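(* Let $G$ be an $m$-uniform hypergraph whose connected components are properly connected. Assume the number of edges of $G$ is equal to the number of nodes of $G$. If $G$ has $c$ connected components and $j(I(G))\neq0$, then $$j(I(G))=m^{c}.$$
   Context: A hypergraph $G$ has a finite non-empty node set $V(G)=\{x_1,\dots,x_n\}$ and an edge set $E(G)$ consisting of subsets of $V(G)$; it is $m$-uniform ($m\ge1$) if every edge has exactly $m$ elements. $G$ is connected if any two nodes can be joined by a sequence of edges, the first containing one node and the last the other, with consecutive edges sharing a node. An $m$-uniform hypergraph is properly connected if for any two edges $u,v$ there is a sequence of edges starting with $u$ and ending with $v$ such that consecutive edges intersect in exactly $m-1$ nodes. Hypergraphs are assumed to have no isolated nodes (nodes lying in no edge); this is automatic when $j(I(G))\ne0$. Fix a field $\Bbbk$ and view nodes as indeterminates. The edge ideal is $I(G)=(x_{i_1}\cdots x_{i_m}:\{x_{i_1},\dots,x_{i_m}\}\in E(G))\subset R=\Bbbk[x_1,\dots,x_n]_{(x_1,\dots,x_n)}$. For an ideal $I$ in a Noetherian local ring $(R,\mathfrak m)$ of dimension $n\ge1$, the $j$-multiplicity is $j(I)=(n-1)!\lim_{t\to\infty}\lambda_R(\Gamma_{\mathfrak m}(I^t/I^{t+1}))/t^{n-1}$, where $\lambda_R$ is length and $\Gamma_{\mathfrak m}$ is the zeroth local cohomology. *)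

theory Defs
  imports
    "HOL-Algebra.Ideal_Product"
    "HOL-Algebra.QuotRing"
    "HOL-Algebra.Module"
    "HOL-Library.Poly_Mapping"
    "HOL-Library.Extended_Real"
begin

section \<open>Hypergraphs\<close>

record 'v hypergraph =
  nodes :: "'v set"
  edges :: "'v set set"

definition hypergraph :: "'v hypergraph \<Rightarrow> bool" where
  "hypergraph G \<longleftrightarrow> finite (nodes G) \<and> nodes G \<noteq> {} \<and> edges G \<subseteq> Pow (nodes G)"

definition uniform :: "nat \<Rightarrow> 'v hypergraph \<Rightarrow> bool" where
  "uniform m G \<longleftrightarrow> (\<forall>e\<in>edges G. card e = m)"

definition no_isolated_nodes :: "'v hypergraph \<Rightarrow> bool" where
  "no_isolated_nodes G \<longleftrightarrow> (\<forall>x\<in>nodes G. \<exists>e\<in>edges G. x \<in> e)"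

definition joined :: "'v hypergraph \<Rightarrow> 'v \<Rightarrow> 'v \<Rightarrow> bool" where
  "joined G x y \<longleftrightarrow>
     (\<exists>es. es \<noteq> [] \<and> set es \<subseteq> edges G \<and> x \<in> hd es \<and> y \<in> last es \<and>
           successively (\<lambda>e f. e \<inter> f \<noteq> {}) es)"

definition induced :: "'v hypergraph \<Rightarrow> 'v set \<Rightarrow> 'v hypergraph" where
  "induced G U = \<lparr>nodes = U, edges = {e \<in> edges G. e \<subseteq> U}\<rparr>"

text \<open>
  Reflexivity is added so that an isolated node, if there were one, would form a component of
  its own; without isolated nodes every node is joined to itself anyway.
\<close>
definition components :: "'v hypergraph \<Rightarrow> 'v hypergraph set" where
  "components G =
     induced G ` (nodes G // {(x, y). x \<in> nodes G \<and> y \<in> nodes G \<and> (x = y \<or> joined G x y)})"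

definition properly_connected :: "nat \<Rightarrow> 'v hypergraph \<Rightarrow> bool" where
  "properly_connected m G \<longleftrightarrow> uniform m G \<and>
     (\<forall>u\<in>edges G. \<forall>v\<in>edges G. \<exists>es. es \<noteq> [] \<and> set es \<subseteq> edges G \<and> hd es = u \<and> last es = v \<and>
        successively (\<lambda>e f. card (e \<inter> f) = m - 1) es)"


section \<open>Localization at a prime ideal\<close>

definition loc_rel :: "('a, 'b) ring_scheme \<Rightarrow> 'a set \<Rightarrow> (('a \<times> 'a) \<times> ('a \<times> 'a)) set" where
  "loc_rel A P = {((a, s), (b, t)). a \<in> carrier A \<and> b \<in> carrier A \<and>
     s \<in> carrier A - P \<and> t \<in> carrier A - P \<and>
     (\<exists>u \<in> carrier A - P. u \<otimes>\<^bsub>A\<^esub> (a \<otimes>\<^bsub>A\<^esub> t) = u \<otimes>\<^bsub>A\<^esub> (b \<otimes>\<^bsub>A\<^esub> s))}"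

definition loc_frac :: "('a, 'b) ring_scheme \<Rightarrow> 'a set \<Rightarrow> 'a \<Rightarrow> 'a \<Rightarrow> ('a \<times> 'a) set" where
  "loc_frac A P a s = loc_rel A P `` {(a, s)}"

definition localization :: "('a, 'b) ring_scheme \<Rightarrow> 'a set \<Rightarrow> ('a \<times> 'a) set ring" where
  "localization A P =
     \<lparr>carrier = (carrier A \<times> (carrier A - P)) // loc_rel A P,
      monoid.mult = (\<lambda>X Y. \<Union>(a, s)\<in>X. \<Union>(b, t)\<in>Y. loc_frac A P (a \<otimes>\<^bsub>A\<^esub> b) (s \<otimes>\<^bsub>A\<^esub> t)),
      one = loc_frac A P \<one>\<^bsub>A\<^esub> \<one>\<^bsub>A\<^esub>,
      zero = loc_frac A P \<zero>\<^bsub>A\<^esub> \<one>\<^bsub>A\<^esub>,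
      add = (\<lambda>X Y. \<Union>(a, s)\<in>X. \<Union>(b, t)\<in>Y.
               loc_frac A P (a \<otimes>\<^bsub>A\<^esub> t \<oplus>\<^bsub>A\<^esub> b \<otimes>\<^bsub>A\<^esub> s) (s \<otimes>\<^bsub>A\<^esub> t))\<rparr>"


section \<open>The $j$-multiplicity\<close>

definition ideal_power :: "('a, 'b) ring_scheme \<Rightarrow> 'a set \<Rightarrow> nat \<Rightarrow> 'a set" where
  "ideal_power R I t = I [^]\<^bsub>ideals_set R\<^esub> t"

definition krull_dim :: "('a, 'b) ring_scheme \<Rightarrow> enat" where
  "krull_dim R = Sup {enat d | d. \<exists>p :: nat \<Rightarrow> 'a set.
     (\<forall>i\<le>d. primeideal (p i) R) \<and> (\<forall>i<d. p i \<subset> p (Suc i))}"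

definition max_ideal :: "('a, 'b) ring_scheme \<Rightarrow> 'a set" where
  "max_ideal R = (THE M. maximalideal M R)"

definition module_length :: "('a, 'r) ring_scheme \<Rightarrow> ('a, 'b, 's) module_scheme \<Rightarrow> enat" where
  "module_length R M = Sup {enat d | d. \<exists>N :: nat \<Rightarrow> 'b set.
     (\<forall>i\<le>d. submodule (N i) R M) \<and> (\<forall>i<d. N i \<subset> N (Suc i))}"

text \<open>
  The record for modules extends the one for rings; its fields for the ring multiplication and
  unit play no role in the theory of modules.
\<close>

definition ideal_module :: "('a, 'b) ring_scheme \<Rightarrow> 'a set \<Rightarrow> ('a, 'a) module" where
  "ideal_module R I =
     \<lparr>carrier = I, monoid.mult = monoid.mult R, one = one R, zero = zero R, add = add R,
      smult = monoid.mult R\<rparr>"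

definition quotient_module :: "('a, 'b) module \<Rightarrow> 'b set \<Rightarrow> ('a, 'b set) module" where
  "quotient_module M N =
     \<lparr>carrier = a_rcosets\<^bsub>M\<^esub> N, monoid.mult = undefined, one = undefined,
      zero = N, add = set_add M,
      smult = (\<lambda>r X. \<Union>x\<in>X. N +>\<^bsub>M\<^esub> (r \<odot>\<^bsub>M\<^esub> x))\<rparr>"

definition local_cohomology_0 ::
    "('a, 'r) ring_scheme \<Rightarrow> 'a set \<Rightarrow> ('a, 'b) module \<Rightarrow> ('a, 'b) module" where
  "local_cohomology_0 R J M =
     M\<lparr>carrier := {x \<in> carrier M. \<exists>k. \<forall>a\<in>ideal_power R J k. a \<odot>\<^bsub>M\<^esub> x = \<zero>\<^bsub>M\<^esub>}\<rparr>"

text \<open>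
  Meant for an ideal of a Noetherian local ring of dimension at least one; there the lengths
  below are finite and the limit exists.
\<close>
definition j_multiplicity :: "('a, 'b) ring_scheme \<Rightarrow> 'a set \<Rightarrow> ereal" where
  "j_multiplicity R I =
     (let n = the_enat (krull_dim R);
          gr = (\<lambda>t. quotient_module (ideal_module R (ideal_power R I t)) (ideal_power R I (t + 1)))
      in ereal (fact (n - 1)) *
         lim (\<lambda>t. ereal_of_enat (module_length R (local_cohomology_0 R (max_ideal R) (gr t)))
                  / ereal (real t ^ (n - 1))))"


section \<open>Edge ideals\<close>

type_synonym ('v, 'k) mpoly = "('v \<Rightarrow>\<^sub>0 nat) \<Rightarrow>\<^sub>0 'k"

definition var :: "'v \<Rightarrow> ('v, 'k::field) mpoly" where
  "var x = Poly_Mapping.single (Poly_Mapping.single x 1) 1"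

text \<open>Polynomials in the variables from \<open>V\<close> only, inside those with variables of type \<open>'v\<close>.\<close>
definition poly_ring :: "'k::field itself \<Rightarrow> 'v set \<Rightarrow> ('v, 'k) mpoly ring" where
  "poly_ring k V =
     \<lparr>carrier = {p. \<forall>t\<in>Poly_Mapping.keys p. Poly_Mapping.keys t \<subseteq> V},
      monoid.mult = (*), one = 1, zero = 0, add = (+)\<rparr>"

definition var_ideal :: "'k::field itself \<Rightarrow> 'v set \<Rightarrow> ('v, 'k) mpoly set" where
  "var_ideal k V = Idl\<^bsub>poly_ring k V\<^esub> (var ` V)"

definition node_ring ::
    "'k::field itself \<Rightarrow> 'v hypergraph \<Rightarrow> (('v, 'k) mpoly \<times> ('v, 'k) mpoly) set ring" where
  "node_ring k G = localization (poly_ring k (nodes G)) (var_ideal k (nodes G))"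

definition edge_ideal ::
    "'k::field itself \<Rightarrow> 'v hypergraph \<Rightarrow> (('v, 'k) mpoly \<times> ('v, 'k) mpoly) set set" where
  "edge_ideal k G = Idl\<^bsub>node_ring k G\<^esub>
     ((\<lambda>e. loc_frac (poly_ring k (nodes G)) (var_ideal k (nodes G)) (\<Prod>x\<in>e. var x) 1) ` edges G)"

end

(*
The torsion of I^t / I^(t+1) is spanned by monomials, so its length counts lattice points.  By Dickson's
lemma each of these monomials is a sum of t edges plus a remainder from a finite set that does not
depend on t.

If the incidence vectors of the edges satisfy an integer relation, the t edges can be chosen with one
of them used a bounded number of times; then there are too few such monomials and j(I) = 0.

Otherwise proper connectedness forces the lattice spanned by the edges to consist of all vectors whose
degree on every component is divisible by m, hence it has m^c cosets.  In each coset all but a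
negligible part of the torsion monomials are the sums of t edges plus the smallest nonnegative
representative, and there are t^(n-1) / (n-1)! of these up to lower order.
*)

theory Submission
  imports Defs "HOL-Library.Disjoint_Sets"
begin

section \<open>Linear systems, Dickson's lemma and compositions\<close>

text \<open>The equality of the numbers of edges and nodes acts twice. The incidence matrix is
  square, so independent edges leave no nonzero functional on the nodes that vanishes on all edges;
  this determines the lattice without a determinant. And \<open>t\<close> can be distributed over
  the edges in about \<open>t ^ (card V - 1) / fact (card V - 1)\<close> ways, the very order by
  which the definition normalises.

  Integer combinations of edges may have negative coefficients and then stand for no product of
  edges. The counting therefore separates multiplicities that are all at least a constant
  \<open>K\<close>, where a fixed combination can be added, from the rest, which is of lower order.

  The field disappears through ideals of fractions whose numerators are supported in an up-closed
  set of exponents: denominators have nonzero constant term, so membership does not depend on the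
  chosen fraction. The normalising exponent is read from the Krull dimension, so that dimension is
  computed too; its upper bound comes from counting monomials to get an algebraic relation and
  following its lexicographically least term along a chain of primes.\<close>

lemma underdetermined_system:
  fixes A :: "'i \<Rightarrow> 'j \<Rightarrow> 'a::idom"
  assumes "finite I" "finite J" "card I < card J"
  shows "\<exists>z. (\<exists>j\<in>J. z j \<noteq> 0) \<and> (\<forall>i\<in>I. (\<Sum>j\<in>J. z j * A i j) = 0)"
  using assms
proof (induction I arbitrary: A J rule: finite_induct)
  case empty
  then obtain j where "j \<in> J"
    by (metis card.empty ex_in_conv less_irrefl)
  then show ?case
    by (intro exI[of _ "\<lambda>_. 1"]) auto
next
  case (insert i I)
  show ?case
  proof (cases "\<forall>j\<in>J. A i j = 0")
    case True
    obtain z where "\<exists>j\<in>J. z j \<noteq> 0" "\<forall>i\<in>I. (\<Sum>j\<in>J. z j * A i j) = 0"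
      using insert.IH[of J A] insert.prems insert.hyps by auto
    then show ?thesis
      using True by (intro exI[of _ z]) auto
  next
    case False
    \<comment> \<open>Fraction-free elimination, so that the result holds over \<open>int\<close> as
      well as over a field: the unknown \<open>q\<close> is removed from every other equation by
      cross-multiplying with the pivot \<open>A i q\<close>.\<close>
    then obtain q where q: "q \<in> J" "A i q \<noteq> 0" by blast
    define J' where "J' = J - {q}"
    have fin: "finite J'" and J: "J = insert q J'" and qJ': "q \<notin> J'"
      using q insert.prems by (auto simp: J'_def)
    have "card I < card J'"
      using insert.prems insert.hyps q by (simp add: J'_def)
    then obtain z where z: "\<exists>j\<in>J'. z j \<noteq> 0"
      "\<forall>l\<in>I. (\<Sum>j\<in>J'. z j * (A i q * A l j - A l q * A i j)) = 0"
      using insert.IH[of J' "\<lambda>l j. A i q * A l j - A l q * A i j"] fin by blast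
    \<comment> \<open>Scaling the reduced solution by the pivot makes equation \<open>i\<close>
      solvable for the unknown \<open>q\<close> without division; the scaled solution stays nonzero
      because there are no zero divisors.\<close>
    define y where "y j = (if j = q then - (\<Sum>j\<in>J'. z j * A i j) else A i q * z j)" for j
    have sum_y: "(\<Sum>j\<in>J. y j * A l j) = A i q * (\<Sum>j\<in>J'. z j * A l j) - A l q * (\<Sum>j\<in>J'. z j * A i j)" for l
    proof -
      have "(\<Sum>j\<in>J'. y j * A l j) = (\<Sum>j\<in>J'. A i q * (z j * A l j))"
        using qJ' by (intro sum.cong) (auto simp: y_def)
      then show ?thesis
        using fin qJ' by (simp add: J y_def sum_distrib_left algebra_simps)
    qed
    have "(\<Sum>j\<in>J. y j * A l j) = 0" if "l \<in> I" for l
    proof -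
      have "A i q * (\<Sum>j\<in>J'. z j * A l j) - A l q * (\<Sum>j\<in>J'. z j * A i j)
        = (\<Sum>j\<in>J'. z j * (A i q * A l j - A l q * A i j))"
        by (simp add: sum_distrib_left sum_subtractf algebra_simps)
      then show ?thesis
        using sum_y[of l] z(2) that by simp
    qed
    moreover have "(\<Sum>j\<in>J. y j * A i j) = 0"
      using sum_y[of i] by simp
    moreover have "\<exists>j\<in>J. y j \<noteq> 0"
      using z(1) q(2) qJ' unfolding J y_def by (metis insertCI mult_eq_0_iff)
    ultimately show ?thesis
      by (intro exI[of _ y]) auto
  qed
qed

lemma dickson:
  fixes S :: "('j \<Rightarrow> nat) set"
  assumes "finite J"
  shows "\<exists>F. finite F \<and> F \<subseteq> S \<and> (\<forall>s\<in>S. \<exists>f\<in>F. \<forall>j\<in>J. f j \<le> s j)"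
  using assms
proof (induction J arbitrary: S rule: finite_induct)
  case empty
  show ?case
  proof (cases "S = {}")
    case False
    then obtain s where "s \<in> S" by blast
    then show ?thesis by (intro exI[of _ "{s}"]) auto
  qed auto
next
  case (insert x J)
  obtain F where F: "finite F" "F \<subseteq> S" "\<forall>s\<in>S. \<exists>f\<in>F. \<forall>j\<in>J. f j \<le> s j"
    using insert.IH[of S] by blast
  have "\<forall>v. \<exists>H. finite H \<and> H \<subseteq> {s\<in>S. s x = v} \<and> (\<forall>s\<in>{s\<in>S. s x = v}. \<exists>f\<in>H. \<forall>j\<in>J. f j \<le> s j)"
    by (intro allI insert.IH)
  from choice[OF this] obtain H where H0: "\<forall>v. finite (H v) \<and> H v \<subseteq> {s\<in>S. s x = v} \<and>
      (\<forall>s\<in>{s\<in>S. s x = v}. \<exists>f\<in>H v. \<forall>j\<in>J. f j \<le> s j)"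
    by (rule exE)
  have H: "finite (H v)" "H v \<subseteq> {s\<in>S. s x = v}"
    "s \<in> S \<Longrightarrow> s x = v \<Longrightarrow> \<exists>f\<in>H v. \<forall>j\<in>J. f j \<le> s j" for v s
    using H0 by auto
  \<comment> \<open>\<open>M\<close> bounds coordinate \<open>x\<close> on \<open>F\<close>, so
    \<open>F\<close> covers every \<open>s\<close> with \<open>s x \<ge> M\<close>; the remaining
    \<open>s\<close> lie in finitely many slices \<open>s x = v\<close> with \<open>v < M\<close>,
    each covered by its own \<open>H v\<close>.\<close>
  define M where "M = (\<Sum>f\<in>F. f x)"
  have M: "f x \<le> M" if "f \<in> F" for f
    using F(1) that unfolding M_def by (intro member_le_sum[of f F "\<lambda>f. f x"]) auto
  have "\<exists>f\<in>F \<union> (\<Union>v<M. H v). \<forall>j\<in>insert x J. f j \<le> s j" if s: "s \<in> S" for s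
  proof (cases "s x < M")
    case True
    obtain f where "f \<in> H (s x)" "\<forall>j\<in>J. f j \<le> s j"
      using H(3)[OF s refl] by blast
    then show ?thesis
      using True H(2)[of "s x"] by (intro bexI[of _ f]) auto
  next
    case False
    obtain f where "f \<in> F" "\<forall>j\<in>J. f j \<le> s j"
      using F(3) s by blast
    then show ?thesis
      using False M[of f] by (intro bexI[of _ f]) auto
  qed
  moreover have "finite (F \<union> (\<Union>v<M. H v))"
    using F H by simp
  moreover have "F \<union> (\<Union>v<M. H v) \<subseteq> S"
    using F H by blast
  ultimately show ?case by blast
qed

text \<open>Weak compositions. The value 0 off \<open>J\<close> makes a function determined by its
  values on \<open>J\<close>, so that the set is finite.\<close>

definition compositions :: "'j set \<Rightarrow> nat \<Rightarrow> ('j \<Rightarrow> nat) set" where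
  "compositions J t = {c. (\<forall>j. j \<notin> J \<longrightarrow> c j = 0) \<and> sum c J = t}"

text \<open>Stars and bars, transported from lists of given length and sum. The truncated
  subtraction is correct for empty \<open>J\<close> too: the value is 1 for \<open>t = 0\<close> and
  0 otherwise.\<close>

lemma card_compositions:
  assumes "finite J"
  shows "finite (compositions J t) \<and> card (compositions J t) = (t + card J - 1) choose t"
proof -
  obtain xs where xs: "set xs = J" "distinct xs"
    using assms finite_distinct_list by blast
  have len: "length xs = card J"
    using xs distinct_card[of xs] by simp
  have "bij_betw (\<lambda>c. map c xs) (compositions J t) {l. length l = card J \<and> sum_list l = t}"
  proof (rule bij_betw_imageI)
    show "inj_on (\<lambda>c. map c xs) (compositions J t)"
    proof (rule inj_onI, rule ext)
      fix c d j
      assume "c \<in> compositions J t" "d \<in> compositions J t" "map c xs = map d xs"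
      then show "c j = d j"
        using xs by (cases "j \<in> J") (auto simp: compositions_def)
    qed
    show "(\<lambda>c. map c xs) ` compositions J t = {l. length l = card J \<and> sum_list l = t}"
    proof (intro equalityI subsetI)
      fix l assume "l \<in> (\<lambda>c. map c xs) ` compositions J t"
      then show "l \<in> {l. length l = card J \<and> sum_list l = t}"
        using xs len by (auto simp: compositions_def sum_list_distinct_conv_sum_set)
    next
      fix l :: "nat list" assume l: "l \<in> {l. length l = card J \<and> sum_list l = t}"
      define c where "c j = (case map_of (zip xs l) j of Some v \<Rightarrow> v | None \<Rightarrow> 0)" for j
      have c: "map c xs = l"
      proof (rule nth_equalityI)
        show "length (map c xs) = length l" using l len by simp
        fix i assume "i < length (map c xs)"
        then show "map c xs ! i = l ! i"
          using l len xs by (simp add: c_def map_of_zip_nth)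
      qed
      moreover have "c j = 0" if "j \<notin> J" for j
      proof -
        have "map_of (zip xs l) j = None"
          using that xs(1) l len by (simp add: map_of_zip_is_None)
        then show ?thesis by (simp add: c_def)
      qed
      moreover have "sum c J = t"
        using c xs l by (metis (mono_tags, lifting) mem_Collect_eq sum_list_distinct_conv_sum_set)
      ultimately show "l \<in> (\<lambda>c. map c xs) ` compositions J t"
        by (intro image_eqI[of _ _ c]) (auto simp: compositions_def)
    qed
  qed
  moreover have "finite {l::nat list. length l = card J \<and> sum_list l = t}"
    by (rule finite_subset[OF _ finite_lists_length_eq[of "{..t}" "card J"]])
       (auto dest: member_le_sum_list)
  ultimately show ?thesis
    using bij_betw_finite bij_betw_same_card card_length_sum_list[of "card J" t] by metis
qed

lemma finite_compositions: "finite J \<Longrightarrow> finite (compositions J t)"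
  using card_compositions[of J t] by simp

text \<open>The binomial is a polynomial in \<open>t\<close> of degree \<open>k\<close> with leading
  coefficient \<open>1 / fact k\<close>; each induction step contributes the factor
  \<open>(t + k + 1) / (k + 1)\<close>.\<close>

lemma choose_asymp:
  "(\<lambda>t. real ((t + k) choose t) / real t ^ k) \<longlonglongrightarrow> 1 / fact k"
proof (induction k)
  case (Suc k)
  have "(\<lambda>t. real ((t + k) choose t) / real t ^ k * ((1 + real (Suc k) / real t) / real (Suc k)))
      \<longlonglongrightarrow> 1 / fact k * ((1 + 0) / real (Suc k))"
    by (intro tendsto_intros Suc.IH lim_const_over_n) auto
  moreover have "\<forall>\<^sub>F t in sequentially.
      real ((t + k) choose t) / real t ^ k * ((1 + real (Suc k) / real t) / real (Suc k))
      = real ((t + Suc k) choose t) / real t ^ Suc k"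
    using eventually_gt_at_top[of 0]
  proof eventually_elim
    case (elim t)
    have "Suc k * (Suc (t + k) choose Suc k) = Suc (t + k) * ((t + k) choose k)"
      by (rule Suc_times_binomial_eq[of "t + k" k, unfolded mult.commute[of _ "Suc k"], symmetric])
    then have *: "real (Suc k) * real (Suc (t + k) choose Suc k) = real (Suc (t + k)) * real ((t + k) choose k)"
      by (metis of_nat_mult)
    have s1: "(t + k) choose t = (t + k) choose k"
      by (metis add_diff_cancel_left' binomial_symmetric le_add1)
    have s2: "(t + Suc k) choose t = Suc (t + k) choose Suc k"
      by (metis add_Suc_right add_diff_cancel_left' binomial_symmetric le_add1)
    have "real (Suc (t + k) choose Suc k) = real (Suc (t + k)) * real ((t + k) choose k) / real (Suc k)"
      using * by (metis nonzero_mult_div_cancel_left of_nat_eq_0_iff nat.simps(3))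
    moreover have "C / T ^ k * ((1 + K / T) / K) = (T + K) * C / K / T ^ Suc k" if "T > 0" "K > 0" for C T K :: real
      using that by (simp add: field_simps)
    ultimately show ?case
      using elim unfolding s1 s2 by (simp add: add_ac del: binomial_Suc_Suc power_Suc)
  qed
  ultimately have "(\<lambda>t. real ((t + Suc k) choose t) / real t ^ Suc k) \<longlonglongrightarrow> 1 / fact k * ((1 + 0) / real (Suc k))"
    by (rule Lim_transform_eventually)
  then show ?case
    by (simp add: field_simps)
qed auto

lemma compositions_asymp:
  assumes "finite J" "J \<noteq> {}"
  shows "(\<lambda>t. real (card (compositions J t)) / real t ^ (card J - 1)) \<longlonglongrightarrow> 1 / fact (card J - 1)"
proof -
  have "card J > 0" using assms by (simp add: card_gt_0_iff)
  then have "card (compositions J t) = (t + (card J - 1)) choose t" for t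
    using card_compositions[OF assms(1), of t] by simp
  then show ?thesis
    using choose_asymp[of "card J - 1"] by simp
qed

text \<open>A fixed shift changes the leading term only by a power of \<open>1 - s / t\<close>,
  which tends to 1.\<close>

lemma compositions_shift_asymp:
  assumes "finite J" "J \<noteq> {}"
  shows "(\<lambda>t. real (card (compositions J (t - s))) / real t ^ (card J - 1)) \<longlonglongrightarrow> 1 / fact (card J - 1)"
proof -
  let ?d = "card J - 1"
  have 1: "filterlim (\<lambda>t. t - s) sequentially sequentially"
    by (simp add: filterlim_minus_const_nat_at_top)
  have "(\<lambda>t. 1 - real s / real t) \<longlonglongrightarrow> 1 - 0"
    by (intro tendsto_intros lim_const_over_n)
  then have "(\<lambda>t. real (card (compositions J (t - s))) / real (t - s) ^ ?d * (1 - real s / real t) ^ ?d)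
      \<longlonglongrightarrow> 1 / fact ?d * (1 - 0) ^ ?d"
    by (intro tendsto_intros filterlim_compose[OF compositions_asymp[OF assms] 1])
  moreover have "\<forall>\<^sub>F t in sequentially.
      real (card (compositions J (t - s))) / real (t - s) ^ ?d * (1 - real s / real t) ^ ?d
      = real (card (compositions J (t - s))) / real t ^ ?d"
    using eventually_gt_at_top[of s]
  proof eventually_elim
    case (elim t)
    have "1 - real s / real t = real (t - s) / real t"
      using elim by (simp add: field_simps of_nat_diff)
    then show ?case
      using elim by (simp add: power_divide)
  qed
  ultimately show ?thesis
    using Lim_transform_eventually by fastforce
qed

lemma card_compositions_ge:
  assumes "finite J" "card J * K \<le> t"
  shows "card {c \<in> compositions J t. \<forall>j\<in>J. K \<le> c j} = card (compositions J (t - card J * K))"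
proof -
  have "bij_betw (\<lambda>c j. if j \<in> J then c j + K else 0) (compositions J (t - card J * K))
      {c \<in> compositions J t. \<forall>j\<in>J. K \<le> c j}"
    by (rule bij_betw_byWitness[of _ "\<lambda>c j. c j - K"])
       (use assms in \<open>auto simp: compositions_def fun_eq_iff sum.distrib sum_subtractf_nat\<close>)
  from bij_betw_same_card[OF this] show ?thesis by simp
qed

lemma card_compositions_lt:
  assumes "finite J" "card J * K \<le> t"
  shows "card {c \<in> compositions J t. \<exists>j\<in>J. c j < K}
    = card (compositions J t) - card (compositions J (t - card J * K))"
proof -
  have "{c \<in> compositions J t. \<exists>j\<in>J. c j < K} = compositions J t - {c \<in> compositions J t. \<forall>j\<in>J. K \<le> c j}"
    by (auto simp: not_le)
  then show ?thesis
    using card_Diff_subset[of "{c \<in> compositions J t. \<forall>j\<in>J. K \<le> c j}" "compositions J t"]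
      card_compositions_ge[OF assms] finite_compositions[OF assms(1), of t]
    by (metis (no_types, lifting) finite_subset mem_Collect_eq subsetI)
qed

text \<open>Lowering every part by \<open>K\<close> turns the compositions with all parts at least
  \<open>K\<close> into those of \<open>t - card J * K\<close>. They have the same leading term as
  all compositions, so the complement is of lower order.\<close>

lemma compositions_lt_asymp:
  assumes "finite J" "J \<noteq> {}"
  shows "(\<lambda>t. real (card {c \<in> compositions J t. \<exists>j\<in>J. c j < K}) / real t ^ (card J - 1)) \<longlonglongrightarrow> 0"
proof -
  let ?d = "card J - 1"
  have "(\<lambda>t. real (card (compositions J t)) / real t ^ ?d
        - real (card (compositions J (t - card J * K))) / real t ^ ?d) \<longlonglongrightarrow> 1 / fact ?d - 1 / fact ?d"
    by (intro tendsto_intros compositions_asymp compositions_shift_asymp assms)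
  moreover have "\<forall>\<^sub>F t in sequentially. real (card (compositions J t)) / real t ^ ?d
        - real (card (compositions J (t - card J * K))) / real t ^ ?d
      = real (card {c \<in> compositions J t. \<exists>j\<in>J. c j < K}) / real t ^ ?d"
    using eventually_ge_at_top[of "card J * K"]
  proof eventually_elim
    case (elim t)
    have "card {c \<in> compositions J t. \<forall>j\<in>J. K \<le> c j} \<le> card (compositions J t)"
      using finite_compositions[OF assms(1)] by (intro card_mono) auto
    then show ?case
      using card_compositions_lt[OF assms(1) elim] card_compositions_ge[OF assms(1) elim]
      by (simp add: of_nat_diff diff_divide_distrib)
  qed
  ultimately show ?thesis
    using Lim_transform_eventually by fastforce
qed

section \<open>The lattice spanned by the edges\<close>

text \<open>The hypergraph reduced to what the counting uses, with \<open>Us\<close> as the node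
  sets of the components. Proper connectedness appears as a reflexive-transitive closure so that an
  invariant of single exchanges can be propagated by induction.\<close>

locale uniform_components =
  fixes V :: "'v set" and E :: "'v set set" and m :: nat and Us :: "'v set set"
  assumes finite_V: "finite V" and V_ne: "V \<noteq> {}"
    and partition: "partition_on V Us"
    and edge_card: "e \<in> E \<Longrightarrow> card e = m" and m_pos: "m \<ge> 1"
    and edge_component: "e \<in> E \<Longrightarrow> \<exists>U\<in>Us. e \<subseteq> U"
    and covered: "x \<in> V \<Longrightarrow> \<exists>e\<in>E. x \<in> e"
    and chain: "U \<in> Us \<Longrightarrow> e \<in> E \<Longrightarrow> f \<in> E \<Longrightarrow> e \<subseteq> U \<Longrightarrow> f \<subseteq> U \<Longrightarrow>
      (e, f) \<in> {(e, f). e \<in> E \<and> f \<in> E \<and> e \<subseteq> U \<and> f \<subseteq> U \<and> card (e \<inter> f) = m - 1}\<^sup>*"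
    and card_E: "card E = card V"
begin

lemma edge_subset: "e \<in> E \<Longrightarrow> e \<subseteq> V"
  using edge_component[of e] partition_onD1[OF partition] by auto

lemma finite_E: "finite E"
  by (rule finite_subset[of E "Pow V"]) (use finite_V edge_subset in auto)

lemma finite_edge: "e \<in> E \<Longrightarrow> finite e"
  using finite_subset[OF edge_subset finite_V] .

lemma component_subset: "U \<in> Us \<Longrightarrow> U \<subseteq> V"
  using partition_onD1[OF partition] by auto

lemma component_ne: "U \<in> Us \<Longrightarrow> U \<noteq> {}"
  using partition_onD3[OF partition] by auto

lemma component_unique: "U \<in> Us \<Longrightarrow> U' \<in> Us \<Longrightarrow> x \<in> U \<Longrightarrow> x \<in> U' \<Longrightarrow> U = U'"
  using disjointD[OF partition_onD2[OF partition], of U U'] by auto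

lemma finite_component: "U \<in> Us \<Longrightarrow> finite U"
  using finite_subset[OF component_subset finite_V] .

lemma finite_Us: "finite Us"
  using finite_elements[OF finite_V partition] .

lemma E_ne: "E \<noteq> {}"
  using covered V_ne by auto

text \<open>The incidence matrix applied to \<open>c\<close>: for natural multiplicities this is the
  exponent vector of a product of edges. The value type stays open because integer relations between
  edges are needed as well.\<close>

definition inc :: "('v set \<Rightarrow> 'a::comm_monoid_add) \<Rightarrow> 'v \<Rightarrow> 'a" where
  "inc c x = (\<Sum>e\<in>{e \<in> E. x \<in> e}. c e)"

lemma inc_if: "inc c x = (\<Sum>e\<in>E. if x \<in> e then c e else 0)"
  unfolding inc_def using finite_E by (simp add: sum.inter_filter)

lemma inc_add: "inc (\<lambda>e. c e + d e) x = inc c x + inc d x"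
  by (simp add: inc_def sum.distrib)

lemma inc_diff: "inc (\<lambda>e. c e - d e) x = inc c x - inc d x"
  for c d :: "'v set \<Rightarrow> 'a::ab_group_add"
  by (simp add: inc_def sum_subtractf)

lemma inc_scale: "inc (\<lambda>e. k * c e) x = k * inc c x" for k :: "'a::semiring_0"
  by (simp add: inc_def sum_distrib_left)

lemma inc_int: "inc (\<lambda>e. int (c e)) x = int (inc c x)"
  by (simp add: inc_def)

lemma inc_single: "e \<in> E \<Longrightarrow> inc (\<lambda>f. if f = e then 1 else 0) x = (if x \<in> e then 1 else 0)"
  using finite_E by (simp add: inc_def)

text \<open>Double counting of incident pairs, that is, transposition of the incidence matrix: a
  functional on nodes is tested on the edges instead.\<close>

lemma sum_inc_weighted:
  fixes \<phi> :: "'v \<Rightarrow> 'a::comm_semiring_1"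
  assumes "U \<subseteq> V"
  shows "(\<Sum>x\<in>U. \<phi> x * inc c x) = (\<Sum>e\<in>E. c e * (\<Sum>x\<in>e \<inter> U. \<phi> x))"
proof -
  have fin: "finite U" using assms finite_V finite_subset by blast
  have "(\<Sum>x\<in>U. \<phi> x * inc c x) = (\<Sum>x\<in>U. \<Sum>e\<in>E. if x \<in> e then c e * \<phi> x else 0)"
    by (intro sum.cong refl) (simp add: inc_if sum_distrib_left if_distrib mult.commute cong: if_cong)
  also have "\<dots> = (\<Sum>e\<in>E. \<Sum>x\<in>U. if x \<in> e then c e * \<phi> x else 0)"
    by (rule sum.swap)
  also have "\<dots> = (\<Sum>e\<in>E. c e * (\<Sum>x\<in>e \<inter> U. \<phi> x))"
    using fin by (intro sum.cong refl) (simp add: sum_distrib_left sum.inter_restrict[symmetric] Int_commute)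
  finally show ?thesis .
qed

text \<open>An edge lies inside a component or misses it, so it contributes \<open>m\<close> or 0.
  This is the source of all divisibility by \<open>m\<close>.\<close>

lemma sum_inc_component:
  fixes c :: "'v set \<Rightarrow> 'a::comm_semiring_1"
  assumes "U \<in> Us"
  shows "(\<Sum>x\<in>U. inc c x) = of_nat m * (\<Sum>e\<in>{e\<in>E. e \<subseteq> U}. c e)"
proof -
  have "(\<Sum>x\<in>U. inc c x) = (\<Sum>e\<in>E. c e * (\<Sum>x\<in>e \<inter> U. 1))"
    using sum_inc_weighted[of U "\<lambda>_. 1" c] component_subset[OF assms] by simp
  also have "\<dots> = (\<Sum>e\<in>E. if e \<subseteq> U then of_nat m * c e else 0)"
  proof (intro sum.cong refl)
    fix e assume e: "e \<in> E"
    show "c e * (\<Sum>x\<in>e \<inter> U. 1) = (if e \<subseteq> U then of_nat m * c e else 0)"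
    proof (cases "e \<subseteq> U")
      case True
      then show ?thesis using edge_card[OF e] by (simp add: Int_absorb2 mult.commute)
    next
      case False
      then have "e \<inter> U = {}"
        using edge_component[OF e] component_unique assms by blast
      then show ?thesis using False by simp
    qed
  qed
  also have "\<dots> = of_nat m * (\<Sum>e\<in>{e\<in>E. e \<subseteq> U}. c e)"
    using finite_E by (simp add: sum.inter_filter sum_distrib_left if_distrib cong: if_cong)
  finally show ?thesis .
qed

lemma sum_inc: "(\<Sum>x\<in>V. inc c x) = of_nat m * sum c E"
  for c :: "'v set \<Rightarrow> 'a::comm_semiring_1"
proof -
  have "(\<Sum>x\<in>V. inc c x) = (\<Sum>e\<in>E. c e * (\<Sum>x\<in>e \<inter> V. 1))"
    using sum_inc_weighted[of V "\<lambda>_. 1" c] by simp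
  also have "\<dots> = (\<Sum>e\<in>E. of_nat m * c e)"
    using edge_subset edge_card by (intro sum.cong refl) (simp add: Int_absorb2 mult.commute)
  finally show ?thesis by (simp add: sum_distrib_left)
qed

text \<open>Independence over the integers is the same as over the rationals; as
  \<open>card E = card V\<close>, the condition says that the incidence matrix has nonzero
  determinant.\<close>

definition nonsingular :: bool where
  "nonsingular \<longleftrightarrow> (\<forall>z :: 'v set \<Rightarrow> int. (\<forall>x\<in>V. inc z x = 0) \<longrightarrow> (\<forall>e\<in>E. z e = 0))"

text \<open>Row independence of a square matrix from column independence. Dropping the row of
  \<open>x0\<close> leaves fewer equations than unknowns, hence a nonzero \<open>z\<close> whose
  incidence sums vanish off \<open>x0\<close>. Pairing with \<open>\<phi>\<close> gives
  \<open>\<phi> x0 * inc z x0 = 0\<close>, so \<open>\<phi> x0 \<noteq> 0\<close> would make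
  \<open>z\<close> a relation between the edges.\<close>

lemma functional_zero:
  fixes \<phi> :: "'v \<Rightarrow> int"
  assumes ns: nonsingular and \<phi>: "\<And>e. e \<in> E \<Longrightarrow> (\<Sum>x\<in>e. \<phi> x) = 0" and x0: "x0 \<in> V"
  shows "\<phi> x0 = 0"
proof (rule ccontr)
  assume neq: "\<phi> x0 \<noteq> 0"
  have "card (V - {x0}) < card E"
    using card_E x0 finite_V by (metis card_Diff1_less)
  then obtain z :: "'v set \<Rightarrow> int" where z: "\<exists>e\<in>E. z e \<noteq> 0"
    "\<forall>x\<in>V - {x0}. (\<Sum>e\<in>E. z e * (if x \<in> e then 1 else 0)) = 0"
    using underdetermined_system[of "V - {x0}" E "\<lambda>x e. if x \<in> e then 1 else 0 :: int"]
      finite_V finite_E by auto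
  have inc0: "inc z x = 0" if "x \<in> V - {x0}" for x
    using z(2) that by (simp add: inc_if if_distrib cong: if_cong)
  have "(\<Sum>x\<in>V. \<phi> x * inc z x) = (\<Sum>e\<in>E. z e * (\<Sum>x\<in>e \<inter> V. \<phi> x))"
    by (rule sum_inc_weighted) simp
  also have "\<dots> = 0"
    using \<phi> edge_subset by (intro sum.neutral) (simp add: Int_absorb2)
  finally have "\<phi> x0 * inc z x0 = 0"
    using inc0 finite_V x0 by (simp add: sum.remove[of V x0])
  then have "\<forall>x\<in>V. inc z x = 0"
    using neq inc0 by auto
  then show False
    using ns z(1) unfolding nonsingular_def by blast
qed

text \<open>Values off \<open>V\<close> are left free, so identities between vectors have to be
  verified on \<open>V\<close> only (\<open>lattice_cong\<close>).\<close>

definition lattice :: "('v \<Rightarrow> int) set" where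
  "lattice = {h. \<exists>z. \<forall>x\<in>V. h x = inc z x}"

lemma lattice_add: "h \<in> lattice \<Longrightarrow> g \<in> lattice \<Longrightarrow> (\<lambda>x. h x + g x) \<in> lattice"
  unfolding lattice_def
  by (clarsimp, rule_tac x = "\<lambda>e. z e + za e" in exI) (simp add: inc_add)

lemma lattice_scale: "h \<in> lattice \<Longrightarrow> (\<lambda>x. k * h x) \<in> lattice"
  unfolding lattice_def
  by (clarsimp, rule_tac x = "\<lambda>e. k * z e" in exI) (simp add: inc_scale)

lemma lattice_cong: "h \<in> lattice \<Longrightarrow> (\<And>x. x \<in> V \<Longrightarrow> h x = g x) \<Longrightarrow> g \<in> lattice"
  unfolding lattice_def by auto

lemma lattice_diff: "h \<in> lattice \<Longrightarrow> g \<in> lattice \<Longrightarrow> (\<lambda>x. h x - g x) \<in> lattice"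
  by (rule lattice_cong[OF lattice_add[OF _ lattice_scale[of g "- 1"]]]) auto

lemma lattice_zero: "(\<lambda>x. 0) \<in> lattice"
  unfolding lattice_def by (auto intro!: exI[of _ "\<lambda>_. 0"] simp: inc_def)

lemma lattice_sum:
  assumes "finite A" "\<And>i. i \<in> A \<Longrightarrow> h i \<in> lattice"
  shows "(\<lambda>x. \<Sum>i\<in>A. h i x) \<in> lattice"
  using assms by (induction A rule: finite_induct) (auto intro: lattice_add lattice_zero)

lemma lattice_edge: "e \<in> E \<Longrightarrow> (\<lambda>x. if x \<in> e then 1 else 0) \<in> lattice"
  unfolding lattice_def by (auto intro!: exI[of _ "\<lambda>f. if f = e then 1 else 0"] simp: inc_single)

abbreviation \<delta> :: "'v \<Rightarrow> 'v \<Rightarrow> int" where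
  "\<delta> x \<equiv> (\<lambda>y. if y = x then 1 else 0)"

text \<open>Here proper connectedness yields lattice vectors: edges sharing \<open>m - 1\<close>
  nodes differ by exchanging one node, and their difference is the difference of two unit
  vectors.\<close>

lemma lattice_swap:
  assumes "e \<in> E" "f \<in> E" "card (e \<inter> f) = m - 1"
  obtains p q D where "e = insert p D" "f = insert q D" "p \<notin> D" "q \<notin> D"
    "(\<lambda>x. \<delta> p x - \<delta> q x) \<in> lattice"
proof -
  have "card (e - f) = 1" "card (f - e) = 1"
    using assms edge_card finite_edge m_pos card_Diff_subset_Int[of e f] card_Diff_subset_Int[of f e]
    by (simp_all add: Int_commute)
  then obtain p q where pq: "e - f = {p}" "f - e = {q}"
    by (metis card_1_singletonE)
  have "(\<lambda>x. (if x \<in> e then 1 else 0) - (if x \<in> f then 1 else 0)) \<in> lattice"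
    using assms by (intro lattice_diff lattice_edge)
  then have "(\<lambda>x. \<delta> p x - \<delta> q x) \<in> lattice"
    by (rule lattice_cong) (use pq in auto)
  moreover have "e = insert p (e \<inter> f)" "f = insert q (e \<inter> f)" "p \<notin> e \<inter> f" "q \<notin> e \<inter> f"
    using pq by blast+
  ultimately show ?thesis using that by blast
qed

text \<open>The nodes equivalent to \<open>x\<close> modulo the lattice meet all edges of the component in equally many
  nodes, which yields a functional vanishing on all edges.\<close>
lemma lattice_delta_diff:
  assumes ns: nonsingular and U: "U \<in> Us" and x: "x \<in> U" and y: "y \<in> U"
  shows "(\<lambda>v. \<delta> x v - \<delta> y v) \<in> lattice"
proof -
  define W where "W = {w \<in> U. (\<lambda>v. \<delta> x v - \<delta> w v) \<in> lattice}"
  have xW: "x \<in> W"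
    using x lattice_zero by (simp add: W_def)
  have step: "card (e \<inter> W) = card (f \<inter> W)"
    if ef: "e \<in> E" "f \<in> E" "e \<subseteq> U" "f \<subseteq> U" "card (e \<inter> f) = m - 1" for e f
  proof -
    obtain p q D where pq: "e = insert p D" "f = insert q D" "p \<notin> D" "q \<notin> D"
      and l: "(\<lambda>v. \<delta> p v - \<delta> q v) \<in> lattice"
      using lattice_swap[OF ef(1,2,5)] by blast
    \<comment> \<open>\<open>p\<close> and \<open>q\<close> are equivalent modulo the lattice, so
      exchanging them leaves the number of nodes in \<open>W\<close> unchanged.\<close>
    have "p \<in> W \<Longrightarrow> q \<in> W"
      using lattice_add[OF _ l, of "\<lambda>v. \<delta> x v - \<delta> p v"] pq ef unfolding W_def by (auto simp: algebra_simps)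
    moreover have "q \<in> W \<Longrightarrow> p \<in> W"
      using lattice_diff[OF _ l, of "\<lambda>v. \<delta> x v - \<delta> q v"] pq ef unfolding W_def by (auto simp: algebra_simps)
    moreover have "finite D"
      using finite_edge[OF ef(1)] pq by simp
    ultimately show ?thesis
      using pq by (cases "p \<in> W") (auto simp: Int_insert_left)
  qed
  obtain e0 where e0: "e0 \<in> E" "x \<in> e0"
    using covered component_subset[OF U] x by blast
  then have e0U: "e0 \<subseteq> U"
    using edge_component component_unique U x by blast
  define k where "k = card (e0 \<inter> W)"
  have cards: "card (e \<inter> W) = k" if e: "e \<in> E" "e \<subseteq> U" for e
  proof -
    have "(e0, e) \<in> {(e, f). e \<in> E \<and> f \<in> E \<and> e \<subseteq> U \<and> f \<subseteq> U \<and> card (e \<inter> f) = m - 1}\<^sup>*"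
      using chain[OF U e0(1) e(1) e0U e(2)] .
    then show ?thesis
      by (induction rule: rtrancl_induct) (use step in \<open>auto simp: k_def\<close>)
  qed
  \<comment> \<open>The weights are balanced: an edge inside \<open>U\<close> gets
    \<open>m * k - k * m = 0\<close>, all other edges miss \<open>U\<close>. Once
    \<open>\<phi>\<close> is known to vanish, its value at \<open>x\<close> gives
    \<open>m = k\<close>, and its value at \<open>y\<close> then forces
    \<open>y \<in> W\<close>.\<close>
  define \<phi> :: "'v \<Rightarrow> int" where
    "\<phi> v = (if v \<in> W then int m else 0) - (if v \<in> U then int k else 0)" for v
  have "(\<Sum>v\<in>e. \<phi> v) = 0" if e: "e \<in> E" for e
  proof -
    have "(\<Sum>v\<in>e. \<phi> v) = int m * int (card (e \<inter> W)) - int k * int (card (e \<inter> U))"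
      using finite_edge[OF e] by (simp add: \<phi>_def sum_subtractf sum.inter_restrict[symmetric] mult.commute)
    also have "\<dots> = 0"
    proof (cases "e \<subseteq> U")
      case True
      then show ?thesis using cards[OF e] edge_card[OF e] by (simp add: Int_absorb2)
    next
      case False
      then have "e \<inter> U = {}"
        using edge_component[OF e] component_unique U by blast
      moreover have "W \<subseteq> U" by (auto simp: W_def)
      ultimately have "e \<inter> U = {}" "e \<inter> W = {}" by auto
      then show ?thesis by simp
    qed
    finally show ?thesis .
  qed
  then have \<phi>0: "\<phi> v = 0" if "v \<in> V" for v
    using functional_zero[OF ns] that by blast
  have "int m = int k"
    using \<phi>0[of x] xW x component_subset[OF U] by (auto simp: \<phi>_def)
  then have "y \<in> W"
    using \<phi>0[of y] y component_subset[OF U] m_pos by (auto simp: \<phi>_def split: if_splits)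
  then show ?thesis by (simp add: W_def)
qed

text \<open>All \<open>m\<close> nodes of an edge through \<open>x\<close> are moved onto
  \<open>x\<close> by \<open>lattice_delta_diff\<close>.\<close>

lemma lattice_delta:
  assumes ns: nonsingular and x: "x \<in> V"
  shows "(\<lambda>v. int m * \<delta> x v) \<in> lattice"
proof -
  obtain e where e: "e \<in> E" "x \<in> e" using covered x by blast
  then obtain U where U: "U \<in> Us" "e \<subseteq> U" using edge_component by blast
  have "(\<lambda>v. (\<Sum>y\<in>e. \<delta> x v - \<delta> y v)) \<in> lattice"
    using e U by (intro lattice_sum lattice_delta_diff[OF ns U(1)] finite_edge) auto
  then have "(\<lambda>v. (\<Sum>y\<in>e. \<delta> x v - \<delta> y v) + (if v \<in> e then 1 else 0)) \<in> lattice"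
    by (intro lattice_add lattice_edge e)
  then show ?thesis
    by (rule lattice_cong)
       (use edge_card[OF e(1)] finite_edge[OF e(1)] in \<open>simp add: sum_subtractf sum.delta\<close>)
qed

lemma sum_V: "(\<Sum>x\<in>V. h x) = (\<Sum>U\<in>Us. \<Sum>x\<in>U. h x)"
proof -
  have "V = \<Union> Us"
    using partition by (simp add: partition_on_def)
  moreover have "\<forall>U\<in>Us. \<forall>U'\<in>Us. U \<noteq> U' \<longrightarrow> U \<inter> U' = {}"
    using component_unique by blast
  ultimately show ?thesis
    using finite_component by (simp add: sum.Union_disjoint o_def)
qed

text \<open>On each component the whole of \<open>h\<close> is moved to the single node
  \<open>r U\<close>. What accumulates there is a multiple of \<open>m\<close> by assumption, so
  \<open>lattice_delta\<close> applies.\<close>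

lemma mem_lattice:
  fixes h :: "'v \<Rightarrow> int"
  assumes ns: nonsingular and h: "\<And>U. U \<in> Us \<Longrightarrow> int m dvd (\<Sum>x\<in>U. h x)"
  shows "h \<in> lattice"
proof -
  define r where "r U = (SOME x. x \<in> U)" for U :: "'v set"
  have r: "r U \<in> U" if "U \<in> Us" for U
    unfolding r_def using component_ne[OF that] some_in_eq by blast
  obtain q where q: "\<And>U. U \<in> Us \<Longrightarrow> (\<Sum>x\<in>U. h x) = int m * q U"
    using h unfolding dvd_def by metis
  have "(\<lambda>v. \<Sum>U\<in>Us. (\<Sum>x\<in>U. h x * (\<delta> x v - \<delta> (r U) v)) + q U * (int m * \<delta> (r U) v)) \<in> lattice"
    using finite_Us finite_component r component_subset
    by (intro lattice_sum lattice_add lattice_scale lattice_delta_diff[OF ns] lattice_delta[OF ns]) auto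
  then show ?thesis
  proof (rule lattice_cong)
    fix v assume v: "v \<in> V"
    have "(\<Sum>U\<in>Us. (\<Sum>x\<in>U. h x * (\<delta> x v - \<delta> (r U) v)) + q U * (int m * \<delta> (r U) v))
      = (\<Sum>U\<in>Us. \<Sum>x\<in>U. h x * \<delta> x v)"
    proof (intro sum.cong refl)
      fix U assume "U \<in> Us"
      then show "(\<Sum>x\<in>U. h x * (\<delta> x v - \<delta> (r U) v)) + q U * (int m * \<delta> (r U) v) = (\<Sum>x\<in>U. h x * \<delta> x v)"
        using q[of U] by (simp add: right_diff_distrib sum_subtractf sum_distrib_right[symmetric])
    qed
    also have "\<dots> = (\<Sum>x\<in>V. h x * \<delta> x v)"
      by (rule sum_V[symmetric])
    also have "\<dots> = h v"
      using v finite_V by (simp add: if_distrib sum.delta cong: if_cong)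
    finally show "(\<Sum>U\<in>Us. (\<Sum>x\<in>U. h x * (\<delta> x v - \<delta> (r U) v)) + q U * (int m * \<delta> (r U) v)) = h v" .
  qed
qed

end

section \<open>Counting torsion monomials\<close>

context uniform_components
begin

text \<open>An exponent vector \<open>h\<close> stands for a monomial: \<open>dominates t h\<close> says that it lies in the \<open>t\<close>-th power
  of the edge ideal \<open>I\<close>, and \<open>torsion t\<close> is a basis of the torsion of \<open>I^t / I^(t+1)\<close>.\<close>
definition dominates :: "nat \<Rightarrow> ('v \<Rightarrow> nat) \<Rightarrow> bool" where
  "dominates t h \<longleftrightarrow> (\<exists>c. t \<le> sum c E \<and> (\<forall>x\<in>V. inc c x \<le> h x))"

definition torsion :: "nat \<Rightarrow> ('v \<Rightarrow> nat) set" where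
  "torsion t = {h. (\<forall>x. x \<notin> V \<longrightarrow> h x = 0) \<and> dominates t h \<and> \<not> dominates (t + 1) h \<and>
     (\<forall>x\<in>V. \<exists>N. dominates (t + 1) (h(x := h x + N)))}"

definition box :: "nat \<Rightarrow> ('v \<Rightarrow> nat) set" where
  "box M = {b. \<forall>x. (x \<in> V \<longrightarrow> b x < M) \<and> (x \<notin> V \<longrightarrow> b x = 0)}"

lemma finite_box: "finite (box M)"
proof -
  have "box M \<subseteq> {b. \<forall>x. (x \<in> V \<longrightarrow> b x \<in> {..<M}) \<and> (x \<notin> V \<longrightarrow> b x = 0)}"
    by (auto simp: box_def)
  then show ?thesis
    using finite_set_of_finite_funs[OF finite_V finite_lessThan] finite_subset by blast
qed

lemma dominates_mono: "dominates t h \<Longrightarrow> (\<And>x. x \<in> V \<Longrightarrow> h x \<le> g x) \<Longrightarrow> dominates t g"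
  unfolding dominates_def by (meson order_trans)

lemma inc_outside: "x \<notin> V \<Longrightarrow> inc c x = 0"
  using edge_subset unfolding inc_def by (intro sum.neutral) auto

lemma inc_cong: "(\<And>e. e \<in> E \<Longrightarrow> c e = d e) \<Longrightarrow> inc c x = inc d x"
  unfolding inc_def by (intro sum.cong) auto

text \<open>The pairs \<open>(b, c)\<close> for which \<open>b\<close> plus the edges with multiplicities \<open>c\<close> becomes an element of
  \<open>I^(t+1)\<close> after raising any one exponent form an up-closed set; its finitely many minimal elements
  bound \<open>b\<close> uniformly in \<open>t\<close>.\<close>
lemma torsion_bounded:
  "\<exists>M. \<forall>t. \<forall>h\<in>torsion t. \<exists>c\<in>compositions E t. \<exists>b\<in>box M. h = (\<lambda>x. inc c x + b x)"
proof -
  let ?c = "\<lambda>s::'v + 'v set \<Rightarrow> nat. \<lambda>e. s (Inr e)"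
  \<comment> \<open>The power is computed from \<open>s\<close> itself, so one set \<open>S\<close>
    serves all \<open>t\<close> at once, and the exponents \<open>N\<close> have to be controlled
    only on its finitely many minimal elements.\<close>
  define P where "P s x N \<longleftrightarrow>
    dominates (sum (?c s) E + 1) (\<lambda>y. inc (?c s) y + s (Inl y) + (if y = x then N else 0))" for s x N
  define S where "S = {s. \<forall>x\<in>V. \<exists>N. P s x N}"
  obtain F where F: "finite F" "F \<subseteq> S" "\<forall>s\<in>S. \<exists>f\<in>F. \<forall>j\<in>Sum_Type.Plus V E. f j \<le> s j"
    using dickson[OF finite_Plus[OF finite_V finite_E], of S] by blast
  have "\<forall>s\<in>S. \<exists>N. \<forall>x\<in>V. P s x (N x)"
  proof
    fix s assume "s \<in> S"
    then have "\<forall>x\<in>V. \<exists>N. P s x N" unfolding S_def mem_Collect_eq .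
    from bchoice[OF this] show "\<exists>N. \<forall>x\<in>V. P s x (N x)" .
  qed
  from bchoice[OF this] obtain N where N0: "\<forall>s\<in>S. \<forall>x\<in>V. P s x (N s x)"
    by (rule exE)
  have N: "P s x (N s x)" if "s \<in> S" "x \<in> V" for s x
    using bspec[OF bspec[OF N0 that(1)] that(2)] .
  define M where "M = (\<Sum>f\<in>F. \<Sum>x\<in>V. f (Inl x) + N f x + 1)"
  have M: "f (Inl x) + N f x < M" if f: "f \<in> F" and x: "x \<in> V" for f x
  proof -
    have "f (Inl x) + N f x + 1 \<le> (\<Sum>x\<in>V. f (Inl x) + N f x + 1)"
      using x finite_V by (intro member_le_sum[of x V "\<lambda>x. f (Inl x) + N f x + 1"]) auto
    also have "\<dots> \<le> M"
      unfolding M_def using f F(1)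
      by (intro member_le_sum[of f F "\<lambda>f. \<Sum>x\<in>V. f (Inl x) + N f x + 1"]) auto
    finally show ?thesis by simp
  qed
  have "\<exists>c\<in>compositions E t. \<exists>b\<in>box M. h = (\<lambda>x. inc c x + b x)" if h: "h \<in> torsion t" for t h
  proof -
    obtain c0 where c0: "t \<le> sum c0 E" "\<forall>x\<in>V. inc c0 x \<le> h x"
      using h unfolding torsion_def dominates_def by blast
    have ndom: "\<not> dominates (t + 1) h"
      using h by (simp add: torsion_def)
    have t: "sum c0 E = t"
      using c0 ndom unfolding dominates_def by (metis Suc_eq_plus1 Suc_leI le_neq_implies_less)
    define c where "c e = (if e \<in> E then c0 e else 0)" for e
    have c: "c \<in> compositions E t"
      using t by (simp add: compositions_def c_def)
    have "inc c x = inc c0 x" for x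
      by (rule inc_cong) (simp add: c_def)
    then have cle: "inc c x \<le> h x" if "x \<in> V" for x
      using c0 that by simp
    define b where "b x = h x - inc c x" for x
    have hb: "h = (\<lambda>x. inc c x + b x)"
    proof
      fix x show "h x = inc c x + b x"
        using cle[of x] inc_outside[of x c] h by (cases "x \<in> V") (auto simp: b_def torsion_def)
    qed
    define s where "s = case_sum b c"
    have "s \<in> S"
      unfolding S_def
    proof safe
      fix x assume "x \<in> V"
      then obtain K where "dominates (t + 1) (h(x := h x + K))"
        using h by (auto simp: torsion_def)
      then show "\<exists>K. P s x K"
        using c hb by (intro exI[of _ K]) (auto simp: P_def s_def compositions_def elim!: dominates_mono)
    qed
    then obtain f where f: "f \<in> F" "\<forall>j\<in>Sum_Type.Plus V E. f j \<le> s j"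
      using F(3) by blast
    have fb: "f (Inl x) \<le> b x" if "x \<in> V" for x
      using f(2) that by (auto simp: s_def dest: bspec[of _ _ "Inl x"])
    have fc: "f (Inr e) \<le> c e" if "e \<in> E" for e
      using f(2) that by (auto simp: s_def dest: bspec[of _ _ "Inr e"])
    have "b x < M" if x: "x \<in> V" for x
    proof (rule ccontr)
      assume "\<not> b x < M"
      then have bx: "f (Inl x) + N f x \<le> b x"
        using M[OF f(1) x] by simp
      have "P f x (N f x)"
        using N f(1) F(2) x by blast
      then obtain d where d: "sum (?c f) E + 1 \<le> sum d E"
        "\<forall>y\<in>V. inc d y \<le> inc (?c f) y + f (Inl y) + (if y = x then N f x else 0)"
        unfolding P_def dominates_def by blast
      define d' where "d' e = d e + (c e - f (Inr e))" for e
      have "sum (?c f) E + (\<Sum>e\<in>E. c e - f (Inr e)) = sum c E"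
        using fc by (simp add: sum.distrib[symmetric])
      then have "t + 1 \<le> sum d' E"
        using d(1) c by (simp add: d'_def sum.distrib compositions_def)
      moreover have "inc d' y \<le> h y" if y: "y \<in> V" for y
      proof -
        have "inc (?c f) y + inc (\<lambda>e. c e - f (Inr e)) y = inc c y"
          using fc by (simp add: inc_add[symmetric] cong: inc_cong)
        moreover have "inc d' y = inc d y + inc (\<lambda>e. c e - f (Inr e)) y"
          unfolding d'_def by (rule inc_add)
        ultimately have "inc d' y \<le> inc c y + f (Inl y) + (if y = x then N f x else 0)"
          using bspec[OF d(2) y] by linarith
        also have "\<dots> \<le> h y"
          using hb bx fb[OF y] by (auto simp: fun_eq_iff)
        finally show ?thesis .
      qed
      ultimately show False
        using ndom unfolding dominates_def by blast
    qed
    moreover have "b x = 0" if "x \<notin> V" for x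
      using that h by (simp add: b_def torsion_def)
    ultimately have "b \<in> box M"
      by (simp add: box_def)
    then show ?thesis
      using c hb by blast
  qed
  then show ?thesis by blast
qed

lemma finite_torsion: "finite (torsion t)"
proof -
  obtain M where M: "\<forall>h\<in>torsion t. \<exists>c\<in>compositions E t. \<exists>b\<in>box M. h = (\<lambda>x. inc c x + b x)"
    using torsion_bounded by blast
  have "torsion t \<subseteq> (\<lambda>(b, c) x. inc c x + b x) ` (box M \<times> compositions E t)"
    using M by fastforce
  then show ?thesis
    using finite_box finite_compositions[OF finite_E] by (meson finite_SigmaI finite_imageI finite_subset)
qed

section \<open>Dependent edges: the torsion is negligible\<close>

text \<open>An integer relation between the edges can be subtracted until some multiplicity is small.\<close>
lemma singular_small_coefficient:
  assumes "\<not> nonsingular"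
  shows "\<exists>K. \<forall>t. \<forall>c\<in>compositions E t. \<exists>d\<in>compositions E t. (\<exists>e\<in>E. d e < K) \<and> (\<forall>x. inc d x = inc c x)"
proof -
  obtain z :: "'v set \<Rightarrow> int" and e1 where z: "\<forall>x\<in>V. inc z x = 0" and e1: "e1 \<in> E" "z e1 \<noteq> 0"
    using assms unfolding nonsingular_def by blast
  have incz: "inc z x = 0" for x
    using z inc_outside by (cases "x \<in> V") auto
  \<comment> \<open>Summing the relation over all nodes gives \<open>m\<close> times its total
    weight, which is therefore 0. Hence subtracting the relation preserves the number
    \<open>t\<close> of edges, and since \<open>z\<close> is not zero on \<open>E\<close>, some
    coefficient is positive.\<close>
  have sumz: "sum z E = 0"
    using sum_inc[of z] incz m_pos by simp
  obtain e0 where e0: "e0 \<in> E" "z e0 > 0"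
  proof (cases "\<exists>e\<in>E. z e > 0")
    case False
    then have "\<forall>e\<in>E. z e \<le> 0" by (auto simp: not_less)
    then have "\<forall>e\<in>E. z e = 0"
      using sumz finite_E sum_nonneg_eq_0_iff[of E "\<lambda>e. - z e"] by (simp add: sum_negf)
    then show ?thesis using e1 by blast
  qed blast
  define K where "K = nat (\<Sum>e\<in>E. \<bar>z e\<bar>)"
  have K: "z e \<le> int K" if "e \<in> E" for e
  proof -
    have "\<bar>z e\<bar> \<le> (\<Sum>e\<in>E. \<bar>z e\<bar>)"
      using that finite_E by (intro member_le_sum[of e E "\<lambda>e. \<bar>z e\<bar>"]) auto
    then show ?thesis by (simp add: K_def)
  qed
  have "\<exists>d\<in>compositions E t. (\<exists>e\<in>E. d e < K) \<and> (\<forall>x. inc d x = inc c x)"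
    if c: "c \<in> compositions E t" for t c
  proof -
    let ?Q = "\<lambda>d. d \<in> compositions E t \<and> (\<forall>x. inc d x = inc c x)"
    \<comment> \<open>Minimality at \<open>e0\<close> replaces a repeated subtraction: if all
      multiplicities were at least \<open>K\<close>, subtracting \<open>z\<close> once more would
      keep them nonnegative and lower the one at \<open>e0\<close>, where \<open>z\<close> is
      positive.\<close>
    obtain d where d: "?Q d" "\<And>d'. ?Q d' \<Longrightarrow> d e0 \<le> d' e0"
      using ex_has_least_nat[of ?Q c "\<lambda>d. d e0"] c by blast
    have "\<exists>e\<in>E. d e < K"
    proof (rule ccontr)
      assume "\<not> (\<exists>e\<in>E. d e < K)"
      then have ge: "K \<le> d e" if "e \<in> E" for e
        using that by (simp add: not_less)
      define d' where "d' e = (if e \<in> E then nat (int (d e) - z e) else 0)" for e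
      have d': "int (d' e) = int (d e) - z e" if "e \<in> E" for e
        using ge[OF that] K[OF that] that by (simp add: d'_def)
      have "int (sum d' E) = int (sum d E)"
        using d' sumz by (simp add: sum_subtractf)
      then have "d' \<in> compositions E t"
        using d(1) by (simp add: compositions_def d'_def del: of_nat_sum)
      moreover have "inc d' x = inc c x" for x
      proof -
        have "int (inc d' x) = inc (\<lambda>e. int (d e) - z e) x"
          unfolding inc_int[symmetric] using d' by (intro inc_cong) auto
        also have "\<dots> = int (inc d x)"
          using incz by (simp add: inc_diff inc_int)
        finally show ?thesis using d(1) by simp
      qed
      ultimately have "d e0 \<le> d' e0"
        using d(2) by blast
      then show False
        using d'[OF e0(1)] e0(2) by linarith
    qed
    then show ?thesis using d(1) by blast
  qed
  then show ?thesis by blast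
qed

lemma singular_torsion_asymp:
  assumes "\<not> nonsingular"
  shows "(\<lambda>t. real (card (torsion t)) / real t ^ (card V - 1)) \<longlonglongrightarrow> 0"
proof -
  obtain M where M: "\<And>t h. h \<in> torsion t \<Longrightarrow> \<exists>c\<in>compositions E t. \<exists>b\<in>box M. h = (\<lambda>x. inc c x + b x)"
    using torsion_bounded by blast
  obtain K where K: "\<And>t c. c \<in> compositions E t \<Longrightarrow>
      \<exists>d\<in>compositions E t. (\<exists>e\<in>E. d e < K) \<and> (\<forall>x. inc d x = inc c x)"
    using singular_small_coefficient[OF assms] by blast
  let ?C = "\<lambda>t. {d \<in> compositions E t. \<exists>e\<in>E. d e < K}"
  have le: "card (torsion t) \<le> card (box M) * card (?C t)" for t
  proof -
    have "h \<in> (\<lambda>(b, c) x. inc c x + b x) ` (box M \<times> ?C t)" if h: "h \<in> torsion t" for h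
    proof -
      obtain c b where cb: "c \<in> compositions E t" "b \<in> box M" "h = (\<lambda>x. inc c x + b x)"
        using M[OF h] by blast
      obtain d where "d \<in> ?C t" "\<And>x. inc d x = inc c x"
        using K[OF cb(1)] by blast
      then show ?thesis
        using cb by (intro image_eqI[of _ _ "(b, d)"]) auto
    qed
    then have sub: "torsion t \<subseteq> (\<lambda>(b, c) x. inc c x + b x) ` (box M \<times> ?C t)" by blast
    have fin: "finite (box M \<times> ?C t)"
      using finite_box finite_compositions[OF finite_E] by simp
    have "card (torsion t) \<le> card (box M \<times> ?C t)"
      using card_mono[OF finite_imageI[OF fin] sub] card_image_le[OF fin] by (rule order_trans)
    then show ?thesis by (simp add: card_cartesian_product)
  qed
  have "(\<lambda>t. real (card (box M)) * (real (card (?C t)) / real t ^ (card V - 1))) \<longlonglongrightarrow> real (card (box M)) * 0"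
    using compositions_lt_asymp[OF finite_E E_ne, of K] card_E by (intro tendsto_intros) auto
  then have lim: "(\<lambda>t. real (card (box M)) * (real (card (?C t)) / real t ^ (card V - 1))) \<longlonglongrightarrow> 0"
    by simp
  have ev: "\<forall>\<^sub>F t in sequentially. real (card (torsion t)) / real t ^ (card V - 1)
      \<le> real (card (box M)) * (real (card (?C t)) / real t ^ (card V - 1))"
  proof (intro always_eventually allI)
    fix t
    have "real (card (torsion t)) \<le> real (card (box M) * card (?C t))"
      using le[of t] by (simp del: of_nat_mult)
    from divide_right_mono[OF this, of "real t ^ (card V - 1)"]
    show "real (card (torsion t)) / real t ^ (card V - 1)
      \<le> real (card (box M)) * (real (card (?C t)) / real t ^ (card V - 1))"
      by simp
  qed
  show ?thesis
    by (rule tendsto_sandwich[OF _ ev tendsto_const lim]) simp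
qed

section \<open>Independent edges: one copy of the compositions for each coset\<close>

definition rep :: "'v set \<Rightarrow> 'v" where
  "rep U = (SOME x. x \<in> U)"

lemma rep_mem: "U \<in> Us \<Longrightarrow> rep U \<in> U"
  unfolding rep_def using component_ne some_in_eq by blast

text \<open>The coset representative: the residue of each component sits entirely on its node
  \<open>rep U\<close>. These nodes are distinct, so at most one summand is nonzero.\<close>

definition spread :: "('v set \<Rightarrow> nat) \<Rightarrow> 'v \<Rightarrow> nat" where
  "spread g x = (\<Sum>U\<in>Us. if x = rep U then g U else 0)"

abbreviation residues :: "('v set \<Rightarrow> nat) set" where
  "residues \<equiv> Us \<rightarrow>\<^sub>E {..<m}"

lemma spread_outside: "x \<notin> V \<Longrightarrow> spread g x = 0"
  unfolding spread_def using rep_mem component_subset by (intro sum.neutral) auto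

lemma sum_spread:
  assumes U: "U \<in> Us"
  shows "(\<Sum>x\<in>U. spread g x) = g U"
proof -
  have "(\<Sum>x\<in>U. spread g x) = (\<Sum>U'\<in>Us. \<Sum>x\<in>U. if x = rep U' then g U' else 0)"
    unfolding spread_def by (rule sum.swap)
  also have "\<dots> = (\<Sum>U'\<in>Us. if U' = U then g U' else 0)"
  proof (intro sum.cong refl)
    fix U' assume U': "U' \<in> Us"
    have "rep U' \<in> U \<longleftrightarrow> U' = U"
      using rep_mem[OF U'] component_unique[OF U U'] by auto
    then show "(\<Sum>x\<in>U. if x = rep U' then g U' else 0) = (if U' = U then g U' else 0)"
      using finite_component[OF U] by simp
  qed
  also have "\<dots> = g U"
    using U finite_Us by simp
  finally show ?thesis .
qed

text \<open>Edges change the degree on a component by multiples of \<open>m\<close>, so the residue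
  can be recovered from \<open>h\<close>; this is what keeps the cosets apart.\<close>

lemma residue_eq_mod:
  assumes "U \<in> Us" "g \<in> residues" "\<And>x. x \<in> V \<Longrightarrow> h x = spread g x + inc c x"
  shows "g U = (\<Sum>x\<in>U. h x) mod m"
proof -
  have "(\<Sum>x\<in>U. h x) = (\<Sum>x\<in>U. spread g x + inc c x)"
    using assms(3) component_subset[OF assms(1)] by (intro sum.cong) auto
  then have "(\<Sum>x\<in>U. h x) = g U + m * (\<Sum>e\<in>{e\<in>E. e \<subseteq> U}. c e)"
    by (simp add: sum.distrib sum_spread[OF assms(1)] sum_inc_component[OF assms(1)])
  moreover have "g U < m"
    using assms(1,2) by auto
  ultimately show ?thesis by simp
qed

text \<open>A degree comparison. Whatever remains after removing edges from \<open>h\<close> is, on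
  each component, congruent to \<open>g U\<close> modulo \<open>m\<close> and hence at least
  \<open>g U\<close>. So the total degree leaves room for at most \<open>t\<close> edges.\<close>

lemma not_dominates_Suc:
  assumes g: "g \<in> residues" and h: "\<And>x. x \<in> V \<Longrightarrow> h x = spread g x + inc c x" and t: "sum c E = t"
  shows "\<not> dominates (t + 1) h"
proof
  assume "dominates (t + 1) h"
  then obtain d where d: "t + 1 \<le> sum d E" "\<forall>x\<in>V. inc d x \<le> h x"
    unfolding dominates_def by blast
  define b where "b x = h x - inc d x" for x
  have hb: "h x = b x + inc d x" if "x \<in> V" for x
    using d(2) that by (simp add: b_def)
  have le: "g U \<le> (\<Sum>x\<in>U. b x)" if U: "U \<in> Us" for U
  proof -
    have "(\<Sum>x\<in>U. h x) = (\<Sum>x\<in>U. b x + inc d x)"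
      using hb component_subset[OF U] by (intro sum.cong) auto
    then have "(\<Sum>x\<in>U. h x) mod m = (\<Sum>x\<in>U. b x) mod m"
      by (simp add: sum.distrib sum_inc_component[OF U])
    then have "g U = (\<Sum>x\<in>U. b x) mod m"
      using residue_eq_mod[OF U g h] by simp
    then show ?thesis by simp
  qed
  have "(\<Sum>x\<in>V. spread g x) \<le> (\<Sum>x\<in>V. b x)"
    unfolding sum_V by (rule sum_mono) (simp add: sum_spread le)
  moreover have "(\<Sum>x\<in>V. spread g x + inc c x) = (\<Sum>x\<in>V. b x + inc d x)"
    using h hb by (intro sum.cong) (auto simp flip: h)
  then have "(\<Sum>x\<in>V. spread g x) + m * t = (\<Sum>x\<in>V. b x) + m * sum d E"
    using t by (simp add: sum.distrib sum_inc)
  ultimately have "m * sum d E \<le> m * t" by linarith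
  then show False
    using d(1) m_pos by simp
qed

text \<open>The degrees modulo \<open>m\<close> recover \<open>g\<close>; after cancelling it, the
  difference of the multiplicities is a relation between the edges and vanishes.\<close>

lemma inj_spread_inc:
  assumes ns: nonsingular
  shows "inj_on (\<lambda>(g, c) x. spread g x + inc c x) (residues \<times> compositions E t)"
proof (rule inj_onI, clarify)
  fix g c g' c'
  assume g: "g \<in> residues" "g' \<in> residues" and c: "c \<in> compositions E t" "c' \<in> compositions E t"
    and eq: "(\<lambda>x. spread g x + inc c x) = (\<lambda>x. spread g' x + inc c' x)"
  define h where "h x = spread g x + inc c x" for x
  have h: "h x = spread g x + inc c x" "h x = spread g' x + inc c' x" for x
    using fun_cong[OF eq, of x] by (simp_all add: h_def)
  have "g U = g' U" if "U \<in> Us" for U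
    using residue_eq_mod[OF that g(1) h(1)] residue_eq_mod[OF that g(2) h(2)] by simp
  then have gg: "g = g'"
    using g by (intro PiE_ext)
  have "inc (\<lambda>e. int (c e) - int (c' e)) x = 0" for x
    using h[of x] gg by (simp add: inc_diff inc_int)
  then have "\<forall>e\<in>E. int (c e) - int (c' e) = 0"
    using ns unfolding nonsingular_def by blast
  then have "c = c'"
    using c by (auto simp: compositions_def fun_eq_iff)
  then show "g = g' \<and> c = c'" using gg by simp
qed

lemma card_residues: "card residues = m ^ card Us"
  using finite_Us by (simp add: card_PiE)

lemma finite_residues: "finite residues"
  using finite_Us by (simp add: finite_PiE)

text \<open>By \<open>lattice_delta\<close>, \<open>m\<close> times the unit vector at
  \<open>x\<close> is an integer combination \<open>z x\<close> of edges, whose coefficients sum to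
  1 by degree. So raising the exponent at \<open>x\<close> by \<open>m\<close> buys one additional
  edge, provided all multiplicities are at least \<open>K\<close>, a bound for the negative
  coefficients of every \<open>z x\<close>. This yields the last condition in
  \<open>torsion\<close>.\<close>

lemma torsion_card_ge:
  assumes ns: nonsingular
  shows "\<exists>K. \<forall>t. m ^ card Us * card {c \<in> compositions E t. \<forall>e\<in>E. K \<le> c e} \<le> card (torsion t)"
proof -
  have "\<exists>z. \<forall>y\<in>V. int m * \<delta> x y = inc z y" if "x \<in> V" for x
    using lattice_delta[OF ns that] unfolding lattice_def by blast
  then obtain z where z: "\<And>x y. x \<in> V \<Longrightarrow> y \<in> V \<Longrightarrow> inc (z x) y = int m * \<delta> x y"
    by metis
  have sumz: "sum (z x) E = 1" if x: "x \<in> V" for x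
  proof -
    have "(\<Sum>y\<in>V. inc (z x) y) = (\<Sum>y\<in>V. if y = x then int m else 0)"
      using z[OF x] by (intro sum.cong) auto
    then have "int m * sum (z x) E = int m"
      using sum_inc[of "z x"] finite_V x by simp
    then show ?thesis using m_pos by simp
  qed
  define K where "K = nat (\<Sum>x\<in>V. \<Sum>e\<in>E. \<bar>z x e\<bar>)"
  have K: "- z x e \<le> int K" if "x \<in> V" "e \<in> E" for x e
  proof -
    have "\<bar>z x e\<bar> \<le> (\<Sum>e\<in>E. \<bar>z x e\<bar>)"
      using that finite_E by (intro member_le_sum[of e E "\<lambda>e. \<bar>z x e\<bar>"]) auto
    also have "\<dots> \<le> (\<Sum>x\<in>V. \<Sum>e\<in>E. \<bar>z x e\<bar>)"
      using that finite_V by (intro member_le_sum[of x V "\<lambda>x. \<Sum>e\<in>E. \<bar>z x e\<bar>"]) (auto intro: sum_nonneg)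
    finally show ?thesis unfolding K_def by linarith
  qed
  have "m ^ card Us * card {c \<in> compositions E t. \<forall>e\<in>E. K \<le> c e} \<le> card (torsion t)" for t
  proof -
    let ?C = "{c \<in> compositions E t. \<forall>e\<in>E. K \<le> c e}"
    let ?f = "\<lambda>(g, c) x. spread g x + inc c x"
    have "?f ` (residues \<times> ?C) \<subseteq> torsion t"
    proof clarify
      fix g c assume g: "g \<in> residues" and c: "c \<in> compositions E t" and ge: "\<forall>e\<in>E. K \<le> c e"
      define h where "h x = spread g x + inc c x" for x
      have ct: "sum c E = t" using c by (simp add: compositions_def)
      have "dominates t h"
        unfolding dominates_def using ct by (intro exI[of _ c]) (simp add: h_def)
      moreover have "\<not> dominates (t + 1) h"
        using not_dominates_Suc[OF g _ ct] by (simp add: h_def)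
      moreover have "dominates (t + 1) (h(x := h x + m))" if x: "x \<in> V" for x
      proof -
        define d where "d e = nat (int (c e) + z x e)" for e
        have d: "int (d e) = int (c e) + z x e" if "e \<in> E" for e
        proof -
          have "K \<le> c e" using ge that by blast
          then show ?thesis using K[OF x that] by (simp add: d_def)
        qed
        have "int (sum d E) = int t + 1"
          using d ct sumz[OF x] by (simp add: sum.distrib flip: ct)
        then have "t + 1 \<le> sum d E" by linarith
        moreover have "inc d y \<le> (h(x := h x + m)) y" if y: "y \<in> V" for y
        proof -
          have "int (inc d y) = inc (\<lambda>e. int (c e) + z x e) y"
            unfolding inc_int[symmetric] using d by (intro inc_cong) auto
          then have "int (inc d y) = int (inc c y) + int m * \<delta> x y"
            using z[OF x y] by (simp add: inc_add inc_int)
          then show ?thesis by (auto simp: h_def split: if_splits)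
        qed
        ultimately show ?thesis
          unfolding dominates_def by (intro exI[of _ d]) auto
      qed
      moreover have "h x = 0" if "x \<notin> V" for x
        using that by (simp add: h_def spread_outside inc_outside)
      ultimately have "h \<in> torsion t"
        unfolding torsion_def by blast
      then show "(\<lambda>x. spread g x + inc c x) \<in> torsion t"
        by (simp add: h_def[abs_def])
    qed
    then have "card (?f ` (residues \<times> ?C)) \<le> card (torsion t)"
      using card_mono finite_torsion by blast
    moreover have "inj_on ?f (residues \<times> ?C)"
      by (rule inj_on_subset[OF inj_spread_inc[OF ns]]) auto
    ultimately show ?thesis
      by (simp add: card_image card_cartesian_product card_residues)
  qed
  then show ?thesis by blast
qed

text \<open>A remainder \<open>b\<close> differs from its coset representative by an integer
  combination \<open>z b\<close> of edges, of nonnegative weight because reduction modulo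
  \<open>m\<close> does not increase degrees. As only finitely many \<open>b\<close> occur, one
  \<open>K\<close> suffices to absorb every \<open>z b\<close> into multiplicities that are all at
  least \<open>K\<close>; the monomials with a smaller multiplicity form the error term.\<close>

lemma torsion_card_le:
  assumes ns: nonsingular
  shows "\<exists>L K. \<forall>t. card (torsion t) \<le> m ^ card Us * card (compositions E t)
    + L * card {c \<in> compositions E t. \<exists>e\<in>E. c e < K}"
proof -
  obtain M where M: "\<And>t h. h \<in> torsion t \<Longrightarrow> \<exists>c\<in>compositions E t. \<exists>b\<in>box M. h = (\<lambda>x. inc c x + b x)"
    using torsion_bounded by blast
  define r where "r b = (\<lambda>U\<in>Us. (\<Sum>x\<in>U. b x) mod m)" for b :: "'v \<Rightarrow> nat"
  have r: "r b \<in> residues" for b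
    using m_pos by (auto simp: r_def)
  have "(\<lambda>x. int (b x) - int (spread (r b) x)) \<in> lattice" for b
  proof (rule mem_lattice[OF ns])
    fix U assume U: "U \<in> Us"
    have "(\<Sum>x\<in>U. int (b x) - int (spread (r b) x)) = int (\<Sum>x\<in>U. b x) - int ((\<Sum>x\<in>U. b x) mod m)"
      using sum_spread[OF U, of "r b"] U by (simp add: sum_subtractf r_def flip: of_nat_sum)
    then show "int m dvd (\<Sum>x\<in>U. int (b x) - int (spread (r b) x))"
      by (simp only: zmod_int dvd_minus_mod)
  qed
  then have "\<exists>z. \<forall>x\<in>V. int (b x) - int (spread (r b) x) = inc z x" for b
    unfolding lattice_def by blast
  then obtain z where z: "\<And>b x. x \<in> V \<Longrightarrow> inc (z b) x = int (b x) - int (spread (r b) x)"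
    by metis
  have sumz: "sum (z b) E \<ge> 0" for b
  proof -
    have "(\<Sum>x\<in>V. spread (r b) x) \<le> (\<Sum>x\<in>V. b x)"
      unfolding sum_V by (rule sum_mono) (simp add: sum_spread r_def)
    moreover have "(\<Sum>x\<in>V. inc (z b) x) = int (\<Sum>x\<in>V. b x) - int (\<Sum>x\<in>V. spread (r b) x)"
      using z by (simp add: sum_subtractf)
    ultimately have "int m * sum (z b) E \<ge> 0"
      using sum_inc[of "z b"] by linarith
    then show ?thesis using m_pos by (simp add: zero_le_mult_iff)
  qed
  define K where "K = nat (\<Sum>b\<in>box M. \<Sum>e\<in>E. \<bar>z b e\<bar>)"
  have K: "- z b e \<le> int K" if "b \<in> box M" "e \<in> E" for b e
  proof -
    have "\<bar>z b e\<bar> \<le> (\<Sum>e\<in>E. \<bar>z b e\<bar>)"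
      using that finite_E by (intro member_le_sum[of e E "\<lambda>e. \<bar>z b e\<bar>"]) auto
    also have "\<dots> \<le> (\<Sum>b\<in>box M. \<Sum>e\<in>E. \<bar>z b e\<bar>)"
      using that finite_box by (intro member_le_sum[of b "box M" "\<lambda>b. \<Sum>e\<in>E. \<bar>z b e\<bar>"]) (auto intro: sum_nonneg)
    finally show ?thesis unfolding K_def by linarith
  qed
  have "card (torsion t) \<le> m ^ card Us * card (compositions E t)
    + card (box M) * card {c \<in> compositions E t. \<exists>e\<in>E. c e < K}" for t
  proof -
    let ?C = "{c \<in> compositions E t. \<exists>e\<in>E. c e < K}"
    let ?f = "\<lambda>(g, c) x. spread g x + inc c x"
    let ?g = "\<lambda>(b, c) x. inc c x + b x"
    have "h \<in> ?f ` (residues \<times> compositions E t) \<union> ?g ` (box M \<times> ?C)" if h: "h \<in> torsion t" for h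
    proof -
      obtain c b where cb: "c \<in> compositions E t" "b \<in> box M" "h = (\<lambda>x. inc c x + b x)"
        using M[OF h] by blast
      show ?thesis
      proof (cases "\<exists>e\<in>E. c e < K")
        case True
        then have "h \<in> ?g ` (box M \<times> ?C)"
          using cb by (intro image_eqI[of _ _ "(b, c)"]) auto
        then show ?thesis by blast
      next
        case False
        define d where "d e = (if e \<in> E then nat (int (c e) + z b e) else 0)" for e
        have d: "int (d e) = int (c e) + z b e" if "e \<in> E" for e
        proof -
          have "K \<le> c e" using False that by (simp add: not_less)
          then show ?thesis using K[OF cb(2) that] that by (simp add: d_def)
        qed
        have sumd: "int (sum d E) = int t + sum (z b) E"
        proof -
          have "int (sum d E) = (\<Sum>e\<in>E. int (c e) + z b e)"
            using d by (simp add: of_nat_sum)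
          then show ?thesis
            using cb(1) by (simp add: sum.distrib compositions_def flip: of_nat_sum)
        qed
        have hd: "h x = spread (r b) x + inc d x" for x
        proof (cases "x \<in> V")
          case True
          have "int (inc d x) = inc (\<lambda>e. int (c e) + z b e) x"
            unfolding inc_int[symmetric] using d by (intro inc_cong) auto
          then have "int (inc d x) = int (inc c x) + (int (b x) - int (spread (r b) x))"
            using z[OF True] by (simp add: inc_add inc_int)
          then show ?thesis using cb(3) by simp
        next
          case False
          then show ?thesis
            using h spread_outside inc_outside by (simp add: torsion_def)
        qed
        \<comment> \<open>As \<open>h\<close> does not lie in the next power, the nonnegative weight
          of \<open>z b\<close> must be 0, and \<open>d\<close> again uses exactly \<open>t\<close>
          edges.\<close>
        have "\<not> t + 1 \<le> sum d E"
          using h hd unfolding torsion_def dominates_def by auto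
        then have "sum d E = t"
          using sumd sumz[of b] by linarith
        then have "d \<in> compositions E t"
          by (simp add: compositions_def d_def)
        then have "h \<in> ?f ` (residues \<times> compositions E t)"
          using r[of b] hd by (intro image_eqI[of _ _ "(r b, d)"]) auto
        then show ?thesis by blast
      qed
    qed
    then have sub: "torsion t \<subseteq> ?f ` (residues \<times> compositions E t) \<union> ?g ` (box M \<times> ?C)" by blast
    have fin1: "finite (residues \<times> compositions E t)" and fin2: "finite (box M \<times> ?C)"
      using finite_residues finite_box finite_compositions[OF finite_E] by auto
    have "card (torsion t) \<le> card (?f ` (residues \<times> compositions E t) \<union> ?g ` (box M \<times> ?C))"
      using fin1 fin2 by (intro card_mono[OF _ sub] finite_UnI finite_imageI)
    also have "\<dots> \<le> card (residues \<times> compositions E t) + card (box M \<times> ?C)"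
      using card_Un_le card_image_le[OF fin1, of ?f] card_image_le[OF fin2, of ?g] by (meson add_mono order_trans)
    finally show ?thesis
      by (simp add: card_cartesian_product card_residues)
  qed
  then show ?thesis by blast
qed

lemma nonsingular_torsion_asymp:
  assumes ns: nonsingular
  shows "(\<lambda>t. real (card (torsion t)) / real t ^ (card V - 1)) \<longlonglongrightarrow> real m ^ card Us / fact (card V - 1)"
proof -
  let ?d = "card V - 1"
  obtain K where K: "\<And>t. m ^ card Us * card {c \<in> compositions E t. \<forall>e\<in>E. K \<le> c e} \<le> card (torsion t)"
    using torsion_card_ge[OF ns] by blast
  obtain L K' where K': "\<And>t. card (torsion t) \<le> m ^ card Us * card (compositions E t)
    + L * card {c \<in> compositions E t. \<exists>e\<in>E. c e < K'}"
    using torsion_card_le[OF ns] by blast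
  have up: "(\<lambda>t. real m ^ card Us * (real (card (compositions E t)) / real t ^ ?d)
      + real L * (real (card {c \<in> compositions E t. \<exists>e\<in>E. c e < K'}) / real t ^ ?d))
      \<longlonglongrightarrow> real m ^ card Us * (1 / fact ?d) + real L * 0"
    using compositions_lt_asymp[OF finite_E E_ne, of K'] compositions_asymp[OF finite_E E_ne] card_E
    by (intro tendsto_add tendsto_mult tendsto_const) simp_all
  have lo: "(\<lambda>t. real m ^ card Us * (real (card (compositions E (t - card E * K))) / real t ^ ?d))
      \<longlonglongrightarrow> real m ^ card Us * (1 / fact ?d)"
    using compositions_shift_asymp[OF finite_E E_ne, of "card E * K"] card_E
    by (intro tendsto_add tendsto_mult tendsto_const) simp_all
  have "\<forall>\<^sub>F t in sequentially. real m ^ card Us * (real (card (compositions E (t - card E * K))) / real t ^ ?d)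
      \<le> real (card (torsion t)) / real t ^ ?d"
    using eventually_ge_at_top[of "card E * K"]
  proof eventually_elim
    case (elim t)
    have "real (m ^ card Us * card (compositions E (t - card E * K))) \<le> real (card (torsion t))"
      using K[of t] card_compositions_ge[OF finite_E elim] by (simp del: of_nat_mult)
    from divide_right_mono[OF this, of "real t ^ ?d"] show ?case by simp
  qed
  moreover have "\<forall>\<^sub>F t in sequentially. real (card (torsion t)) / real t ^ ?d
      \<le> real m ^ card Us * (real (card (compositions E t)) / real t ^ ?d)
      + real L * (real (card {c \<in> compositions E t. \<exists>e\<in>E. c e < K'}) / real t ^ ?d)"
  proof (intro always_eventually allI)
    fix t
    have "real (card (torsion t)) \<le> real (m ^ card Us * card (compositions E t)
        + L * card {c \<in> compositions E t. \<exists>e\<in>E. c e < K'})"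
      using K'[of t] by (simp del: of_nat_add of_nat_mult)
    from divide_right_mono[OF this, of "real t ^ ?d"]
    show "real (card (torsion t)) / real t ^ ?d
      \<le> real m ^ card Us * (real (card (compositions E t)) / real t ^ ?d)
      + real L * (real (card {c \<in> compositions E t. \<exists>e\<in>E. c e < K'}) / real t ^ ?d)"
      by (simp add: add_divide_distrib)
  qed
  ultimately show ?thesis
    using tendsto_sandwich[OF _ _ lo, of "\<lambda>t. real (card (torsion t)) / real t ^ ?d"] up by simp
qed

end

section \<open>Monomials and polynomials\<close>

abbreviation "lookup \<equiv> Poly_Mapping.lookup"
abbreviation "keys \<equiv> Poly_Mapping.keys"
abbreviation "monom \<equiv> Poly_Mapping.single"

text \<open>Summing over actual pairs of keys reduces non-cancellation arguments to showing that an
  exponent splits in only one way.\<close>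

lemma lookup_mult_finite:
  fixes p q :: "'a::monoid_add \<Rightarrow>\<^sub>0 'b::semiring_0"
  shows "lookup (p * q) k = (\<Sum>(a, b)\<in>{(a, b). a \<in> keys p \<and> b \<in> keys q \<and> k = a + b}. lookup p a * lookup q b)"
proof -
  let ?B = "{(a, b). a \<in> keys p \<and> b \<in> keys q \<and> k = a + b}"
  have fin: "finite ?B"
    by (rule finite_subset[of _ "keys p \<times> keys q"]) auto
  have "lookup (p * q) k = (\<Sum>(a, b). lookup p a * lookup q b when k = a + b)"
    by transfer (simp add: prod_fun_unfold_prod)
  also have "\<dots> = (\<Sum>(a, b)\<in>?B. lookup p a * lookup q b when k = a + b)"
    using fin by (intro Sum_any.expand_superset) (auto simp: in_keys_iff)
  also have "\<dots> = (\<Sum>(a, b)\<in>?B. lookup p a * lookup q b)"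
    by (intro sum.cong) auto
  finally show ?thesis .
qed

lemma keys_add_nat: "keys (a + b) = keys a \<union> keys b" for a b :: "'v \<Rightarrow>\<^sub>0 nat"
  by (auto simp: in_keys_iff lookup_add)

definition monomials :: "'v set \<Rightarrow> ('v \<Rightarrow>\<^sub>0 nat) set" where
  "monomials V = {a. keys a \<subseteq> V}"

lemma monomials_add [simp]: "a + b \<in> monomials V \<longleftrightarrow> a \<in> monomials V \<and> b \<in> monomials V"
  by (auto simp: monomials_def keys_add_nat)

lemma monomials_zero [simp]: "0 \<in> monomials V"
  by (simp add: monomials_def)

lemma monomials_eqI: "a \<in> monomials V \<Longrightarrow> b \<in> monomials V \<Longrightarrow> (\<And>x. x \<in> V \<Longrightarrow> lookup a x = lookup b x) \<Longrightarrow> a = b"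
proof (rule poly_mapping_eqI)
  fix x
  assume "a \<in> monomials V" "b \<in> monomials V" "\<And>x. x \<in> V \<Longrightarrow> lookup a x = lookup b x"
  moreover from this have "lookup a x = 0 \<and> lookup b x = 0" if "x \<notin> V"
    using that in_keys_iff[of x a] in_keys_iff[of x b] unfolding monomials_def by blast
  ultimately show "lookup a x = lookup b x"
    by (cases "x \<in> V") auto
qed

definition monomial_of :: "'v set \<Rightarrow> ('v \<Rightarrow> nat) \<Rightarrow> 'v \<Rightarrow>\<^sub>0 nat" where
  "monomial_of V h = Abs_poly_mapping (\<lambda>x. if x \<in> V then h x else 0)"

lemma lookup_monomial_of: "finite V \<Longrightarrow> lookup (monomial_of V h) x = (if x \<in> V then h x else 0)"
  unfolding monomial_of_def by (subst lookup_Abs_poly_mapping) (auto intro: finite_subset)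

lemma monomial_of_mem: "finite V \<Longrightarrow> monomial_of V h \<in> monomials V"
  by (auto simp: monomials_def in_keys_iff lookup_monomial_of split: if_splits)

lemma monomials_diff:
  assumes "finite V" "a \<in> monomials V" "\<And>x. x \<in> V \<Longrightarrow> h x \<le> lookup a x"
  obtains b where "b \<in> monomials V" "a = monomial_of V h + b"
proof
  let ?b = "monomial_of V (\<lambda>x. lookup a x - h x)"
  show "?b \<in> monomials V" using assms(1) by (rule monomial_of_mem)
  show "a = monomial_of V h + ?b"
    using assms by (intro monomials_eqI[of _ V]) (auto simp: monomial_of_mem lookup_add lookup_monomial_of)
qed

definition total :: "('v \<Rightarrow>\<^sub>0 nat) \<Rightarrow> nat" where
  "total a = (\<Sum>x\<in>keys a. lookup a x)"

lemma total_eq: "finite V \<Longrightarrow> a \<in> monomials V \<Longrightarrow> total a = (\<Sum>x\<in>V. lookup a x)"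
  unfolding total_def monomials_def by (intro sum.mono_neutral_left) (auto simp: in_keys_iff)

lemma total_add: "total (a + b) = total a + total b"
proof -
  have "finite (keys a \<union> keys b)" by simp
  then show ?thesis
    using total_eq[of "keys a \<union> keys b"]
    by (simp add: monomials_def keys_add_nat lookup_add sum.distrib)
qed

lemma total_eq_0_iff: "total a = 0 \<longleftrightarrow> a = 0"
proof
  assume "total a = 0"
  then have "\<forall>x\<in>keys a. lookup a x = 0" by (simp add: total_def)
  then have "lookup a x = 0" for x
    using in_keys_iff[of x a] by blast
  then show "a = 0" by (intro poly_mapping_eqI) simp
qed (simp add: total_def)

text \<open>The exponent sets of monomial ideals in the variables \<open>V\<close>.\<close>

definition up_closed :: "'v set \<Rightarrow> ('v \<Rightarrow>\<^sub>0 nat) set \<Rightarrow> bool" where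
  "up_closed V S \<longleftrightarrow> S \<subseteq> monomials V \<and> (\<forall>a\<in>S. \<forall>b\<in>monomials V. a + b \<in> S)"

text \<open>\<open>s\<close> will be a denominator. A key \<open>a\<close> of \<open>p\<close>
  outside \<open>S\<close> of least degree cannot cancel in \<open>p * s\<close>: a splitting of
  \<open>a\<close> with a nonzero key of \<open>s\<close> would involve a key of \<open>p\<close>
  outside \<open>S\<close> of smaller degree, so only \<open>lookup s 0\<close> contributes.\<close>

lemma keys_mult_unit:
  fixes p s :: "('v, 'k::field) mpoly"
  assumes S: "up_closed V S" and p: "keys p \<subseteq> monomials V" and s: "keys s \<subseteq> monomials V"
    and s0: "lookup s 0 \<noteq> 0" and ps: "keys (p * s) \<subseteq> S"
  shows "keys p \<subseteq> S"
proof (rule ccontr)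
  assume "\<not> keys p \<subseteq> S"
  then obtain a where a: "a \<in> keys p - S" and min: "\<And>b. b \<in> keys p - S \<Longrightarrow> total a \<le> total b"
    using ex_has_least_nat[of "\<lambda>a. a \<in> keys p - S" _ total] by blast
  have "{(b, c). b \<in> keys p \<and> c \<in> keys s \<and> a = b + c} = {(a, 0)}"
  proof -
    have "c = 0" if bc: "b \<in> keys p" "c \<in> keys s" "a = b + c" for b c
    proof -
      have "b \<notin> S"
        using S a bc s unfolding up_closed_def by blast
      then have "total a \<le> total b" using min bc by blast
      then show ?thesis using bc by (simp add: total_add total_eq_0_iff)
    qed
    moreover have "a \<in> keys p" "0 \<in> keys s" using a s0 by (simp_all add: in_keys_iff)
    ultimately show ?thesis by force
  qed
  then have "lookup (p * s) a = lookup p a * lookup s 0"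
    by (simp add: lookup_mult_finite)
  then have "a \<in> keys (p * s)"
    using a s0 by (simp add: in_keys_iff)
  then show False using ps a by blast
qed

text \<open>Monomials in finitely many variables are ordered by embedding them into monomials in variables
  indexed by natural numbers.\<close>
lemma keys_mult_avoid:
  fixes p q :: "('v, 'k::field) mpoly"
  assumes fin: "finite V" and p: "keys p \<subseteq> monomials V" and q: "keys q \<subseteq> monomials V"
    and a: "a \<in> keys p" "keys a \<inter> W = {}" and b: "b \<in> keys q" "keys b \<inter> W = {}"
  shows "\<exists>c\<in>keys (p * q). keys c \<inter> W = {}"
proof -
  obtain f :: "'v \<Rightarrow> nat" where f: "inj_on f V"
    using finite_imp_inj_to_nat_seg[OF fin] by blast
  define \<Phi> :: "('v \<Rightarrow>\<^sub>0 nat) \<Rightarrow> (nat \<Rightarrow>\<^sub>0 nat)" where "\<Phi> a = (\<Sum>x\<in>V. monom (f x) (lookup a x))" for a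
  have \<Phi>_add: "\<Phi> (a + b) = \<Phi> a + \<Phi> b" for a b
    by (simp add: \<Phi>_def lookup_add single_add sum.distrib)
  have \<Phi>_lookup: "lookup (\<Phi> a) (f x) = lookup a x" if "x \<in> V" for a x
  proof -
    have "lookup (\<Phi> a) (f x) = (\<Sum>y\<in>V. if y = x then lookup a y else 0)"
      unfolding \<Phi>_def lookup_sum using f that
      by (intro sum.cong refl) (auto simp: lookup_single when_def inj_on_eq_iff)
    then show ?thesis using fin that by simp
  qed
  have \<Phi>_inj: "a = b" if "a \<in> monomials V" "b \<in> monomials V" "\<Phi> a = \<Phi> b" for a b
    using that \<Phi>_lookup by (intro monomials_eqI[OF that(1,2)]) metis
  have max: "\<exists>a\<in>A. \<forall>b\<in>A. \<Phi> b \<le> \<Phi> a" if "finite A" "A \<noteq> {}" for A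
  proof -
    have "Max (\<Phi> ` A) \<in> \<Phi> ` A" using that by (intro Max_in) auto
    then obtain a where a: "a \<in> A" "Max (\<Phi> ` A) = \<Phi> a" by blast
    have "\<Phi> b \<le> \<Phi> a" if "b \<in> A" for b
      unfolding a(2)[symmetric] using \<open>finite A\<close> that by (intro Max_ge) auto
    then show ?thesis using a by blast
  qed
  obtain s where s: "s \<in> keys p" "keys s \<inter> W = {}"
    "\<And>a. a \<in> keys p \<Longrightarrow> keys a \<inter> W = {} \<Longrightarrow> \<Phi> a \<le> \<Phi> s"
  proof -
    have "\<exists>s\<in>{a \<in> keys p. keys a \<inter> W = {}}. \<forall>a\<in>{a \<in> keys p. keys a \<inter> W = {}}. \<Phi> a \<le> \<Phi> s"
      by (rule max) (use a in auto)
    then show ?thesis using that by blast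
  qed
  obtain t where t: "t \<in> keys q" "keys t \<inter> W = {}"
    "\<And>a. a \<in> keys q \<Longrightarrow> keys a \<inter> W = {} \<Longrightarrow> \<Phi> a \<le> \<Phi> t"
  proof -
    have "\<exists>s\<in>{a \<in> keys q. keys a \<inter> W = {}}. \<forall>a\<in>{a \<in> keys q. keys a \<inter> W = {}}. \<Phi> a \<le> \<Phi> s"
      by (rule max) (use b in auto)
    then show ?thesis using that by blast
  qed
  \<comment> \<open>The leading-term argument, restricted to keys avoiding \<open>W\<close>: since
    supports unite under addition, any splitting of \<open>s + t\<close> uses only such keys, and
    among these \<open>s\<close> and \<open>t\<close> are largest.\<close>
  have "{(a, b). a \<in> keys p \<and> b \<in> keys q \<and> s + t = a + b} = {(s, t)}"
  proof (intro equalityI subsetI)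
    fix ab assume "ab \<in> {(a, b). a \<in> keys p \<and> b \<in> keys q \<and> s + t = a + b}"
    then obtain a b where ab: "ab = (a, b)" "a \<in> keys p" "b \<in> keys q" "s + t = a + b" by blast
    have "keys a \<union> keys b = keys s \<union> keys t"
      using ab(4) keys_add_nat by metis
    then have "keys a \<inter> W = {}" "keys b \<inter> W = {}" using s t by blast+
    then have le: "\<Phi> a \<le> \<Phi> s" "\<Phi> b \<le> \<Phi> t" using s t ab by blast+
    have eq: "\<Phi> a + \<Phi> b = \<Phi> s + \<Phi> t" using ab(4) \<Phi>_add by metis
    have "\<Phi> a = \<Phi> s"
      using le eq add_less_le_mono[of "\<Phi> a" "\<Phi> s" "\<Phi> b" "\<Phi> t"] by (metis order_le_less less_irrefl)
    then have "a = s" using \<Phi>_inj p ab(2) s(1) by blast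
    then show "ab \<in> {(s, t)}" using ab by simp
  qed (use s t in auto)
  then have "lookup (p * q) (s + t) = lookup p s * lookup q t"
    by (simp add: lookup_mult_finite)
  then have "s + t \<in> keys (p * q)"
    using s t by (simp add: in_keys_iff)
  then show ?thesis
    using s t by (intro bexI[of _ "s + t"]) (auto simp: keys_add_nat)
qed

text \<open>\<open>keys_mult_avoid\<close> with empty \<open>W\<close>, over the finitely many
  variables that occur. No order on the variable type is available, so absence of zero divisors is
  derived this way.\<close>

lemma mpoly_mult_eq_0:
  fixes p q :: "('v, 'k::field) mpoly"
  assumes "p * q = 0"
  shows "p = 0 \<or> q = 0"
proof (rule ccontr)
  assume "\<not> (p = 0 \<or> q = 0)"
  then obtain a b where "a \<in> keys p" "b \<in> keys q"
    by (metis all_not_in_conv keys_zero poly_mapping_eqI lookup_zero in_keys_iff)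
  then show False
    using keys_mult_avoid[of "\<Union>(keys ` (keys p \<union> keys q))" p q a "{}" b] assms
    by (auto simp: monomials_def)
qed

lemma mpoly_mult_left_cancel: "p \<noteq> 0 \<Longrightarrow> p * q = p * r \<Longrightarrow> q = r" for p q r :: "('v, 'k::field) mpoly"
  using mpoly_mult_eq_0[of p "q - r"] by (simp add: right_diff_distrib)

text \<open>Bounding each exponent, rather than the total degree, makes the number of admissible
  monomials an exact power (\<open>card_bounded_monomials\<close>).\<close>

definition exponent_bound :: "nat \<Rightarrow> ('v, 'k::field) mpoly \<Rightarrow> bool" where
  "exponent_bound D p \<longleftrightarrow> (\<forall>a\<in>keys p. \<forall>x. lookup a x \<le> D)"

lemma exponent_bound_mult:
  assumes "exponent_bound D p" "exponent_bound D' q"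
  shows "exponent_bound (D + D') (p * q)"
  unfolding exponent_bound_def
proof safe
  fix a x assume "a \<in> keys (p * q)"
  then obtain b c where "b \<in> keys p" "c \<in> keys q" "a = b + c"
    using keys_mult[of p q] by blast
  then show "lookup a x \<le> D + D'"
    using assms by (auto simp: exponent_bound_def lookup_add intro!: add_mono)
qed

lemma exponent_bound_one: "exponent_bound 0 1"
  by (simp add: exponent_bound_def)

lemma exponent_bound_power: "exponent_bound D p \<Longrightarrow> exponent_bound (k * D) (p ^ k)"
  by (induction k) (auto simp: exponent_bound_one intro: exponent_bound_mult)

lemma exponent_bound_prod:
  "finite A \<Longrightarrow> (\<And>i. i \<in> A \<Longrightarrow> exponent_bound (D i) (f i)) \<Longrightarrow> exponent_bound (sum D A) (prod f A)"
  by (induction A rule: finite_induct) (auto simp: exponent_bound_one intro: exponent_bound_mult)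

lemma exponent_bound_mono: "exponent_bound D p \<Longrightarrow> D \<le> D' \<Longrightarrow> exponent_bound D' p"
  unfolding exponent_bound_def by (meson order_trans)

lemma exponent_bound_exists: "\<exists>D. exponent_bound D p"
proof -
  define D where "D = (\<Sum>a\<in>keys p. total a)"
  have "lookup a x \<le> D" if a: "a \<in> keys p" for a x
  proof -
    have "lookup a x \<le> total a"
      by (cases "x \<in> keys a") (auto simp: total_def in_keys_iff intro!: member_le_sum[of x "keys a" "lookup a"])
    also have "\<dots> \<le> D" unfolding D_def using a by (intro member_le_sum[of a "keys p" total]) auto
    finally show ?thesis .
  qed
  then show ?thesis unfolding exponent_bound_def by blast
qed

definition polynomials :: "'v set \<Rightarrow> ('v, 'k::field) mpoly set" where
  "polynomials V = {p. keys p \<subseteq> monomials V}"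

lemma polynomials_add: "p \<in> polynomials V \<Longrightarrow> q \<in> polynomials V \<Longrightarrow> p + q \<in> polynomials V"
  unfolding polynomials_def using Poly_Mapping.keys_add[of p q] by blast

lemma polynomials_mult: "p \<in> polynomials V \<Longrightarrow> q \<in> polynomials V \<Longrightarrow> p * q \<in> polynomials V"
proof -
  assume pq: "p \<in> polynomials V" "q \<in> polynomials V"
  have "a \<in> monomials V" if "a \<in> keys (p * q)" for a
  proof -
    obtain b c where "a = b + c" "b \<in> keys p" "c \<in> keys q"
      using keys_mult[of p q] \<open>a \<in> keys (p * q)\<close> by blast
    then show ?thesis using pq by (auto simp: polynomials_def)
  qed
  then show ?thesis by (auto simp: polynomials_def)
qed

lemma polynomials_uminus: "p \<in> polynomials V \<Longrightarrow> - p \<in> polynomials V"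
  by (auto simp: polynomials_def in_keys_iff)

lemma polynomials_zero: "0 \<in> polynomials V" and polynomials_one: "1 \<in> polynomials V"
  by (simp_all add: polynomials_def)

lemma polynomials_const: "monom 0 z \<in> polynomials V"
  by (simp add: polynomials_def)

lemma polynomials_monom: "a \<in> monomials V \<Longrightarrow> monom a z \<in> polynomials V"
  by (simp add: polynomials_def)

lemma polynomials_power: "p \<in> polynomials V \<Longrightarrow> p ^ k \<in> polynomials V"
  by (induction k) (auto simp: polynomials_one intro: polynomials_mult)

lemma polynomials_prod: "(\<And>i. i \<in> A \<Longrightarrow> f i \<in> polynomials V) \<Longrightarrow> prod f A \<in> polynomials V"
  by (induction A rule: infinite_finite_induct) (auto simp: polynomials_one intro: polynomials_mult)

lemma polynomials_sum: "(\<And>i. i \<in> A \<Longrightarrow> f i \<in> polynomials V) \<Longrightarrow> sum f A \<in> polynomials V"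
  by (induction A rule: infinite_finite_induct) (auto simp: polynomials_zero intro: polynomials_add)

lemma lookup_const_mult: "lookup (monom 0 z * p) a = z * lookup p a" for p :: "('v, 'k::field) mpoly"
proof -
  have "{(b, c). b \<in> keys (monom 0 z) \<and> c \<in> keys p \<and> a = b + c} = (if z \<noteq> 0 \<and> a \<in> keys p then {(0, a)} else {})"
    by (auto split: if_splits)
  then show ?thesis
    by (simp add: lookup_mult_finite in_keys_iff)
qed

lemma card_bounded_monomials:
  assumes "finite V"
  shows "finite {a \<in> monomials V. \<forall>x. lookup a x \<le> N} \<and>
    card {a \<in> monomials V. \<forall>x. lookup a x \<le> N} = (N + 1) ^ card V"
proof -
  have "bij_betw (\<lambda>h. monomial_of V h) (V \<rightarrow>\<^sub>E {..N}) {a \<in> monomials V. \<forall>x. lookup a x \<le> N}"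
  proof (rule bij_betw_byWitness[of _ "\<lambda>a. restrict (lookup a) V"])
    show "\<forall>h\<in>V \<rightarrow>\<^sub>E {..N}. restrict (lookup (monomial_of V h)) V = h"
      using assms by (auto simp: lookup_monomial_of fun_eq_iff restrict_def PiE_def extensional_def)
    show "\<forall>a\<in>{a \<in> monomials V. \<forall>x. lookup a x \<le> N}. monomial_of V (restrict (lookup a) V) = a"
      using assms by (auto simp: lookup_monomial_of monomial_of_mem intro!: monomials_eqI[of _ V])
    show "monomial_of V ` (V \<rightarrow>\<^sub>E {..N}) \<subseteq> {a \<in> monomials V. \<forall>x. lookup a x \<le> N}"
      using assms by (auto simp: lookup_monomial_of monomial_of_mem PiE_def Pi_def)
  qed auto
  from bij_betw_finite[OF this] bij_betw_same_card[OF this] show ?thesis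
    using assms by (simp add: finite_PiE card_PiE)
qed

text \<open>There are more monomials of degree at most \<open>T\<close> in each \<open>x i\<close> than monomials in \<open>V\<close> that can
  occur in their expansions.\<close>
lemma algebraically_dependent:
  fixes x :: "nat \<Rightarrow> ('v, 'k::field) mpoly"
  assumes fin: "finite V" and x: "\<And>i. i \<le> card V \<Longrightarrow> x i \<in> polynomials V"
  shows "\<exists>A z. finite A \<and> A \<noteq> {} \<and> (\<forall>\<alpha>\<in>A. z \<alpha> \<noteq> 0) \<and> A \<subseteq> {..card V} \<rightarrow>\<^sub>E UNIV \<and>
    (\<Sum>\<alpha>\<in>A. monom 0 (z \<alpha>) * (\<Prod>i\<le>card V. x i ^ \<alpha> i)) = 0"
proof -
  define n where "n = card V"
  have "\<forall>i. \<exists>D. exponent_bound D (x i)" using exponent_bound_exists by blast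
  then obtain D0 where D0: "\<And>i. exponent_bound (D0 i) (x i)" by metis
  \<comment> \<open>The added 1 keeps \<open>D\<close> positive, which the estimate of
    \<open>N + 1\<close> below requires.\<close>
  define D where "D = (\<Sum>i\<le>n. D0 i) + 1"
  have D: "exponent_bound D (x i)" if "i \<le> n" for i
  proof -
    have "D0 i \<le> (\<Sum>i\<le>n. D0 i)" using that by (intro member_le_sum) auto
    then show ?thesis using exponent_bound_mono[OF D0[of i]] by (simp add: D_def)
  qed
  \<comment> \<open>Chosen so that \<open>(N + 1) ^ n \<le> ((n + 1) * D * (T + 1)) ^ n = T * (T +
    1) ^ n\<close>, which is less than \<open>(T + 1) ^ (n + 1)\<close>: fewer equations than
    unknowns.\<close>
  define T where "T = ((n + 1) * D) ^ n"
  define N where "N = (n + 1) * (T * D)"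
  define J where "J = {..n} \<rightarrow>\<^sub>E {..T}"
  define I where "I = {a \<in> monomials V. \<forall>x. lookup a x \<le> N}"
  define P where "P \<alpha> = (\<Prod>i\<le>n. x i ^ \<alpha> i)" for \<alpha> :: "nat \<Rightarrow> nat"
  have finJ: "finite J" and cardJ: "card J = (T + 1) ^ (n + 1)"
    by (simp_all add: J_def finite_PiE card_PiE)
  have finI: "finite I" and cardI: "card I = (N + 1) ^ n"
    using card_bounded_monomials[OF fin, of N] by (simp_all add: I_def n_def)
  have "N + 1 \<le> (n + 1) * D * (T + 1)"
    by (simp add: N_def D_def algebra_simps)
  then have "card I \<le> ((n + 1) * D * (T + 1)) ^ n"
    unfolding cardI by (rule power_mono) simp
  also have "\<dots> = T * (T + 1) ^ n" by (simp only: power_mult_distrib T_def)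
  also have "\<dots> < card J" by (simp add: cardJ)
  finally obtain z where z: "\<exists>\<alpha>\<in>J. z \<alpha> \<noteq> 0" "\<forall>a\<in>I. (\<Sum>\<alpha>\<in>J. z \<alpha> * lookup (P \<alpha>) a) = 0"
    using underdetermined_system[OF finI finJ, of "\<lambda>a \<alpha>. lookup (P \<alpha>) a"] by blast
  define A where "A = {\<alpha> \<in> J. z \<alpha> \<noteq> 0}"
  have keysP: "keys (P \<alpha>) \<subseteq> I" if "\<alpha> \<in> J" for \<alpha>
  proof -
    have "exponent_bound (\<Sum>i\<le>n. \<alpha> i * D) (P \<alpha>)"
      unfolding P_def using D by (intro exponent_bound_prod exponent_bound_power) auto
    moreover have "(\<Sum>i\<le>n. \<alpha> i * D) \<le> (\<Sum>i\<le>n. T * D)"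
      using that by (intro sum_mono mult_right_mono) (auto simp: J_def)
    ultimately have "exponent_bound N (P \<alpha>)"
      by (auto intro: exponent_bound_mono simp: N_def)
    moreover have "P \<alpha> \<in> polynomials V"
      unfolding P_def using x by (intro polynomials_prod polynomials_power) (auto simp: n_def)
    ultimately show ?thesis
      by (auto simp: exponent_bound_def polynomials_def I_def)
  qed
  have "(\<Sum>\<alpha>\<in>A. monom 0 (z \<alpha>) * P \<alpha>) = 0"
  proof (rule poly_mapping_eqI)
    fix a
    have "lookup (\<Sum>\<alpha>\<in>A. monom 0 (z \<alpha>) * P \<alpha>) a = (\<Sum>\<alpha>\<in>J. z \<alpha> * lookup (P \<alpha>) a)"
      unfolding A_def lookup_sum lookup_const_mult using finJ by (intro sum.mono_neutral_left) auto
    also have "\<dots> = 0"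
    proof (cases "a \<in> I")
      case False
      then show ?thesis
        by (intro sum.neutral ballI) (use keysP in \<open>force simp: in_keys_iff\<close>)
    qed (use z in blast)
    finally show "lookup (\<Sum>\<alpha>\<in>A. monom 0 (z \<alpha>) * P \<alpha>) a = lookup 0 a" by simp
  qed
  then show ?thesis
    using z finJ unfolding n_def[symmetric] P_def
    by (intro exI[of _ A] exI[of _ z]) (auto simp: A_def J_def)
qed

section \<open>The local ring and its monomial ideals\<close>

lemma mpoly_expansion: "p = (\<Sum>a\<in>keys p. monom a (lookup p a))"
  for p :: "'a \<Rightarrow>\<^sub>0 'b::comm_monoid_add"
proof (rule poly_mapping_eqI)
  fix b
  have "lookup (\<Sum>a\<in>keys p. monom a (lookup p a)) b = (\<Sum>a\<in>keys p. if a = b then lookup p a else 0)"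
    unfolding lookup_sum by (intro sum.cong) (auto simp: lookup_single when_def)
  also have "\<dots> = lookup p b"
    by (simp add: in_keys_iff)
  finally show "lookup p b = lookup (\<Sum>a\<in>keys p. monom a (lookup p a)) b" by simp
qed

lemma mpoly_memI:
  fixes p :: "'a \<Rightarrow>\<^sub>0 'b::comm_monoid_add"
  assumes "0 \<in> J" "\<And>p q. p \<in> J \<Longrightarrow> q \<in> J \<Longrightarrow> p + q \<in> J" "\<And>a. a \<in> keys p \<Longrightarrow> monom a (lookup p a) \<in> J"
  shows "p \<in> J"
proof -
  have "(\<Sum>a\<in>A. monom a (lookup p a)) \<in> J" if "A \<subseteq> keys p" "finite A" for A
    using that(2,1) by (induction A rule: finite_induct) (use assms in auto)
  from this[of "keys p"] show ?thesis
    using mpoly_expansion[of p] by simp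
qed

lemma lookup_times_0: "lookup (p * q) 0 = lookup p 0 * lookup q 0" for p q :: "('v, 'k::field) mpoly"
proof -
  have iff: "0 = a + b \<longleftrightarrow> a = 0 \<and> b = 0" for a b :: "'v \<Rightarrow>\<^sub>0 nat"
    using total_add[of a b] total_eq_0_iff[of "a + b"] total_eq_0_iff[of a] total_eq_0_iff[of b] by auto
  have "{(a, b). a \<in> keys p \<and> b \<in> keys q \<and> 0 = a + b} = (if 0 \<in> keys p \<and> 0 \<in> keys q then {(0, 0)} else {})"
    unfolding iff by auto
  then show ?thesis
    by (auto simp: lookup_mult_finite in_keys_iff)
qed

lemma monomial_split:
  fixes a :: "'v \<Rightarrow>\<^sub>0 nat"
  assumes "a \<in> monomials V" "x \<in> keys a"
  obtains b where "b \<in> monomials V" "a = monom x 1 + b"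
proof
  let ?b = "a - monom x 1"
  show eq: "a = monom x 1 + ?b"
    using assms(2) by (intro poly_mapping_eqI) (auto simp: lookup_add lookup_minus lookup_single when_def in_keys_iff)
  show "?b \<in> monomials V"
    using assms(1) eq monomials_add by metis
qed

lemma keys_neq_empty: "a \<noteq> 0 \<Longrightarrow> keys a \<noteq> {}" for a :: "'v \<Rightarrow>\<^sub>0 nat"
  using total_eq_0_iff[of a] by (auto simp: total_def)

locale local_polynomials =
  fixes V :: "'v set" and k :: "'k::field itself"
  assumes finite_V: "finite V"
begin

abbreviation A :: "('v, 'k) mpoly ring" where "A \<equiv> poly_ring k V"
abbreviation C :: "('v, 'k) mpoly set" where "C \<equiv> polynomials V"
abbreviation P :: "('v, 'k) mpoly set" where "P \<equiv> var_ideal k V"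
abbreviation R :: "(('v, 'k) mpoly \<times> ('v, 'k) mpoly) set ring" where "R \<equiv> localization A P"
abbreviation fr :: "('v, 'k) mpoly \<Rightarrow> ('v, 'k) mpoly \<Rightarrow> (('v, 'k) mpoly \<times> ('v, 'k) mpoly) set" where
  "fr \<equiv> loc_frac A P"

text \<open>The denominators; \<open>carrier_minus_P\<close> identifies them with the complement of
  the prime ideal \<open>P\<close>.\<close>

definition S :: "('v, 'k) mpoly set" where "S = {s \<in> C. lookup s 0 \<noteq> 0}"

lemma carrier_A: "carrier A = C"
  by (auto simp: poly_ring_def polynomials_def monomials_def)

lemma A_simps: "x \<otimes>\<^bsub>A\<^esub> y = x * y" "x \<oplus>\<^bsub>A\<^esub> y = x + y" "\<zero>\<^bsub>A\<^esub> = 0" "\<one>\<^bsub>A\<^esub> = 1"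
  by (simp_all add: poly_ring_def)

lemmas C_closed = polynomials_add polynomials_mult polynomials_zero polynomials_one

lemma cring_A: "cring A"
proof (rule cringI)
  show "abelian_group A"
  proof (rule abelian_groupI)
    fix x assume "x \<in> carrier A"
    then show "\<exists>y\<in>carrier A. y \<oplus>\<^bsub>A\<^esub> x = \<zero>\<^bsub>A\<^esub>"
      by (intro bexI[of _ "- x"]) (auto simp: A_simps carrier_A polynomials_uminus)
  qed (auto simp: A_simps carrier_A C_closed algebra_simps)
  show "comm_monoid A"
    by (rule comm_monoidI) (auto simp: A_simps carrier_A C_closed algebra_simps)
qed (auto simp: A_simps algebra_simps)

text \<open>Every nonconstant term is a multiple of a variable, so only the constant term decides
  membership. This makes the denominators explicit.\<close>

lemma var_ideal_eq: "P = {p \<in> C. lookup p 0 = 0}"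
proof -
  interpret A: cring A by (rule cring_A)
  let ?J = "{p \<in> C. lookup p 0 = 0}"
  have vars: "var ` V \<subseteq> C"
    by (auto simp: var_def monomials_def intro: polynomials_monom)
  have "ideal ?J A"
  proof (rule idealI)
    show "subgroup ?J (add_monoid A)"
    proof (rule A.add.subgroupI)
      fix p assume p: "p \<in> ?J"
      then have "\<ominus>\<^bsub>A\<^esub> p = - p"
        by (intro A.minus_equality) (auto simp: A_simps carrier_A polynomials_uminus)
      then show "\<ominus>\<^bsub>A\<^esub> p \<in> ?J" using p by (auto simp: polynomials_uminus)
    qed (auto simp: carrier_A A_simps lookup_add C_closed intro!: exI[of _ 0])
  qed (auto simp: A_simps carrier_A C_closed lookup_times_0 A.ring_axioms)
  moreover have "var ` V \<subseteq> ?J"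
  proof
    fix v :: "('v, 'k) mpoly" assume "v \<in> var ` V"
    then obtain x where x: "x \<in> V" "v = var x" by blast
    have "monom x (1::nat) \<noteq> 0"
      using lookup_single_eq[of x "1::nat"] by (metis lookup_zero one_neq_zero)
    then have "lookup v 0 = 0"
      using x(2) by (simp add: var_def lookup_single when_def)
    then show "v \<in> ?J" using vars x by blast
  qed
  ultimately have "P \<subseteq> ?J"
    unfolding var_ideal_def by (rule A.genideal_minimal)
  moreover have "?J \<subseteq> P"
  proof
    fix p assume p: "p \<in> ?J"
    have "ideal P A"
      unfolding var_ideal_def using vars by (intro A.genideal_ideal) (simp add: carrier_A)
    then interpret P: ideal P A .
    have gen: "var x \<in> P" if "x \<in> V" for x
      using A.genideal_self[of "var ` V"] vars that unfolding var_ideal_def carrier_A by blast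
    show "p \<in> P"
    proof (rule mpoly_memI)
      show "0 \<in> P" using P.zero_closed by (simp add: A_simps)
      show "\<And>p q. p \<in> P \<Longrightarrow> q \<in> P \<Longrightarrow> p + q \<in> P" using P.a_closed by (simp add: A_simps)
      fix a assume a: "a \<in> keys p"
      then have "a \<noteq> 0" using p by (auto simp: in_keys_iff)
      then obtain x where x: "x \<in> keys a" using keys_neq_empty by blast
      have aV: "a \<in> monomials V" using a p by (auto simp: polynomials_def)
      then obtain b where b: "b \<in> monomials V" "a = monom x 1 + b"
        using monomial_split x by metis
      have "x \<in> V" using aV x by (auto simp: monomials_def)
      then have "var x * monom b (lookup p a) \<in> P"
        using P.I_r_closed[OF gen, of x "monom b (lookup p a)"] b
        by (simp add: A_simps carrier_A polynomials_monom)
      moreover have "var x * monom b (lookup p a) = monom a (lookup p a)"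
        unfolding var_def mult_single b(2)[symmetric] by simp
      ultimately show "monom a (lookup p a) \<in> P" by simp
    qed
  qed
  ultimately show ?thesis by blast
qed

lemma carrier_minus_P: "carrier A - P = S"
  by (auto simp: carrier_A var_ideal_eq S_def)

lemma S_subset: "s \<in> S \<Longrightarrow> s \<in> C" and S_nonzero: "s \<in> S \<Longrightarrow> s \<noteq> 0"
  by (auto simp: S_def)

lemma S_one: "1 \<in> S"
  by (simp add: S_def polynomials_one)

lemma S_mult: "s \<in> S \<Longrightarrow> t \<in> S \<Longrightarrow> s * t \<in> S"
  by (auto simp: S_def polynomials_mult lookup_times_0)

text \<open>Cancellation in the polynomial ring removes the auxiliary factor \<open>u\<close> from
  the equality of fractions.\<close>

lemma fr_def: "a \<in> C \<Longrightarrow> s \<in> S \<Longrightarrow> fr a s = {(b, t). b \<in> C \<and> t \<in> S \<and> a * t = b * s}"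
proof -
  assume as: "a \<in> C" "s \<in> S"
  have "(\<exists>u\<in>S. u * (a * t) = u * (b * s)) \<longleftrightarrow> a * t = b * s" for b t
  proof
    assume "\<exists>u\<in>S. u * (a * t) = u * (b * s)"
    then obtain u where u: "u \<in> S" "u * (a * t) = u * (b * s)" by (rule bexE)
    show "a * t = b * s"
      by (rule mpoly_mult_left_cancel[OF S_nonzero[OF u(1)] u(2)])
  next
    assume "a * t = b * s"
    then show "\<exists>u\<in>S. u * (a * t) = u * (b * s)"
      using S_one by (intro bexI[of _ 1]) simp_all
  qed
  then show ?thesis
    unfolding loc_frac_def loc_rel_def carrier_minus_P unfolding A_simps carrier_A using as by auto
qed

lemma fr_eq:
  assumes "a \<in> C" "s \<in> S" "b \<in> C" "t \<in> S"
  shows "fr a s = fr b t \<longleftrightarrow> a * t = b * s"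
proof
  assume "fr a s = fr b t"
  moreover have "(a, s) \<in> fr a s" using assms by (simp add: fr_def)
  ultimately have "(a, s) \<in> fr b t" by simp
  then show "a * t = b * s" using assms by (simp add: fr_def)
next
  assume eq: "a * t = b * s"
  have "a * v = c * s \<longleftrightarrow> b * v = c * t" if "c \<in> C" "v \<in> S" for c v
  proof
    assume "a * v = c * s"
    have "s * (b * v) = (b * s) * v" by (simp add: mult_ac)
    also have "\<dots> = t * (a * v)" by (simp add: eq[symmetric] mult_ac)
    also have "\<dots> = s * (c * t)" using \<open>a * v = c * s\<close> by (simp add: mult_ac)
    finally have "s * (b * v) = s * (c * t)" .
    then show "b * v = c * t"
      using assms mpoly_mult_left_cancel[OF S_nonzero] by blast
  next
    assume "b * v = c * t"
    have "t * (a * v) = (a * t) * v" by (simp add: mult_ac)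
    also have "\<dots> = s * (b * v)" by (simp add: eq mult_ac)
    also have "\<dots> = t * (c * s)" using \<open>b * v = c * t\<close> by (simp add: mult_ac)
    finally have "t * (a * v) = t * (c * s)" .
    then show "a * v = c * s"
      using assms mpoly_mult_left_cancel[OF S_nonzero] by blast
  qed
  then show "fr a s = fr b t"
    using assms by (auto simp: fr_def)
qed

lemma carrier_R: "carrier R = {fr a s | a s. a \<in> C \<and> s \<in> S}"
  unfolding localization_def quotient_def carrier_minus_P
  by (auto simp: carrier_A loc_frac_def)

lemma fr_closed: "a \<in> C \<Longrightarrow> s \<in> S \<Longrightarrow> fr a s \<in> carrier R"
  by (auto simp: carrier_R)

lemma carrier_R_cases:
  assumes "x \<in> carrier R"
  obtains a s where "a \<in> C" "s \<in> S" "x = fr a s"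
  using assms by (auto simp: carrier_R)

text \<open>The operations of \<open>localization\<close> are unions over all representatives; when
  the result does not depend on the choice, the union collapses to one value.\<close>

lemma fr_UN:
  assumes a: "a \<in> C" "s \<in> S" and b: "b \<in> C" "t \<in> S"
    and F: "\<And>a' s' b' t'. a' \<in> C \<Longrightarrow> s' \<in> S \<Longrightarrow> b' \<in> C \<Longrightarrow> t' \<in> S \<Longrightarrow>
      a * s' = a' * s \<Longrightarrow> b * t' = b' * t \<Longrightarrow> F a' s' b' t' = F a s b t"
  shows "(\<Union>(a, s)\<in>fr a s. \<Union>(b, t)\<in>fr b t. F a s b t) = F a s b t"
proof -
  have ne: "fr a s \<noteq> {}" "fr b t \<noteq> {}"
    using fr_def[OF a] fr_def[OF b] a b by auto
  have "F a' s' b' t' = F a s b t" if "(a', s') \<in> fr a s" "(b', t') \<in> fr b t" for a' s' b' t'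
    using F[of a' s' b' t'] that by (simp add: fr_def[OF a] fr_def[OF b])
  then show ?thesis
    using ne by (intro SUP_eq_const) auto
qed

lemma fr_mult:
  assumes a: "a \<in> C" "s \<in> S" and b: "b \<in> C" "t \<in> S"
  shows "fr a s \<otimes>\<^bsub>R\<^esub> fr b t = fr (a * b) (s * t)"
proof -
  have "fr a s \<otimes>\<^bsub>R\<^esub> fr b t = (\<Union>(a, s)\<in>fr a s. \<Union>(b, t)\<in>fr b t. fr (a * b) (s * t))"
    by (simp add: localization_def A_simps)
  also have "\<dots> = fr (a * b) (s * t)"
  proof (rule fr_UN[OF a b])
    fix a' s' b' t'
    assume p: "a' \<in> C" "s' \<in> S" "b' \<in> C" "t' \<in> S" and eq: "a * s' = a' * s" "b * t' = b' * t"
    have "a' * b' * (s * t) = (a' * s) * (b' * t)" by (simp add: mult_ac)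
    also have "\<dots> = a * b * (s' * t')" by (simp add: eq[symmetric] mult_ac)
    finally show "fr (a' * b') (s' * t') = fr (a * b) (s * t)"
      using p a b by (simp add: fr_eq polynomials_mult S_mult)
  qed
  finally show ?thesis .
qed

lemma fr_add:
  assumes a: "a \<in> C" "s \<in> S" and b: "b \<in> C" "t \<in> S"
  shows "fr a s \<oplus>\<^bsub>R\<^esub> fr b t = fr (a * t + b * s) (s * t)"
proof -
  have "fr a s \<oplus>\<^bsub>R\<^esub> fr b t = (\<Union>(a, s)\<in>fr a s. \<Union>(b, t)\<in>fr b t. fr (a * t + b * s) (s * t))"
    by (simp add: localization_def A_simps)
  also have "\<dots> = fr (a * t + b * s) (s * t)"
  proof (rule fr_UN[OF a b])
    fix a' s' b' t'
    assume p: "a' \<in> C" "s' \<in> S" "b' \<in> C" "t' \<in> S" and eq: "a * s' = a' * s" "b * t' = b' * t"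
    have "(a' * t' + b' * s') * (s * t) = (a' * s) * (t' * t) + (b' * t) * (s' * s)" by (simp add: algebra_simps)
    also have "\<dots> = (a * t + b * s) * (s' * t')" by (simp add: eq[symmetric] algebra_simps)
    finally show "fr (a' * t' + b' * s') (s' * t') = fr (a * t + b * s) (s * t)"
      using p a b by (simp add: fr_eq polynomials_mult polynomials_add S_mult S_subset)
  qed
  finally show ?thesis .
qed

lemma fr_zero: "\<zero>\<^bsub>R\<^esub> = fr 0 1" and fr_one: "\<one>\<^bsub>R\<^esub> = fr 1 1"
  by (simp_all add: localization_def A_simps)

lemmas fr_closure = polynomials_add polynomials_mult polynomials_uminus polynomials_zero polynomials_one S_mult S_one S_subset

lemma fr_add_same:
  assumes "a \<in> C" "b \<in> C" "s \<in> S"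
  shows "fr a s \<oplus>\<^bsub>R\<^esub> fr b s = fr (a + b) s"
  using assms by (simp add: fr_add fr_eq fr_closure algebra_simps)

lemma fr_cases2:
  assumes "x \<in> carrier R" "y \<in> carrier R"
  obtains a s b t where "a \<in> C" "s \<in> S" "x = fr a s" "b \<in> C" "t \<in> S" "y = fr b t"
  using assms by (elim carrier_R_cases) blast

lemma fr_cases3:
  assumes "x \<in> carrier R" "y \<in> carrier R" "z \<in> carrier R"
  obtains a s b t c u where "a \<in> C" "s \<in> S" "x = fr a s" "b \<in> C" "t \<in> S" "y = fr b t"
    "c \<in> C" "u \<in> S" "z = fr c u"
  using assms by (elim carrier_R_cases) blast

lemma cring_R: "cring R"
proof (rule cringI)
  show "abelian_group R"
  proof (rule abelian_groupI)
    fix x y assume "x \<in> carrier R" "y \<in> carrier R"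
    then obtain a s b t where "a \<in> C" "s \<in> S" "x = fr a s" "b \<in> C" "t \<in> S" "y = fr b t"
      by (rule fr_cases2)
    then show "x \<oplus>\<^bsub>R\<^esub> y \<in> carrier R" "x \<oplus>\<^bsub>R\<^esub> y = y \<oplus>\<^bsub>R\<^esub> x"
      by (simp_all add: fr_add fr_closed fr_closure add.commute mult.commute)
  next
    fix x y z assume "x \<in> carrier R" "y \<in> carrier R" "z \<in> carrier R"
    then obtain a s b t c u where "a \<in> C" "s \<in> S" "x = fr a s" "b \<in> C" "t \<in> S" "y = fr b t"
      "c \<in> C" "u \<in> S" "z = fr c u"
      by (rule fr_cases3)
    then show "x \<oplus>\<^bsub>R\<^esub> y \<oplus>\<^bsub>R\<^esub> z = x \<oplus>\<^bsub>R\<^esub> (y \<oplus>\<^bsub>R\<^esub> z)"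
      by (simp add: fr_add fr_eq fr_closure) (simp add: algebra_simps)
  next
    show "\<zero>\<^bsub>R\<^esub> \<in> carrier R" by (simp add: fr_zero fr_closed fr_closure)
  next
    fix x assume "x \<in> carrier R"
    then obtain a s where x: "a \<in> C" "s \<in> S" "x = fr a s" by (rule carrier_R_cases)
    then show "\<zero>\<^bsub>R\<^esub> \<oplus>\<^bsub>R\<^esub> x = x"
      by (simp add: fr_add fr_zero fr_closure)
    have "fr (- a) s \<oplus>\<^bsub>R\<^esub> x = \<zero>\<^bsub>R\<^esub>"
      using x by (simp add: fr_add_same fr_zero fr_closure fr_eq)
    then show "\<exists>y\<in>carrier R. y \<oplus>\<^bsub>R\<^esub> x = \<zero>\<^bsub>R\<^esub>"
      using x by (intro bexI[of _ "fr (- a) s"]) (simp_all add: fr_closed fr_closure)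
  qed
  show "comm_monoid R"
  proof (rule comm_monoidI)
    fix x y assume "x \<in> carrier R" "y \<in> carrier R"
    then obtain a s b t where "a \<in> C" "s \<in> S" "x = fr a s" "b \<in> C" "t \<in> S" "y = fr b t"
      by (rule fr_cases2)
    then show "x \<otimes>\<^bsub>R\<^esub> y \<in> carrier R" "x \<otimes>\<^bsub>R\<^esub> y = y \<otimes>\<^bsub>R\<^esub> x"
      by (simp_all add: fr_mult fr_closed fr_closure mult.commute)
  next
    fix x y z assume "x \<in> carrier R" "y \<in> carrier R" "z \<in> carrier R"
    then obtain a s b t c u where "a \<in> C" "s \<in> S" "x = fr a s" "b \<in> C" "t \<in> S" "y = fr b t"
      "c \<in> C" "u \<in> S" "z = fr c u"
      by (rule fr_cases3)
    then show "x \<otimes>\<^bsub>R\<^esub> y \<otimes>\<^bsub>R\<^esub> z = x \<otimes>\<^bsub>R\<^esub> (y \<otimes>\<^bsub>R\<^esub> z)"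
      by (simp add: fr_mult fr_closure mult.assoc)
  next
    show "\<one>\<^bsub>R\<^esub> \<in> carrier R" by (simp add: fr_one fr_closed fr_closure)
  next
    fix x assume "x \<in> carrier R"
    then obtain a s where "a \<in> C" "s \<in> S" "x = fr a s" by (rule carrier_R_cases)
    then show "\<one>\<^bsub>R\<^esub> \<otimes>\<^bsub>R\<^esub> x = x"
      by (simp add: fr_mult fr_one fr_closure)
  qed
  fix x y z assume "x \<in> carrier R" "y \<in> carrier R" "z \<in> carrier R"
  then obtain a s b t c u where "a \<in> C" "s \<in> S" "x = fr a s" "b \<in> C" "t \<in> S" "y = fr b t"
    "c \<in> C" "u \<in> S" "z = fr c u"
    by (rule fr_cases3)
  then show "(x \<oplus>\<^bsub>R\<^esub> y) \<otimes>\<^bsub>R\<^esub> z = x \<otimes>\<^bsub>R\<^esub> z \<oplus>\<^bsub>R\<^esub> y \<otimes>\<^bsub>R\<^esub> z"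
    by (simp add: fr_add fr_mult fr_eq fr_closure) (simp add: algebra_simps)
qed

sublocale R: cring R
  by (rule cring_R)

lemma fr_uminus:
  assumes "a \<in> C" "s \<in> S"
  shows "\<ominus>\<^bsub>R\<^esub> fr a s = fr (- a) s"
proof (rule R.minus_equality)
  show "fr (- a) s \<oplus>\<^bsub>R\<^esub> fr a s = \<zero>\<^bsub>R\<^esub>"
    using assms by (simp add: fr_add_same fr_zero fr_closure fr_eq)
  show "fr a s \<in> carrier R" "fr (- a) s \<in> carrier R"
    using assms by (simp_all add: fr_closed polynomials_uminus)
qed

lemma fr_split:
  assumes "a \<in> C" "s \<in> S"
  shows "fr a s = fr 1 s \<otimes>\<^bsub>R\<^esub> fr a 1"
proof -
  have "fr 1 s \<otimes>\<^bsub>R\<^esub> fr a 1 = fr (1 * a) (s * 1)"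
    using assms polynomials_one S_one by (intro fr_mult)
  then show ?thesis by simp
qed

lemma fr_clear:
  assumes "a \<in> C" "s \<in> S"
  shows "fr a 1 = fr s 1 \<otimes>\<^bsub>R\<^esub> fr a s"
proof -
  have "fr s 1 \<otimes>\<^bsub>R\<^esub> fr a s = fr (s * a) (1 * s)"
    using assms S_subset S_one by (intro fr_mult)
  also have "\<dots> = fr a 1"
    using assms S_subset S_one by (subst fr_eq) (simp_all add: polynomials_mult)
  finally show ?thesis by simp
qed

text \<open>Denominators are units, so an ideal is determined by the polynomials it
  contains.\<close>

lemma ideal_fr_iff:
  assumes "ideal J R" "a \<in> C" "s \<in> S"
  shows "fr a s \<in> J \<longleftrightarrow> fr a 1 \<in> J"
proof
  have c: "fr s 1 \<in> carrier R" "fr 1 s \<in> carrier R"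
    using assms S_subset S_one polynomials_one by (auto intro: fr_closed)
  show "fr a 1 \<in> J" if "fr a s \<in> J"
    unfolding fr_clear[OF assms(2,3)] by (rule ideal.I_l_closed[OF assms(1) that c(1)])
  show "fr a s \<in> J" if "fr a 1 \<in> J"
    unfolding fr_split[OF assms(2,3)] by (rule ideal.I_l_closed[OF assms(1) that c(2)])
qed

text \<open>The extension to the local ring of the monomial ideal with exponent set
  \<open>U\<close>.\<close>

definition ext :: "('v \<Rightarrow>\<^sub>0 nat) set \<Rightarrow> (('v, 'k) mpoly \<times> ('v, 'k) mpoly) set set" where
  "ext U = {fr p s | p s. p \<in> C \<and> keys p \<subseteq> U \<and> s \<in> S}"

lemma extI: "p \<in> C \<Longrightarrow> keys p \<subseteq> U \<Longrightarrow> s \<in> S \<Longrightarrow> fr p s \<in> ext U"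
  by (auto simp: ext_def)

text \<open>The definition asks for one suitable fraction. By \<open>keys_mult_unit\<close> every
  representing fraction then has its numerator supported in \<open>U\<close>.\<close>

lemma ext_mem:
  assumes U: "up_closed V U" and p: "p \<in> C" "s \<in> S"
  shows "fr p s \<in> ext U \<longleftrightarrow> keys p \<subseteq> U"
proof
  assume "fr p s \<in> ext U"
  then obtain q t where q: "q \<in> C" "keys q \<subseteq> U" "t \<in> S" "fr p s = fr q t"
    by (auto simp: ext_def)
  then have "p * t = q * s" using fr_eq p by blast
  moreover have "keys (q * s) \<subseteq> U"
    using keys_mult[of q s] q(2) p(2) U unfolding up_closed_def S_def polynomials_def by blast
  ultimately show "keys p \<subseteq> U"
    using keys_mult_unit[OF U, of p t] p q by (auto simp: S_def polynomials_def)
qed (use p in \<open>auto simp: ext_def\<close>)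

lemma up_closed_keys_mult:
  assumes "up_closed V U" "p \<in> C" "keys q \<subseteq> U"
  shows "keys (p * q) \<subseteq> U"
proof
  fix c assume "c \<in> keys (p * q)"
  then obtain a b where "a \<in> keys q" "b \<in> keys p" "c = a + b"
    using keys_mult[of q p] by (auto simp: mult.commute)
  then show "c \<in> U"
    using assms unfolding up_closed_def polynomials_def by blast
qed

lemma ext_ideal:
  assumes U: "up_closed V U"
  shows "ideal (ext U) R"
proof (rule idealI)
  show "ring R" by (rule R.ring_axioms)
  have l: "fr q t \<otimes>\<^bsub>R\<^esub> x \<in> ext U" if x: "x \<in> ext U" and qt: "q \<in> C" "t \<in> S" for x q t
  proof -
    obtain p s where ps: "p \<in> C" "keys p \<subseteq> U" "s \<in> S" "x = fr p s"
      using x by (auto simp: ext_def)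
    then have "keys (q * p) \<subseteq> U" using up_closed_keys_mult[OF U] qt by blast
    then show ?thesis using ps qt by (simp add: fr_mult extI polynomials_mult S_mult)
  qed
  have sub: "ext U \<subseteq> carrier R" by (auto simp: ext_def intro: fr_closed)
  show "subgroup (ext U) (add_monoid R)"
  proof (rule R.add.subgroupI)
    show "ext U \<subseteq> carrier R" by (rule sub)
    show "ext U \<noteq> {}" using extI[of 0 U 1] polynomials_zero S_one by auto
  next
    fix x assume "x \<in> ext U"
    then obtain p s where ps: "p \<in> C" "keys p \<subseteq> U" "s \<in> S" "x = fr p s"
      by (auto simp: ext_def)
    moreover have "keys (- p) \<subseteq> U"
      using ps(2) by (auto simp: in_keys_iff)
    ultimately show "\<ominus>\<^bsub>R\<^esub> x \<in> ext U"
      by (simp add: fr_uminus extI polynomials_uminus)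
  next
    fix x y assume "x \<in> ext U" "y \<in> ext U"
    then obtain p s q t where ps: "p \<in> C" "keys p \<subseteq> U" "s \<in> S" "x = fr p s"
      and qt: "q \<in> C" "keys q \<subseteq> U" "t \<in> S" "y = fr q t"
      by (auto simp: ext_def)
    have "keys (p * t + q * s) \<subseteq> U"
      using Poly_Mapping.keys_add[of "p * t" "q * s"] up_closed_keys_mult[OF U, of t p] up_closed_keys_mult[OF U, of s q]
        ps qt S_subset by (auto simp: mult.commute)
    then show "x \<oplus>\<^bsub>R\<^esub> y \<in> ext U"
      using ps qt by (simp add: fr_add extI fr_closure)
  qed
  fix x y assume "x \<in> ext U" "y \<in> carrier R"
  moreover from this obtain q t where "q \<in> C" "t \<in> S" "y = fr q t" by (auto elim: carrier_R_cases)
  ultimately show "y \<otimes>\<^bsub>R\<^esub> x \<in> ext U" using l by blast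
  then show "x \<otimes>\<^bsub>R\<^esub> y \<in> ext U"
    using R.m_comm[of x y] sub \<open>x \<in> ext U\<close> \<open>y \<in> carrier R\<close> by auto
qed

text \<open>The monomials with exponent in \<open>U\<close> generate: constants belong to the ring,
  and denominators are units.\<close>

lemma ext_minimal:
  assumes J: "ideal J R" and U: "U \<subseteq> monomials V" and gen: "\<And>a. a \<in> U \<Longrightarrow> fr (monom a 1) 1 \<in> J"
  shows "ext U \<subseteq> J"
proof
  interpret J: ideal J R by (rule J)
  fix x assume "x \<in> ext U"
  then obtain p s where ps: "p \<in> C" "keys p \<subseteq> U" "s \<in> S" "x = fr p s" by (auto simp: ext_def)
  have "p \<in> {p \<in> C. fr p 1 \<in> J}"
  proof (rule mpoly_memI)
    show "0 \<in> {p \<in> C. fr p 1 \<in> J}"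
      using J.zero_closed by (simp add: fr_zero polynomials_zero)
  next
    fix p q assume "p \<in> {p \<in> C. fr p 1 \<in> J}" "q \<in> {p \<in> C. fr p 1 \<in> J}"
    then show "p + q \<in> {p \<in> C. fr p 1 \<in> J}"
      using J.a_closed[of "fr p 1" "fr q 1"] by (simp add: fr_add_same S_one polynomials_add)
  next
    fix a assume a: "a \<in> keys p"
    then have aU: "a \<in> U" "a \<in> monomials V" using ps U by auto
    have "fr (monom 0 (lookup p a)) 1 \<otimes>\<^bsub>R\<^esub> fr (monom a 1) 1 \<in> J"
      using gen[OF aU(1)] by (intro J.I_l_closed) (auto intro!: fr_closed polynomials_const S_one)
    then show "monom a (lookup p a) \<in> {p \<in> C. fr p 1 \<in> J}"
      using aU by (simp add: fr_mult polynomials_const polynomials_monom S_one mult_single)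
  qed
  then have "fr p 1 \<in> J" by simp
  then show "x \<in> J" using ideal_fr_iff[OF J] ps by simp
qed

section \<open>Products and powers of monomial ideals, and the maximal ideal\<close>

definition msum :: "('v \<Rightarrow>\<^sub>0 nat) set \<Rightarrow> ('v \<Rightarrow>\<^sub>0 nat) set \<Rightarrow> ('v \<Rightarrow>\<^sub>0 nat) set" where
  "msum U U' = {a + b | a b. a \<in> U \<and> b \<in> U'}"

lemma up_closed_msum: "up_closed V U \<Longrightarrow> up_closed V U' \<Longrightarrow> up_closed V (msum U U')"
  unfolding up_closed_def msum_def by (auto simp: subset_iff) (metis add.assoc)

lemma ext_prod:
  assumes U: "up_closed V U" "up_closed V U'"
  shows "ideal_prod R (ext U) (ext U') = ext (msum U U')"
proof
  have up: "up_closed V (msum U U')" using up_closed_msum U by blast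
  show "ideal_prod R (ext U) (ext U') \<subseteq> ext (msum U U')"
  proof
    fix x assume "x \<in> ideal_prod R (ext U) (ext U')"
    then show "x \<in> ext (msum U U')"
    proof induction
      case (prod i j)
      then obtain p s q t where ps: "p \<in> C" "keys p \<subseteq> U" "s \<in> S" "i = fr p s"
        and qt: "q \<in> C" "keys q \<subseteq> U'" "t \<in> S" "j = fr q t"
        by (auto simp: ext_def)
      have "keys (p * q) \<subseteq> msum U U'"
        using keys_mult[of p q] ps qt unfolding msum_def by blast
      then show ?case
        using ps qt by (simp add: fr_mult ext_mem[OF up] fr_closure)
    next
      case (sum x y)
      then show ?case
        using additive_subgroup.a_closed[OF ideal.axioms(1)[OF ext_ideal[OF up]]] by blast
    qed
  qed
  show "ext (msum U U') \<subseteq> ideal_prod R (ext U) (ext U')"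
  proof (rule ext_minimal)
    show "ideal (ideal_prod R (ext U) (ext U')) R"
      using R.ideal_prod_is_ideal ext_ideal U by blast
    show "msum U U' \<subseteq> monomials V" using up by (simp add: up_closed_def)
    fix c assume "c \<in> msum U U'"
    then obtain a b where ab: "a \<in> U" "b \<in> U'" "c = a + b" by (auto simp: msum_def)
    then have abV: "a \<in> monomials V" "b \<in> monomials V" using U by (auto simp: up_closed_def)
    have "fr (monom a 1) 1 \<otimes>\<^bsub>R\<^esub> fr (monom b 1) 1 \<in> ideal_prod R (ext U) (ext U')"
      using ab abV U by (intro ideal_prod.prod) (simp_all add: ext_mem polynomials_monom S_one)
    then show "fr (monom c 1) 1 \<in> ideal_prod R (ext U) (ext U')"
      using abV by (simp add: fr_mult polynomials_monom S_one mult_single ab(3))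
  qed
qed

text \<open>The recursion starts with all monomials because the zeroth power of an ideal is the
  whole ring.\<close>

primrec mpow :: "('v \<Rightarrow>\<^sub>0 nat) set \<Rightarrow> nat \<Rightarrow> ('v \<Rightarrow>\<^sub>0 nat) set" where
  "mpow U 0 = monomials V"
| "mpow U (Suc t) = msum (mpow U t) U"

lemma up_closed_monomials: "up_closed V (monomials V)"
  by (auto simp: up_closed_def)

lemma up_closed_mpow: "up_closed V U \<Longrightarrow> up_closed V (mpow U t)"
  by (induction t) (auto intro: up_closed_msum up_closed_monomials)

lemma ext_monomials: "ext (monomials V) = carrier R"
  by (auto simp: ext_def carrier_R polynomials_def)

lemma ideal_power_ext:
  assumes "up_closed V U"
  shows "ideal_power R (ext U) t = ext (mpow U t)"
proof (induction t)
  case 0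
  then show ?case by (simp add: ideal_power_def nat_pow_def ideals_set_def ext_monomials)
next
  case (Suc t)
  then have "ideal_power R (ext U) (Suc t) = ideal_prod R (ext (mpow U t)) (ext U)"
    by (simp add: ideal_power_def nat_pow_def ideals_set_def)
  then show ?case
    using ext_prod[OF up_closed_mpow[OF assms] assms] by simp
qed

text \<open>A fraction outside this ideal has a numerator with nonzero constant term and is a unit,
  so every proper ideal lies inside. The uniqueness justifies the definite description in
  \<open>max_ideal\<close>.\<close>

lemma ext_maximal_ideal:
  "up_closed V (monomials V - {0})" "maximalideal M R \<longleftrightarrow> M = ext (monomials V - {0})"
proof -
  have "a + b \<noteq> 0" if "a \<noteq> 0" for a b :: "'v \<Rightarrow>\<^sub>0 nat"
    using that total_add[of a b] total_eq_0_iff by (metis add_eq_0_iff_both_eq_0)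
  then show up: "up_closed V (monomials V - {0})"
    by (auto simp: up_closed_def)
  let ?M = "ext (monomials V - {0})"
  have unit: "x \<in> Units R" if "x \<in> carrier R" "x \<notin> ?M" for x
  proof -
    obtain p s where ps: "p \<in> C" "s \<in> S" "x = fr p s" using \<open>x \<in> carrier R\<close> by (rule carrier_R_cases)
    then have "\<not> keys p \<subseteq> monomials V - {0}" using \<open>x \<notin> ?M\<close> ext_mem[OF up] by blast
    then have "p \<in> S" using ps(1) by (auto simp: polynomials_def S_def in_keys_iff)
    then have "fr s p \<in> carrier R" "fr s p \<otimes>\<^bsub>R\<^esub> x = \<one>\<^bsub>R\<^esub>"
      using ps by (auto simp: fr_mult fr_one fr_eq fr_closure mult_ac intro: fr_closed S_subset)
    moreover from this have "x \<otimes>\<^bsub>R\<^esub> fr s p = \<one>\<^bsub>R\<^esub>" using R.m_comm that by metis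
    ultimately show ?thesis using that unfolding Units_def by blast
  qed
  have proper: "\<one>\<^bsub>R\<^esub> \<notin> ?M"
    by (simp add: fr_one ext_mem[OF up] fr_closure)
  have sub: "J \<subseteq> ?M" if J: "ideal J R" "J \<noteq> carrier R" for J
  proof
    fix x assume x: "x \<in> J"
    interpret J: ideal J R by (rule J(1))
    show "x \<in> ?M"
    proof (rule ccontr)
      assume "x \<notin> ?M"
      then have "x \<in> Units R" using unit x J.a_subset by blast
      then have "\<one>\<^bsub>R\<^esub> \<in> J" using J.I_l_closed[OF x] by (metis R.Units_inv_closed R.Units_l_inv)
      then show False using J.one_imp_carrier J(2) by blast
    qed
  qed
  have max: "maximalideal ?M R"
  proof (rule maximalidealI[OF ext_ideal[OF up]])
    show "carrier R \<noteq> ?M" using proper R.one_closed by metis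
  qed (use sub in blast)
  show "maximalideal M R \<longleftrightarrow> M = ?M"
  proof
    assume M: "maximalideal M R"
    then have "M \<subseteq> ?M" using sub maximalideal.I_notcarr[OF M] maximalideal.axioms(1)[OF M] by metis
    then have "?M = M \<or> ?M = carrier R"
      using maximalideal.I_maximal[OF M ext_ideal[OF up]] ext_ideal[OF up] ideal.axioms(1) additive_subgroup.a_subset by metis
    then show "M = ?M" using proper R.one_closed by metis
  qed (use max in simp)
qed

lemma max_ideal_R: "max_ideal R = ext (monomials V - {0})"
  unfolding max_ideal_def by (simp add: ext_maximal_ideal(2))

end

section \<open>Krull dimension and edge ideals\<close>

lemma lookup_monom_mult: "lookup (monom b z * p) (b + a) = z * lookup p a" for p :: "('v, 'k::field) mpoly"
proof -
  have "{(c, d). c \<in> keys (monom b z) \<and> d \<in> keys p \<and> b + a = c + d} = (if z \<noteq> 0 \<and> a \<in> keys p then {(b, a)} else {})"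
    by (auto split: if_splits)
  then show ?thesis
    by (simp add: lookup_mult_finite in_keys_iff)
qed

context local_polynomials
begin

text \<open>The exponents of the ideal generated by the variables in \<open>W\<close>; adjoining one
  variable at a time produces the prime chain of length \<open>card V\<close>.\<close>

definition meeting :: "'v set \<Rightarrow> ('v \<Rightarrow>\<^sub>0 nat) set" where
  "meeting W = {a \<in> monomials V. keys a \<inter> W \<noteq> {}}"

lemma up_closed_meeting: "up_closed V (meeting W)"
  by (auto simp: up_closed_def meeting_def keys_add_nat)

lemma meeting_prime: "primeideal (ext (meeting W)) R"
proof (rule primeidealI[OF ext_ideal[OF up_closed_meeting] cring_R])
  have "\<not> keys (1 :: ('v, 'k) mpoly) \<subseteq> meeting W" by (simp add: meeting_def)
  then have "\<one>\<^bsub>R\<^esub> \<notin> ext (meeting W)"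
    by (simp add: fr_one ext_mem[OF up_closed_meeting] fr_closure)
  then show "carrier R \<noteq> ext (meeting W)" using R.one_closed by metis
  fix x y assume xy: "x \<in> carrier R" "y \<in> carrier R" "x \<otimes>\<^bsub>R\<^esub> y \<in> ext (meeting W)"
  obtain p s q t where p: "p \<in> C" "s \<in> S" "x = fr p s" and q: "q \<in> C" "t \<in> S" "y = fr q t"
    using xy(1,2) by (rule fr_cases2)
  have pq: "keys (p * q) \<subseteq> meeting W"
    using xy(3) p q by (simp add: fr_mult ext_mem[OF up_closed_meeting] fr_closure)
  have "keys p \<subseteq> meeting W \<or> keys q \<subseteq> meeting W"
  proof (rule ccontr)
    assume "\<not> (keys p \<subseteq> meeting W \<or> keys q \<subseteq> meeting W)"
    then obtain a b where "a \<in> keys p" "a \<notin> meeting W" "b \<in> keys q" "b \<notin> meeting W" by blast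
    then have "\<exists>c\<in>keys (p * q). keys c \<inter> W = {}"
      using p(1) q(1) by (intro keys_mult_avoid[OF finite_V]) (auto simp: meeting_def polynomials_def)
    then show False using pq by (auto simp: meeting_def)
  qed
  then show "x \<in> ext (meeting W) \<or> y \<in> ext (meeting W)"
    using p q ext_mem[OF up_closed_meeting] by blast
qed

lemma ext_mono: "U \<subseteq> U' \<Longrightarrow> ext U \<subseteq> ext U'"
  by (auto simp: ext_def)

lemma prime_chain:
  "\<exists>p. (\<forall>i\<le>card V. primeideal (p i) R) \<and> (\<forall>i<card V. p i \<subset> p (Suc i))"
proof -
  obtain f where f: "bij_betw f {0..<card V} V"
    using ex_bij_betw_nat_finite[OF finite_V] by blast
  let ?W = "\<lambda>i. f ` {..<i}"
  have "ext (meeting (?W i)) \<subset> ext (meeting (?W (Suc i)))" if i: "i < card V" for i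
  proof
    show "ext (meeting (?W i)) \<subseteq> ext (meeting (?W (Suc i)))"
      by (rule ext_mono) (auto simp: meeting_def)
    have neq: "f j \<noteq> f i" if "j < i" for j
      using f i that inj_onD[of f "{0..<card V}" j i] by (auto simp: bij_betw_def)
    have fi: "f i \<in> V" "f i \<notin> ?W i"
    proof -
      show "f i \<in> V" using f i by (auto simp: bij_betw_def)
      show "f i \<notin> ?W i"
      proof
        assume "f i \<in> ?W i"
        then obtain j where "j < i" "f i = f j" by blast
        then show False using neq[of j] by simp
      qed
    qed
    let ?a = "monom (f i) (1::nat)"
    have a: "?a \<in> monomials V" "?a \<in> meeting (?W (Suc i))" "?a \<notin> meeting (?W i)"
      using fi by (auto simp: monomials_def meeting_def)
    have "fr (monom ?a 1) 1 \<in> ext (meeting (?W (Suc i)))" "fr (monom ?a 1) 1 \<notin> ext (meeting (?W i))"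
      using a by (simp_all add: ext_mem[OF up_closed_meeting] polynomials_monom S_one)
    then show "ext (meeting (?W i)) \<noteq> ext (meeting (?W (Suc i)))" by blast
  qed
  then show ?thesis
    using meeting_prime by (intro exI[of _ "\<lambda>i. ext (meeting (?W i))"]) blast
qed

text \<open>In a relation between elements taken from the successive differences of a chain of primes, the
  lexicographically least monomial would have a coefficient in the last prime.\<close>
lemma lex_least_term:
  fixes Q :: "nat \<Rightarrow> ('v, 'k) mpoly set"
  assumes zero: "\<And>i. 0 \<in> Q i" and add: "\<And>i p q. p \<in> Q i \<Longrightarrow> q \<in> Q i \<Longrightarrow> p + q \<in> Q i"
    and mult: "\<And>i p q. p \<in> Q i \<Longrightarrow> q \<in> C \<Longrightarrow> p * q \<in> Q i"
    and prime: "\<And>i p q. i \<le> N \<Longrightarrow> p \<in> C \<Longrightarrow> q \<in> C \<Longrightarrow> p * q \<in> Q i \<Longrightarrow> p \<in> Q i \<or> q \<in> Q i"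
    and const: "\<And>i z. i \<le> N \<Longrightarrow> z \<noteq> 0 \<Longrightarrow> monom 0 z \<notin> Q i"
    and chain: "\<And>i. i < N \<Longrightarrow> Q i \<subseteq> Q (Suc i)"
    and x: "\<And>i. i < N \<Longrightarrow> x i \<in> C \<and> x i \<in> Q (Suc i) \<and> x i \<notin> Q i"
    and fin: "finite F" and ne: "F \<noteq> {}" and z: "\<And>\<alpha>. \<alpha> \<in> F \<Longrightarrow> z \<alpha> \<noteq> 0"
    and dist: "\<And>\<alpha> \<beta>. \<alpha> \<in> F \<Longrightarrow> \<beta> \<in> F \<Longrightarrow> (\<And>l. l \<in> {i..<N} \<Longrightarrow> \<alpha> l = \<beta> l) \<Longrightarrow> \<alpha> = \<beta>"
    and i: "i \<le> N"
  shows "(\<Sum>\<alpha>\<in>F. monom 0 (z \<alpha>) * (\<Prod>l\<in>{i..<N}. x l ^ (\<alpha> l :: nat))) \<notin> Q i"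
  using i fin ne z dist
proof (induction i arbitrary: F rule: inc_induct)
  case base
  \<comment> \<open>With no variable left, all exponents in \<open>F\<close> agree, so the sum is a
    single nonzero constant.\<close>
  then obtain \<alpha> where \<alpha>: "\<alpha> \<in> F" by blast
  have "\<beta> = \<alpha>" if "\<beta> \<in> F" for \<beta>
    using base.prems(4)[OF that \<alpha>] by simp
  then have "F = {\<alpha>}" using \<alpha> by blast
  then show ?case using const[of N "z \<alpha>"] base.prems(3) by simp
next
  case (step i)
  have xC: "x l \<in> C" if "l < N" for l using x that by blast
  have prodC: "(\<Prod>l\<in>{j..<N}. x l ^ (\<alpha> l :: nat)) \<in> C" for j \<alpha>
    using xC by (intro polynomials_prod polynomials_power) auto
  define s where "s = Min ((\<lambda>\<alpha>. \<alpha> i) ` F)"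
  have s: "s \<le> \<alpha> i" if "\<alpha> \<in> F" for \<alpha>
    unfolding s_def using step.prems that by (intro Min_le) auto
  have "s \<in> (\<lambda>\<alpha>. \<alpha> i) ` F"
    unfolding s_def using step.prems by (intro Min_in) auto
  then obtain \<alpha>0 where \<alpha>0: "\<alpha>0 \<in> F" "\<alpha>0 i = s" by blast
  define F' where "F' = {\<alpha> \<in> F. \<alpha> i = s}"
  have "F' \<subseteq> F" "finite F'" "F' \<noteq> {}" using \<alpha>0 step.prems by (auto simp: F'_def)
  let ?t = "\<lambda>j \<alpha>. monom 0 (z \<alpha>) * (\<Prod>l\<in>{j..<N}. x l ^ \<alpha> l)"
  have IH: "(\<Sum>\<alpha>\<in>F'. ?t (Suc i) \<alpha>) \<notin> Q (Suc i)"
  proof (rule step.IH)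
    fix \<alpha> \<beta> assume ab: "\<alpha> \<in> F'" "\<beta> \<in> F'" and eq: "\<And>l. l \<in> {Suc i..<N} \<Longrightarrow> \<alpha> l = \<beta> l"
    have "\<alpha> l = \<beta> l" if "l \<in> {i..<N}" for l
      using eq[of l] ab that by (cases "l = i") (auto simp: F'_def)
    then show "\<alpha> = \<beta>" using step.prems(4) ab by (auto simp: F'_def)
  qed (use \<open>F' \<subseteq> F\<close> \<open>finite F'\<close> \<open>F' \<noteq> {}\<close> step.prems in auto)
  \<comment> \<open>The terms with least exponent \<open>s\<close> of \<open>x i\<close> give
    \<open>H\<close>; the others carry a further factor \<open>x i\<close>, so the sum equals
    \<open>x i ^ s * (H + x i * G)\<close>. The power drops out because \<open>x i\<close> is not in
    the prime \<open>Q i\<close>. As \<open>x i\<close> is in \<open>Q (Suc i)\<close>, so would be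
    \<open>H\<close>, against the induction hypothesis.\<close>
  define G where "G = (\<Sum>\<alpha>\<in>F - F'. monom 0 (z \<alpha>) * (x i ^ (\<alpha> i - s - 1) * (\<Prod>l\<in>{Suc i..<N}. x l ^ \<alpha> l)))"
  define H where "H = (\<Sum>\<alpha>\<in>F'. ?t (Suc i) \<alpha>)"
  have HC: "H \<in> C" and GC: "G \<in> C"
    unfolding H_def G_def using prodC xC[OF step.hyps(2)]
    by (auto intro!: polynomials_sum polynomials_mult polynomials_const polynomials_power)
  have split: "(\<Prod>l\<in>{i..<N}. x l ^ \<alpha> l) = x i ^ \<alpha> i * (\<Prod>l\<in>{Suc i..<N}. x l ^ \<alpha> l)" for \<alpha> :: "nat \<Rightarrow> nat"
    using step.hyps(2) by (simp add: prod.atLeast_Suc_lessThan)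
  have "(\<Sum>\<alpha>\<in>F. ?t i \<alpha>) = (\<Sum>\<alpha>\<in>F'. ?t i \<alpha>) + (\<Sum>\<alpha>\<in>F - F'. ?t i \<alpha>)"
    using sum.subset_diff[OF \<open>F' \<subseteq> F\<close> step.prems(1)] by (simp add: add.commute)
  also have "(\<Sum>\<alpha>\<in>F'. ?t i \<alpha>) = x i ^ s * H"
    unfolding H_def sum_distrib_left split by (intro sum.cong refl) (simp add: F'_def mult_ac)
  also have "(\<Sum>\<alpha>\<in>F - F'. ?t i \<alpha>) = x i ^ s * (x i * G)"
    unfolding G_def sum_distrib_left split
  proof (intro sum.cong refl)
    fix \<alpha> assume "\<alpha> \<in> F - F'"
    then have "s < \<alpha> i" using s[of \<alpha>] by (auto simp: F'_def)
    then have "\<alpha> i = s + Suc (\<alpha> i - s - 1)" by simp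
    then have "x i ^ \<alpha> i = x i ^ s * (x i * x i ^ (\<alpha> i - s - 1))"
      by (metis power_Suc power_add)
    then show "monom 0 (z \<alpha>) * (x i ^ \<alpha> i * (\<Prod>l\<in>{Suc i..<N}. x l ^ \<alpha> l))
      = x i ^ s * (x i * (monom 0 (z \<alpha>) * (x i ^ (\<alpha> i - s - 1) * (\<Prod>l\<in>{Suc i..<N}. x l ^ \<alpha> l))))"
      by (simp add: mult_ac)
  qed
  finally have eq: "(\<Sum>\<alpha>\<in>F. ?t i \<alpha>) = x i ^ s * (H + x i * G)"
    by (simp add: distrib_left)
  have pow: "x i ^ r \<notin> Q i" for r
  proof (induction r)
    case 0
    then show ?case using const[of i 1] step.hyps by simp
  next
    case (Suc r)
    then show ?case
      using prime[of i "x i" "x i ^ r"] x[OF step.hyps(2)] step.hyps by (auto intro: polynomials_power)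
  qed
  show ?case
  proof
    assume "(\<Sum>\<alpha>\<in>F. ?t i \<alpha>) \<in> Q i"
    then have "H + x i * G \<in> Q i"
      using eq prime[of i "x i ^ s" "H + x i * G"] pow step.hyps HC GC xC[OF step.hyps(2)]
      by (auto intro: polynomials_add polynomials_mult polynomials_power)
    then have 1: "H + x i * G \<in> Q (Suc i)" using chain[OF step.hyps(2)] by blast
    have 2: "x i * (- G) \<in> Q (Suc i)"
      using x[OF step.hyps(2)] GC by (intro mult) (auto intro: polynomials_uminus)
    have "(H + x i * G) + x i * (- G) \<in> Q (Suc i)"
      by (rule add[OF 1 2])
    then have "H \<in> Q (Suc i)" by simp
    then show False using IH by (simp add: H_def)
  qed
qed

lemma prime_chain_bound:
  assumes prime: "\<And>i. i \<le> d \<Longrightarrow> primeideal (p i) R" and strict: "\<And>i. i < d \<Longrightarrow> p i \<subset> p (Suc i)"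
  shows "d \<le> card V"
proof (rule ccontr)
  assume "\<not> d \<le> card V"
  \<comment> \<open>A chain cut to \<open>card V + 1\<close> steps supplies exactly the
    \<open>card V + 1\<close> elements to which \<open>algebraically_dependent\<close>
    applies.\<close>
  define N where "N = Suc (card V)"
  have N: "N \<le> d" using \<open>\<not> d \<le> card V\<close> by (simp add: N_def)
  have idl: "ideal (p i) R" if "i \<le> N" for i
    using primeideal.axioms(1)[OF prime] N that by simp
  \<comment> \<open>Contraction of the primes to the polynomial ring. Beyond \<open>N\<close> the
    value \<open>C\<close> keeps the closure properties valid for every index, as
    \<open>lex_least_term\<close> asks.\<close>
  define Q where "Q i = (if i \<le> N then {a \<in> C. fr a 1 \<in> p i} else C)" for i
  have "\<exists>a. a \<in> C \<and> a \<in> Q (Suc i) \<and> a \<notin> Q i" if i: "i < N" for i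
  proof -
    obtain x where x: "x \<in> p (Suc i)" "x \<notin> p i" using strict[of i] i N by auto
    interpret I: ideal "p (Suc i)" R using idl i by simp
    obtain a s where a: "a \<in> C" "s \<in> S" "x = fr a s"
      using x(1) I.a_subset by (blast elim: carrier_R_cases)
    then show ?thesis
      using x ideal_fr_iff[OF idl a(1,2)] i by (intro exI[of _ a]) (auto simp: Q_def)
  qed
  then obtain x where x: "\<And>i. i < N \<Longrightarrow> x i \<in> C \<and> x i \<in> Q (Suc i) \<and> x i \<notin> Q i" by metis
  obtain F z where F: "finite F" "F \<noteq> {}" "\<forall>\<alpha>\<in>F. z \<alpha> \<noteq> (0::'k)" "F \<subseteq> {..card V} \<rightarrow>\<^sub>E UNIV"
    and rel: "(\<Sum>\<alpha>\<in>F. monom 0 (z \<alpha>) * (\<Prod>i\<le>card V. x i ^ \<alpha> i)) = 0"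
    using algebraically_dependent[OF finite_V, of x] x by (auto simp: N_def less_Suc_eq_le)
  have ran: "{..card V} = {0..<N}" by (auto simp: N_def)
  have "(\<Sum>\<alpha>\<in>F. monom 0 (z \<alpha>) * (\<Prod>l\<in>{0..<N}. x l ^ \<alpha> l)) \<notin> Q 0"
  proof (rule lex_least_term[where Q = Q])
    fix i show "0 \<in> Q i"
      using additive_subgroup.zero_closed[OF ideal.axioms(1)[OF idl]] by (simp add: Q_def polynomials_zero fr_zero)
    show "a + b \<in> Q i" if "a \<in> Q i" "b \<in> Q i" for a b
    proof (cases "i \<le> N")
      case True
      then have "fr a 1 \<oplus>\<^bsub>R\<^esub> fr b 1 \<in> p i"
        using that additive_subgroup.a_closed[OF ideal.axioms(1)[OF idl]] by (simp add: Q_def)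
      then show ?thesis using that by (auto simp: Q_def fr_add_same S_one polynomials_add split: if_splits)
    qed (use that in \<open>auto simp: Q_def polynomials_add\<close>)
    show "a * b \<in> Q i" if "a \<in> Q i" "b \<in> C" for a b
    proof (cases "i \<le> N")
      case True
      then have "fr a 1 \<otimes>\<^bsub>R\<^esub> fr b 1 \<in> p i"
        using that ideal.I_r_closed[OF idl] by (simp add: Q_def fr_closed S_one)
      then show ?thesis using that by (auto simp: Q_def fr_mult S_one polynomials_mult split: if_splits)
    qed (use that in \<open>auto simp: Q_def polynomials_mult\<close>)
    show "a \<in> Q i \<or> b \<in> Q i" if "i \<le> N" "a \<in> C" "b \<in> C" "a * b \<in> Q i" for a b
    proof -
      have "fr a 1 \<otimes>\<^bsub>R\<^esub> fr b 1 \<in> p i" using that by (simp add: Q_def fr_mult S_one)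
      then show ?thesis
        using primeideal.I_prime[OF prime, of i "fr a 1" "fr b 1"] N that by (auto simp: Q_def fr_closed S_one)
    qed
    show "monom 0 y \<notin> Q i" if "i \<le> N" "y \<noteq> 0" for y
    proof
      assume "monom 0 y \<in> Q i"
      then have "fr (monom 0 (inverse y)) 1 \<otimes>\<^bsub>R\<^esub> fr (monom 0 y) 1 \<in> p i"
        using that ideal.I_l_closed[OF idl] by (simp add: Q_def fr_closed S_one polynomials_const)
      then have "\<one>\<^bsub>R\<^esub> \<in> p i"
        using that by (simp add: fr_mult S_one polynomials_const mult_single fr_one)
      then show False
        using ideal.one_imp_carrier[OF idl[OF that(1)]] primeideal.I_notcarr[OF prime[of i]] that N by simp
    qed
    show "Q i \<subseteq> Q (Suc i)" if "i < N"
      using strict[of i] N that by (auto simp: Q_def)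
  next
    fix \<alpha> \<beta> assume "\<alpha> \<in> F" "\<beta> \<in> F" "\<And>l. l \<in> {0..<N} \<Longrightarrow> \<alpha> l = \<beta> l"
    moreover from this F(4) have "\<alpha> \<in> {0..<N} \<rightarrow>\<^sub>E UNIV" "\<beta> \<in> {0..<N} \<rightarrow>\<^sub>E UNIV"
      unfolding ran by blast+
    ultimately show "\<alpha> = \<beta>" by (metis PiE_ext)
  qed (use x F in auto)
  moreover have "0 \<in> Q 0"
    using additive_subgroup.zero_closed[OF ideal.axioms(1)[OF idl]] by (simp add: Q_def polynomials_zero fr_zero)
  ultimately show False using rel unfolding ran by simp
qed

lemma krull_dim_R: "krull_dim R = enat (card V)"
  unfolding krull_dim_def
proof (rule antisym)
  show "Sup {enat d | d. \<exists>p. (\<forall>i\<le>d. primeideal (p i) R) \<and> (\<forall>i<d. p i \<subset> p (Suc i))} \<le> enat (card V)"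
    using prime_chain_bound by (intro Sup_least) fastforce
  show "enat (card V) \<le> Sup {enat d | d. \<exists>p. (\<forall>i\<le>d. primeideal (p i) R) \<and> (\<forall>i<d. p i \<subset> p (Suc i))}"
    using prime_chain by (intro Sup_upper) blast
qed

section \<open>The edge ideal as a monomial ideal\<close>

lemma var_prod: "finite e \<Longrightarrow> (\<Prod>x\<in>e. var x) = (monom (\<Sum>x\<in>e. monom x 1) 1 :: ('v, 'k) mpoly)"
  by (induction e rule: finite_induct) (auto simp: var_def mult_single)

text \<open>The exponents of the edge ideal. Its generators are squarefree, so divisibility by one
  of them is a condition on the support alone.\<close>

definition above :: "'v set set \<Rightarrow> ('v \<Rightarrow>\<^sub>0 nat) set" where
  "above E = {a \<in> monomials V. \<exists>e\<in>E. e \<subseteq> keys a}"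

lemma up_closed_above: "up_closed V (above E)"
  by (auto simp: up_closed_def above_def keys_add_nat)

lemma genideal_edges:
  assumes E: "\<And>e. e \<in> E \<Longrightarrow> e \<subseteq> V"
  shows "Idl\<^bsub>R\<^esub> ((\<lambda>e. fr (\<Prod>x\<in>e. var x) 1) ` E) = ext (above E)"
proof
  have fin: "finite e" if "e \<in> E" for e
    using E[OF that] finite_V finite_subset by blast
  let ?m = "\<lambda>e. \<Sum>x\<in>e. monom x (1::nat)"
  have lm: "lookup (?m e) x = (if x \<in> e then 1 else 0)" if "e \<in> E" for e x
    using fin[OF that] by (simp add: lookup_sum lookup_single when_def)
  then have km: "keys (?m e) = e" if "e \<in> E" for e
    unfolding set_eq_iff in_keys_iff lm[OF that] by simp
  have m: "?m e \<in> above E" "?m e \<in> monomials V" if "e \<in> E" for e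
    using km[OF that] E that by (auto simp: above_def monomials_def)
  let ?G = "(\<lambda>e. fr (\<Prod>x\<in>e. var x) 1) ` E"
  have G: "?G = (\<lambda>e. fr (monom (?m e) 1) 1) ` E"
    using fin by (intro image_cong) (simp_all add: var_prod)
  have Gc: "?G \<subseteq> carrier R"
    unfolding G using m by (auto intro!: fr_closed polynomials_monom S_one)
  show "Idl\<^bsub>R\<^esub> ?G \<subseteq> ext (above E)"
    by (rule R.genideal_minimal[OF ext_ideal[OF up_closed_above]])
       (use m in \<open>auto simp: G intro!: extI polynomials_monom S_one\<close>)
  have I: "ideal (Idl\<^bsub>R\<^esub> ?G) R" by (rule R.genideal_ideal[OF Gc])
  show "ext (above E) \<subseteq> Idl\<^bsub>R\<^esub> ?G"
  proof (rule ext_minimal[OF I])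
    show "above E \<subseteq> monomials V" by (auto simp: above_def)
    fix a assume "a \<in> above E"
    then obtain e where e: "e \<in> E" "e \<subseteq> keys a" and aV: "a \<in> monomials V" by (auto simp: above_def)
    let ?b = "a - ?m e"
    have a: "a = ?m e + ?b"
      using lm[OF e(1)] e(2) by (intro poly_mapping_eqI) (auto simp: lookup_add lookup_minus in_keys_iff)
    then have bV: "?b \<in> monomials V" using aV monomials_add by metis
    have "fr (monom (?m e) 1) 1 \<in> Idl\<^bsub>R\<^esub> ?G"
      using R.genideal_self[OF Gc] e(1) unfolding G by blast
    then have "fr (monom (?m e) 1) 1 \<otimes>\<^bsub>R\<^esub> fr (monom ?b 1) 1 \<in> Idl\<^bsub>R\<^esub> ?G"
      using bV by (intro ideal.I_r_closed[OF I]) (auto intro!: fr_closed polynomials_monom S_one)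
    then show "fr (monom a 1) 1 \<in> Idl\<^bsub>R\<^esub> ?G"
      using m[OF e(1)] bV a by (simp add: fr_mult polynomials_monom S_one mult_single)
  qed
qed

end

section \<open>Length of the torsion of a monomial quotient\<close>

locale monomial_quotient = local_polynomials V k for V :: "'v set" and k :: "'k::field itself" +
  fixes U U' :: "('v \<Rightarrow>\<^sub>0 nat) set"
  assumes U: "up_closed V U" and U': "up_closed V U'" and U'U: "U' \<subseteq> U"
begin

abbreviation "K \<equiv> ext U'"
abbreviation "M \<equiv> quotient_module (ideal_module R (ext U)) K"
abbreviation "H \<equiv> local_cohomology_0 R (max_ideal R) M"
abbreviation "cs x \<equiv> K +>\<^bsub>R\<^esub> x"

text \<open>The exponents that will form a basis of the torsion: being killed by a power of each
  variable amounts to being killed by a power of the maximal ideal.\<close>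

definition saturated :: "('v \<Rightarrow>\<^sub>0 nat) set" where
  "saturated = {a \<in> U - U'. \<forall>x\<in>V. \<exists>N. a + monom x N \<in> U'}"

lemma K_ideal: "ideal K R"
  by (rule ext_ideal[OF U'])

sublocale K: ideal K R
  by (rule K_ideal)

lemma cs_eq: "x \<in> carrier R \<Longrightarrow> y \<in> carrier R \<Longrightarrow> cs x = cs y \<longleftrightarrow> x \<ominus>\<^bsub>R\<^esub> y \<in> K"
  using R.quotient_eq_iff_same_a_r_cos[OF K_ideal] by blast

lemma cs_zero: "cs \<zero>\<^bsub>R\<^esub> = K"
  by (rule K.a_rcos_const[OF K.zero_closed])

lemma cs_eq_K: "x \<in> carrier R \<Longrightarrow> cs x = K \<longleftrightarrow> x \<in> K"
  using cs_eq[of x "\<zero>\<^bsub>R\<^esub>"] cs_zero by (simp add: R.minus_eq)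

lemma ext_subset_carrier: "ext W \<subseteq> carrier R"
  by (auto simp: ext_def intro: fr_closed)

lemma carrier_M: "carrier M = cs ` ext U"
  by (auto simp: quotient_module_def A_RCOSETS_def RCOSETS_def ideal_module_def a_r_coset_def r_coset_def)

lemma zero_M: "\<zero>\<^bsub>M\<^esub> = K"
  by (simp add: quotient_module_def)

lemma add_M: "x \<in> carrier R \<Longrightarrow> y \<in> carrier R \<Longrightarrow> cs x \<oplus>\<^bsub>M\<^esub> cs y = cs (x \<oplus>\<^bsub>R\<^esub> y)"
  using K.a_rcos_sum[of x y]
  by (simp add: quotient_module_def set_add_def set_mult_def ideal_module_def)

lemma smult_M:
  assumes r: "r \<in> carrier R" and x: "x \<in> carrier R"
  shows "r \<odot>\<^bsub>M\<^esub> cs x = cs (r \<otimes>\<^bsub>R\<^esub> x)"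
proof -
  have "r \<odot>\<^bsub>M\<^esub> cs x = (\<Union>y\<in>cs x. cs (r \<otimes>\<^bsub>R\<^esub> y))"
    by (simp add: quotient_module_def ideal_module_def a_r_coset_def r_coset_def)
  also have "\<dots> = cs (r \<otimes>\<^bsub>R\<^esub> x)"
  proof (rule SUP_eq_const)
    show "cs x \<noteq> {}" using K.a_rcos_self[OF x] by blast
    fix y assume "y \<in> cs x"
    then obtain h where h: "h \<in> K" "y = h \<oplus>\<^bsub>R\<^esub> x" by (auto simp: a_r_coset_def r_coset_def)
    then have hc: "h \<in> carrier R" using K.a_subset by blast
    have "r \<otimes>\<^bsub>R\<^esub> y \<ominus>\<^bsub>R\<^esub> r \<otimes>\<^bsub>R\<^esub> x = r \<otimes>\<^bsub>R\<^esub> h"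
      unfolding h(2) using r x hc by algebra
    then have "r \<otimes>\<^bsub>R\<^esub> y \<ominus>\<^bsub>R\<^esub> r \<otimes>\<^bsub>R\<^esub> x \<in> K" using K.I_l_closed[OF h(1) r] by simp
    then show "cs (r \<otimes>\<^bsub>R\<^esub> y) = cs (r \<otimes>\<^bsub>R\<^esub> x)"
      using r x hc h(2) by (subst cs_eq) auto
  qed
  finally show ?thesis .
qed

lemma H_simps:
  "\<zero>\<^bsub>H\<^esub> = K" "X \<oplus>\<^bsub>H\<^esub> Y = X \<oplus>\<^bsub>M\<^esub> Y" "r \<odot>\<^bsub>H\<^esub> X = r \<odot>\<^bsub>M\<^esub> X"
  by (simp_all add: local_cohomology_0_def zero_M)

lemma up_closed_saturated: "up_closed V (saturated \<union> U')"
  unfolding up_closed_def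
proof (intro conjI ballI)
  show "saturated \<union> U' \<subseteq> monomials V"
    using U U' by (auto simp: saturated_def up_closed_def)
  fix a b assume a: "a \<in> saturated \<union> U'" and b: "b \<in> monomials V"
  show "a + b \<in> saturated \<union> U'"
  proof (cases "a + b \<in> U'")
    case False
    then have "a \<in> saturated" using a b U' by (auto simp: up_closed_def)
    moreover have "(a + b) + monom x N \<in> U'" if "a + monom x N \<in> U'" for x N
      using U' that b unfolding up_closed_def by (metis add.assoc add.commute)
    ultimately show ?thesis
      using False b U unfolding saturated_def up_closed_def by blast
  qed blast
qed

lemma mpow_total: "b \<in> mpow (monomials V - {0}) n \<Longrightarrow> n \<le> total b"
proof (induction n arbitrary: b)
  case (Suc n)
  then obtain c d where cd: "c \<in> mpow (monomials V - {0}) n" "d \<noteq> 0" "b = c + d"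
    by (auto simp: msum_def)
  have "total d \<noteq> 0" using cd(2) by (simp add: total_eq_0_iff)
  then show ?case using Suc.IH[OF cd(1)] cd(3) by (simp add: total_add)
qed simp

lemma monom_mem_mpow: "x \<in> V \<Longrightarrow> monom x n \<in> mpow (monomials V - {0}) n"
proof (induction n)
  case (Suc n)
  have "monom x (1::nat) \<noteq> 0"
    using lookup_single_eq[of x "1::nat"] by (metis lookup_zero one_neq_zero)
  then have "monom x 1 \<in> monomials V - {0}" using Suc.prems by (simp add: monomials_def)
  moreover have "monom x (Suc n) = monom x n + monom x 1"
    by (simp add: single_add[symmetric])
  ultimately show ?case using Suc by (auto simp: msum_def)
qed (simp add: monomials_def)

lemma max_ideal_power: "ideal_power R (max_ideal R) n = ext (mpow (monomials V - {0}) n)"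
  unfolding max_ideal_R by (rule ideal_power_ext[OF ext_maximal_ideal(1)])

text \<open>In one direction, powers of single variables belong to the powers of the maximal ideal,
  and multiplying by a monomial cannot cause cancellation, so each key of the numerator is tested
  separately. In the other, a monomial of large degree contains a large power of some
  variable.\<close>

lemma carrier_H: "carrier H = cs ` ext (saturated \<union> U')"
proof
  have sub: "saturated \<union> U' \<subseteq> U" using U'U by (auto simp: saturated_def)
  show "carrier H \<subseteq> cs ` ext (saturated \<union> U')"
  proof
    fix X assume "X \<in> carrier H"
    then obtain n where X: "X \<in> carrier M" and n: "\<forall>r\<in>ext (mpow (monomials V - {0}) n). r \<odot>\<^bsub>M\<^esub> X = K"
      by (auto simp: local_cohomology_0_def max_ideal_power zero_M)
    from X obtain p s where p: "p \<in> C" "keys p \<subseteq> U" "s \<in> S" "X = cs (fr p s)"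
      unfolding carrier_M by (auto simp: ext_def)
    have "a \<in> saturated \<union> U'" if a: "a \<in> keys p" for a
    proof -
      have "a + monom x n \<in> U'" if x: "x \<in> V" for x
      proof -
        let ?b = "monom x n"
        have b: "?b \<in> monomials V" using x by (simp add: monomials_def)
        have r: "fr (monom ?b 1) 1 \<in> ext (mpow (monomials V - {0}) n)"
          using monom_mem_mpow[OF x] b by (intro extI polynomials_monom S_one) auto
        then have rc: "fr (monom ?b 1) 1 \<in> carrier R" using ext_subset_carrier by blast
        have "cs (fr (monom ?b 1) 1 \<otimes>\<^bsub>R\<^esub> fr p s) = K"
          using n r smult_M[OF rc fr_closed[OF p(1,3)]] p(4) by simp
        then have "fr (monom ?b 1) 1 \<otimes>\<^bsub>R\<^esub> fr p s \<in> K"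
          using cs_eq_K rc fr_closed[OF p(1,3)] by simp
        then have "fr (monom ?b 1 * p) (1 * s) \<in> K"
          using fr_mult[OF polynomials_monom[OF b] S_one p(1,3)] by simp
        then have "keys (monom ?b 1 * p) \<subseteq> U'"
          using ext_mem[OF U'] p polynomials_mult[OF polynomials_monom[OF b] p(1)] by simp
        moreover have "?b + a \<in> keys (monom ?b 1 * p)"
          using a by (simp add: in_keys_iff lookup_monom_mult)
        ultimately show ?thesis by (auto simp: add.commute)
      qed
      then show ?thesis using a p(2) by (auto simp: saturated_def)
    qed
    then have "fr p s \<in> ext (saturated \<union> U')" using p by (intro extI) auto
    then show "X \<in> cs ` ext (saturated \<union> U')" using p by blast
  qed
  show "cs ` ext (saturated \<union> U') \<subseteq> carrier H"
  proof
    fix X assume "X \<in> cs ` ext (saturated \<union> U')"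
    then obtain p s where p: "p \<in> C" "keys p \<subseteq> saturated \<union> U'" "s \<in> S" "X = cs (fr p s)"
      by (auto simp: ext_def)
    have XM: "X \<in> carrier M"
      unfolding carrier_M using p sub by (auto intro!: imageI extI)
    have "\<exists>N. a + monom x N \<in> U'" if "a \<in> keys p" "x \<in> V" for a x
    proof (cases "a \<in> U'")
      case True
      then show ?thesis by (intro exI[of _ 0]) simp
    next
      case False
      then show ?thesis using that p(2) by (auto simp: saturated_def)
    qed
    then obtain N where N: "\<And>a x. a \<in> keys p \<Longrightarrow> x \<in> V \<Longrightarrow> a + monom x (N a x) \<in> U'" by metis
    define B where "B = (\<Sum>a\<in>keys p. \<Sum>x\<in>V. N a x)"
    have B: "N a x \<le> B" if "a \<in> keys p" "x \<in> V" for a x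
    proof -
      have "N a x \<le> (\<Sum>x\<in>V. N a x)"
        using that finite_V by (intro member_le_sum[of x V "N a"]) auto
      also have "\<dots> \<le> B"
        unfolding B_def using that by (intro member_le_sum[of a "keys p" "\<lambda>a. \<Sum>x\<in>V. N a x"]) auto
      finally show ?thesis .
    qed
    \<comment> \<open>Pigeonhole: a monomial in \<open>card V\<close> variables of degree greater
      than \<open>card V * B\<close> has some exponent at least \<open>B\<close>.\<close>
    define n where "n = card V * B + 1"
    have "r \<odot>\<^bsub>M\<^esub> X = K" if r: "r \<in> ext (mpow (monomials V - {0}) n)" for r
    proof -
      obtain q t where q: "q \<in> C" "keys q \<subseteq> mpow (monomials V - {0}) n" "t \<in> S" "r = fr q t"
        using r by (auto simp: ext_def)
      have "keys (q * p) \<subseteq> U'"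
      proof
        fix c assume "c \<in> keys (q * p)"
        then obtain b a where ba: "b \<in> keys q" "a \<in> keys p" "c = b + a" using keys_mult[of q p] by blast
        have bV: "b \<in> monomials V" and aV: "a \<in> monomials V"
          using ba q(1) p(1) by (auto simp: polynomials_def)
        have "\<exists>x\<in>V. B \<le> lookup b x"
        proof (rule ccontr)
          assume "\<not> (\<exists>x\<in>V. B \<le> lookup b x)"
          then have "total b \<le> (\<Sum>x\<in>V. B)"
            unfolding total_eq[OF finite_V bV] by (intro sum_mono) auto
          then show False using mpow_total[of b n] q(2) ba(1) by (auto simp: n_def)
        qed
        then obtain x where x: "x \<in> V" "B \<le> lookup b x" by blast
        let ?d = "b - monom x (N a x)"
        have b: "b = monom x (N a x) + ?d"
          using x B[OF ba(2) x(1)]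
          by (intro poly_mapping_eqI) (auto simp: lookup_add lookup_minus lookup_single when_def)
        then have "?d \<in> monomials V" using bV monomials_add by metis
        then have "(a + monom x (N a x)) + ?d \<in> U'"
          using N[OF ba(2) x(1)] U' by (auto simp: up_closed_def)
        moreover have "c = (a + monom x (N a x)) + ?d"
          unfolding ba(3) using b by (metis add.commute add.left_commute)
        ultimately show "c \<in> U'" by simp
      qed
      then have "r \<otimes>\<^bsub>R\<^esub> fr p s \<in> K"
        using q p by (simp add: fr_mult extI polynomials_mult S_mult)
      then show ?thesis
        using p q by (simp add: smult_M fr_closed cs_eq_K)
    qed
    then show "X \<in> carrier H"
      using XM by (auto simp: local_cohomology_0_def max_ideal_power zero_M)
  qed
qed

lemma ext_submodule:
  assumes W: "up_closed V W" and W': "U' \<subseteq> W" "W \<subseteq> saturated \<union> U'"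
  shows "submodule (cs ` ext W) R H"
proof -
  interpret W: ideal "ext W" R by (rule ext_ideal[OF W])
  have Wc: "x \<in> carrier R" if "x \<in> ext W" for x using that ext_subset_carrier by blast
  have sub: "cs ` ext W \<subseteq> carrier H"
    unfolding carrier_H using ext_mono[OF W'(2)] by blast
  \<comment> \<open>\<open>H\<close> is not interpreted as a group here, so the definite description
    behind the inverse is evaluated directly.\<close>
  have inv: "inv\<^bsub>add_monoid H\<^esub> (cs x) = cs (\<ominus>\<^bsub>R\<^esub> x)" if x: "x \<in> ext W" for x
    unfolding m_inv_def
  proof (rule the_equality)
    have "cs (\<ominus>\<^bsub>R\<^esub> x) \<in> carrier H" using sub x by auto
    then show "cs (\<ominus>\<^bsub>R\<^esub> x) \<in> carrier (add_monoid H) \<and>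
      cs x \<otimes>\<^bsub>add_monoid H\<^esub> cs (\<ominus>\<^bsub>R\<^esub> x) = \<one>\<^bsub>add_monoid H\<^esub> \<and>
      cs (\<ominus>\<^bsub>R\<^esub> x) \<otimes>\<^bsub>add_monoid H\<^esub> cs x = \<one>\<^bsub>add_monoid H\<^esub>"
      using Wc[OF x] by (simp add: H_simps add_M R.r_neg R.l_neg cs_zero)
    fix Y assume Y: "Y \<in> carrier (add_monoid H) \<and> cs x \<otimes>\<^bsub>add_monoid H\<^esub> Y = \<one>\<^bsub>add_monoid H\<^esub> \<and>
      Y \<otimes>\<^bsub>add_monoid H\<^esub> cs x = \<one>\<^bsub>add_monoid H\<^esub>"
    then obtain y where y: "y \<in> carrier R" "Y = cs y"
      using ext_subset_carrier by (auto simp: carrier_H)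
    then have "cs (y \<oplus>\<^bsub>R\<^esub> x) = K" using Y Wc[OF x] by (simp add: H_simps add_M)
    then have "y \<oplus>\<^bsub>R\<^esub> x \<in> K" using cs_eq_K y Wc[OF x] by simp
    moreover have "y \<ominus>\<^bsub>R\<^esub> (\<ominus>\<^bsub>R\<^esub> x) = y \<oplus>\<^bsub>R\<^esub> x" using y Wc[OF x] by (simp add: R.minus_eq)
    ultimately show "Y = cs (\<ominus>\<^bsub>R\<^esub> x)" using y Wc[OF x] by (simp add: cs_eq)
  qed
  show ?thesis
  proof (intro submodule.intro subgroup.intro submodule_axioms.intro)
    show "cs ` ext W \<subseteq> carrier (add_monoid H)" using sub by simp
    show "\<one>\<^bsub>add_monoid H\<^esub> \<in> cs ` ext W"
      using W.zero_closed cs_zero by (auto simp: H_simps)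
  next
    fix X Y assume "X \<in> cs ` ext W" "Y \<in> cs ` ext W"
    then obtain x y where "x \<in> ext W" "y \<in> ext W" "X = cs x" "Y = cs y" by blast
    then show "X \<otimes>\<^bsub>add_monoid H\<^esub> Y \<in> cs ` ext W"
      using Wc by (auto simp: H_simps add_M)
  next
    fix X assume "X \<in> cs ` ext W"
    then show "inv\<^bsub>add_monoid H\<^esub> X \<in> cs ` ext W"
      using inv by auto
  next
    fix r X assume "r \<in> carrier R" "X \<in> cs ` ext W"
    then show "r \<odot>\<^bsub>H\<^esub> X \<in> cs ` ext W"
      using Wc W.I_l_closed by (auto simp: H_simps smult_M)
  qed
qed

text \<open>The monomials are adjoined to \<open>U'\<close> one at a time by descending degree, which keeps the sets
  closed under multiplication.\<close>
lemma submodule_chain: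
  assumes fin: "finite saturated"
  shows "\<exists>N. (\<forall>i\<le>card saturated. submodule (N i) R H) \<and> (\<forall>i<card saturated. N i \<subset> N (Suc i))"
proof -
  obtain ys where ys: "set ys = saturated" "distinct ys"
    using finite_distinct_list[OF fin] by blast
  define xs where "xs = rev (sort_key total ys)"
  have xs: "set xs = saturated" "distinct xs" "length xs = card saturated"
    using ys distinct_card[of ys] by (simp_all add: xs_def)
  have desc: "total (xs ! j) \<le> total (xs ! i)" if "i \<le> j" "j < length xs" for i j
  proof -
    have "sorted (map total (rev xs))" by (simp add: xs_def)
    then have "sorted_wrt (\<ge>) (map total xs)"
      by (simp add: rev_map[symmetric] sorted_wrt_rev)
    then show ?thesis
      using that sorted_wrt_nth_less[of "(\<ge>)" "map total xs" i j] by (cases "i = j") auto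
  qed
  define W where "W i = U' \<union> set (take i xs)" for i
  have Wsub: "U' \<subseteq> W i" "W i \<subseteq> saturated \<union> U'" for i
    using xs set_take_subset[of i xs] by (auto simp: W_def)
  have up: "up_closed V (W i)" for i
    unfolding up_closed_def
  proof (intro conjI ballI)
    show "W i \<subseteq> monomials V"
      using Wsub[of i] up_closed_saturated unfolding up_closed_def by blast
    fix a b assume a: "a \<in> W i" and b: "b \<in> monomials V"
    show "a + b \<in> W i"
    proof (cases "a + b \<in> U' \<or> b = 0")
      case True
      then show ?thesis using a by (auto simp: W_def)
    next
      case False
      then have "a \<notin> U'" using U' b by (auto simp: up_closed_def)
      then obtain l where l: "l < i" "l < length xs" "a = xs ! l"
        using a by (auto simp: W_def in_set_conv_nth)
      have "a + b \<in> saturated \<union> U'"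
        using a b Wsub[of i] up_closed_saturated unfolding up_closed_def by blast
      then have "a + b \<in> set xs" using False xs(1) by blast
      then obtain j where j: "j < length xs" "a + b = xs ! j"
        by (metis in_set_conv_nth)
      \<comment> \<open>Multiplication by a nontrivial monomial raises the degree, so the product
        stands earlier in the descending list and has already been adjoined.\<close>
      have "total b \<noteq> 0" using False by (simp add: total_eq_0_iff)
      then have "total (xs ! l) < total (xs ! j)"
        using l j by (simp flip: l(3) j(2) add: total_add)
      then have "j < l" using desc[of l j] j by (meson not_le)
      then have "j < i" using l by simp
      then show ?thesis using j by (auto simp: W_def in_set_conv_nth intro!: exI[of _ j])
    qed
  qed
  have strict: "cs ` ext (W i) \<subset> cs ` ext (W (Suc i))" if i: "i < card saturated" for i
  proof
    have "W i \<subseteq> W (Suc i)"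
      using set_take_subset_set_take[of i "Suc i" xs] by (auto simp: W_def)
    then show "cs ` ext (W i) \<subseteq> cs ` ext (W (Suc i))"
      by (intro image_mono ext_mono)
    let ?a = "xs ! i"
    have il: "i < length xs" using i xs by simp
    have a: "?a \<in> saturated" using il xs(1) nth_mem by blast
    then have aV: "?a \<in> monomials V" and aU: "?a \<notin> U'" using U by (auto simp: saturated_def up_closed_def)
    have "?a \<in> W (Suc i)" using il by (simp add: W_def take_Suc_conv_app_nth)
    then have m: "fr (monom ?a 1) 1 \<in> ext (W (Suc i))"
      using aV by (intro extI polynomials_monom S_one) auto
    have "?a \<notin> W i"
      using aU xs(2) il by (auto simp: W_def in_set_conv_nth nth_eq_iff_index_eq)
    then have nm: "fr (monom ?a 1) 1 \<notin> ext (W i)"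
      using aV by (simp add: ext_mem[OF up] polynomials_monom S_one)
    have "cs (fr (monom ?a 1) 1) \<notin> cs ` ext (W i)"
    proof
      assume "cs (fr (monom ?a 1) 1) \<in> cs ` ext (W i)"
      then obtain y where y: "y \<in> ext (W i)" "cs (fr (monom ?a 1) 1) = cs y" by blast
      interpret Wi: ideal "ext (W i)" R by (rule ext_ideal[OF up])
      let ?x = "fr (monom ?a 1) 1"
      have c: "?x \<in> carrier R" "y \<in> carrier R" using m y ext_subset_carrier by blast+
      have "?x \<ominus>\<^bsub>R\<^esub> y \<in> ext (W i)"
        using y c cs_eq ext_mono[OF Wsub(1)] by blast
      then have "(?x \<ominus>\<^bsub>R\<^esub> y) \<oplus>\<^bsub>R\<^esub> y \<in> ext (W i)" using y(1) by (rule Wi.a_closed)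
      moreover have "(?x \<ominus>\<^bsub>R\<^esub> y) \<oplus>\<^bsub>R\<^esub> y = ?x" using c by algebra
      ultimately show False using nm by simp
    qed
    then show "cs ` ext (W i) \<noteq> cs ` ext (W (Suc i))" using m by blast
  qed
  show ?thesis
    using ext_submodule[OF up Wsub] strict by (intro exI[of _ "\<lambda>i. cs ` ext (W i)"]) blast
qed

text \<open>Linear algebra over the field. Each step of the chain provides a polynomial that is new
  in the next submodule. With more of them than saturated exponents, some nontrivial combination has
  no saturated coefficient and vanishes in \<open>H\<close>; its last term then lies in the
  submodule where it was new.\<close>

lemma submodule_chain_bound:
  assumes fin: "finite saturated"
    and sub: "\<And>i. i \<le> d \<Longrightarrow> submodule (N i) R H" and strict: "\<And>i. i < d \<Longrightarrow> N i \<subset> N (Suc i)"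
  shows "d \<le> card saturated"
proof (rule ccontr)
  assume less: "\<not> d \<le> card saturated"
  define Q where "Q i = {p \<in> C. keys p \<subseteq> saturated \<union> U' \<and> cs (fr p 1) \<in> N i}" for i
  have add: "p + q \<in> Q i" if "i \<le> d" "p \<in> Q i" "q \<in> Q i" for i p q
  proof -
    have "cs (fr p 1) \<oplus>\<^bsub>H\<^esub> cs (fr q 1) \<in> N i"
      using that subgroup.m_closed[OF submodule.axioms(1)[OF sub]] by (auto simp: Q_def)
    then have "cs (fr (p + q) 1) \<in> N i"
      using that by (simp add: Q_def H_simps add_M fr_closed S_one fr_add_same)
    moreover have "keys (p + q) \<subseteq> saturated \<union> U'"
      using that Poly_Mapping.keys_add[of p q] by (auto simp: Q_def)
    ultimately show ?thesis using that by (simp add: Q_def polynomials_add)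
  qed
  have mult: "q * p \<in> Q i" if "i \<le> d" "p \<in> Q i" "q \<in> C" for i p q
  proof -
    have "fr q 1 \<odot>\<^bsub>H\<^esub> cs (fr p 1) \<in> N i"
      using that submodule.smult_closed[OF sub] by (auto simp: Q_def fr_closed S_one)
    then have "cs (fr (q * p) 1) \<in> N i"
      using that by (simp add: Q_def H_simps smult_M fr_closed S_one fr_mult)
    moreover have "keys (q * p) \<subseteq> saturated \<union> U'"
      using up_closed_keys_mult[OF up_closed_saturated] that by (auto simp: Q_def)
    ultimately show ?thesis using that by (simp add: Q_def polynomials_mult)
  qed
  have base: "p \<in> Q i" if "i \<le> d" "p \<in> C" "keys p \<subseteq> U'" for i p
  proof -
    have "K \<in> N i"
      using subgroup.one_closed[OF submodule.axioms(1)[OF sub]] that by (simp add: H_simps)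
    moreover have "cs (fr p 1) = K"
      using that by (simp add: cs_eq_K fr_closed S_one extI)
    ultimately show ?thesis using that by (auto simp: Q_def)
  qed
  have "N i \<subseteq> N j" if "i \<le> j" "j \<le> d" for i j
    using that
  proof (induction j rule: dec_induct)
    case (step n)
    then show ?case using strict[of n] by auto
  qed simp
  then have mono: "Q i \<subseteq> Q j" if "i \<le> j" "j \<le> d" for i j
    using that by (auto simp: Q_def)
  have "\<exists>p. p \<in> Q (Suc i) \<and> p \<notin> Q i" if i: "i < d" for i
  proof -
    obtain X where X: "X \<in> N (Suc i)" "X \<notin> N i" using strict[OF i] by blast
    have "X \<in> carrier H"
      using X subgroup.subset[OF submodule.axioms(1)[OF sub[of "Suc i"]]] i by auto
    then obtain p s where p: "p \<in> C" "keys p \<subseteq> saturated \<union> U'" "s \<in> S" "X = cs (fr p s)"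
      unfolding carrier_H by (auto simp: ext_def)
    \<comment> \<open>Multiplying by the denominator and dividing again stays within a submodule, so
      a polynomial witness suffices.\<close>
    have "fr s 1 \<odot>\<^bsub>H\<^esub> X \<in> N (Suc i)"
      using submodule.smult_closed[OF sub[of "Suc i"] _ X(1)] i p by (simp add: fr_closed S_one S_subset)
    then have "p \<in> Q (Suc i)"
      using p fr_clear[OF p(1,3)] by (simp add: Q_def H_simps smult_M fr_closed S_one S_subset)
    moreover have "p \<notin> Q i"
    proof
      assume "p \<in> Q i"
      then have "fr 1 s \<odot>\<^bsub>H\<^esub> cs (fr p 1) \<in> N i"
        using submodule.smult_closed[OF sub[of i]] i p by (simp add: Q_def fr_closed polynomials_one)
      then show False
        using p X fr_split[OF p(1,3)] by (simp add: H_simps smult_M fr_closed S_one polynomials_one)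
    qed
    ultimately show ?thesis by blast
  qed
  then obtain p where p: "\<And>i. i < d \<Longrightarrow> p i \<in> Q (Suc i) \<and> p i \<notin> Q i" by metis
  obtain z where z: "\<exists>i\<in>{..<d}. z i \<noteq> 0" "\<forall>a\<in>saturated. (\<Sum>i\<in>{..<d}. z i * lookup (p i) a) = 0"
    using underdetermined_system[OF fin, of "{..<d}" "\<lambda>a i. lookup (p i) a"] less by auto
  \<comment> \<open>The last index with a nonzero coefficient: all earlier polynomials already lie
    in \<open>Q i\<close>, so the relation expresses \<open>p i\<close> by elements of
    \<open>Q i\<close>.\<close>
  define i where "i = Max {i \<in> {..<d}. z i \<noteq> 0}"
  have "i \<in> {i \<in> {..<d}. z i \<noteq> 0}"
    unfolding i_def using z(1) by (intro Max_in) auto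
  then have i: "i < d" "z i \<noteq> 0" by auto
  have imax: "z j = 0" if "j < d" "i < j" for j
    using that Max_ge[of "{i \<in> {..<d}. z i \<noteq> 0}" j] unfolding i_def by fastforce
  define P where "P = (\<Sum>j<i. monom 0 (z j) * p j)"
  have P: "P \<in> Q i"
  proof -
    have "(\<Sum>j\<in>J. monom 0 (z j) * p j) \<in> Q i" if "J \<subseteq> {..<i}" "finite J" for J
      using that(2,1)
    proof (induction J rule: finite_induct)
      case empty
      then show ?case using base[of i 0] i by (simp add: polynomials_zero)
    next
      case (insert j J)
      then have "p j \<in> Q i" using p[of j] mono[of "Suc j" i] i by auto
      then show ?case using insert i by (auto intro!: add mult polynomials_const)
    qed
    from this[of "{..<i}"] show ?thesis by (simp add: P_def)
  qed
  define T where "T = P + monom 0 (z i) * p i"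
  have pC: "p j \<in> C" if "j < d" for j using p[OF that] by (simp add: Q_def)
  have TC: "T \<in> C"
    using P pC[OF i(1)] by (auto simp: T_def Q_def intro!: polynomials_add polynomials_mult polynomials_const)
  have "keys T \<subseteq> U'"
  proof
    fix a assume a: "a \<in> keys T"
    have "T \<in> Q (Suc i)"
      unfolding T_def using P p[OF i(1)] mono[of i "Suc i"] i by (intro add mult polynomials_const) auto
    then have "a \<in> saturated \<union> U'" using a by (auto simp: Q_def)
    moreover have "a \<notin> saturated"
    proof
      assume "a \<in> saturated"
      have "lookup T a = (\<Sum>j<Suc i. z j * lookup (p j) a)"
        by (simp add: T_def P_def lookup_add lookup_sum lookup_const_mult)
      also have "\<dots> = (\<Sum>j\<in>{..<d}. z j * lookup (p j) a)"
        using i imax by (intro sum.mono_neutral_left) (auto simp: not_less_eq)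
      also have "\<dots> = 0" using z(2) \<open>a \<in> saturated\<close> by blast
      finally show False using a by (simp add: in_keys_iff)
    qed
    ultimately show "a \<in> U'" by blast
  qed
  then have "T \<in> Q i" using base TC i by simp
  moreover have "monom 0 (- 1) * P \<in> Q i" using P i by (intro mult polynomials_const) auto
  ultimately have "T + monom 0 (- 1) * P \<in> Q i" using i by (intro add) auto
  moreover have "monom 0 (- 1) * P = - P"
    by (intro poly_mapping_eqI) (simp add: lookup_const_mult)
  ultimately have zp: "monom 0 (z i) * p i \<in> Q i" by (simp add: T_def)
  have "monom 0 (inverse (z i)) * (monom 0 (z i) * p i) \<in> Q i"
    by (rule mult[OF less_imp_le[OF i(1)] zp polynomials_const])
  moreover have "monom 0 (inverse (z i)) * (monom 0 (z i) * p i) = p i"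
    using i(2) by (simp add: mult.assoc[symmetric] mult_single)
  ultimately show False using p[OF i(1)] by simp
qed

lemma module_length_H:
  assumes fin: "finite saturated"
  shows "module_length R H = enat (card saturated)"
  unfolding module_length_def
proof (rule antisym)
  show "Sup {enat d | d. \<exists>N. (\<forall>i\<le>d. submodule (N i) R H) \<and> (\<forall>i<d. N i \<subset> N (Suc i))} \<le> enat (card saturated)"
    using submodule_chain_bound[OF fin] by (intro Sup_least) fastforce
  show "enat (card saturated) \<le> Sup {enat d | d. \<exists>N. (\<forall>i\<le>d. submodule (N i) R H) \<and> (\<forall>i<d. N i \<subset> N (Suc i))}"
    using submodule_chain[OF fin] by (intro Sup_upper) blast
qed

end

section \<open>The $j$-multiplicity of an edge ideal\<close>

locale edge_polynomials =
  G: uniform_components V E m Us + L: local_polynomials V k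
  for V :: "'v set" and E m Us and k :: "'k::field itself"
begin

text \<open>Passing to the next power adds one edge; conversely an edge of positive multiplicity is
  split off, and the quotient still dominates the remaining edges.\<close>

lemma mpow_above: "L.mpow (L.above E) t = {a \<in> monomials V. G.dominates t (lookup a)}"
proof (induction t)
  case 0
  then show ?case by (auto simp: G.dominates_def intro!: exI[of _ "\<lambda>_. 0"] simp: G.inc_def)
next
  case (Suc t)
  let ?e = "\<lambda>e f. if f = e then 1 else 0 :: nat"
  show ?case
  proof (intro equalityI subsetI)
    fix a assume "a \<in> L.mpow (L.above E) (Suc t)"
    then obtain b d where bd: "b \<in> monomials V" "G.dominates t (lookup b)" "d \<in> L.above E" "a = b + d"
      using Suc by (auto simp: L.msum_def)
    then obtain c where c: "t \<le> sum c E" "\<forall>x\<in>V. G.inc c x \<le> lookup b x"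
      unfolding G.dominates_def by blast
    obtain e where e: "e \<in> E" "e \<subseteq> keys d" and dV: "d \<in> monomials V"
      using bd(3) by (auto simp: L.above_def)
    have "Suc t \<le> sum (\<lambda>f. c f + ?e e f) E"
      using c(1) e(1) G.finite_E by (simp add: sum.distrib)
    moreover have "G.inc (\<lambda>f. c f + ?e e f) x \<le> lookup a x" if x: "x \<in> V" for x
    proof -
      have "(if x \<in> e then 1 else 0) \<le> lookup d x"
        using e(2) by (auto simp: in_keys_iff)
      then show ?thesis
        using c(2) x unfolding bd(4) lookup_add G.inc_add G.inc_single[OF e(1)] by (intro add_mono) auto
    qed
    ultimately have "G.dominates (Suc t) (lookup a)"
      unfolding G.dominates_def by blast
    then show "a \<in> {a \<in> monomials V. G.dominates (Suc t) (lookup a)}"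
      using bd dV by simp
  next
    fix a assume "a \<in> {a \<in> monomials V. G.dominates (Suc t) (lookup a)}"
    then obtain c where aV: "a \<in> monomials V" and c: "Suc t \<le> sum c E" "\<forall>x\<in>V. G.inc c x \<le> lookup a x"
      unfolding G.dominates_def by blast
    have "\<exists>e\<in>E. c e \<noteq> 0"
    proof (rule ccontr)
      assume "\<not> (\<exists>e\<in>E. c e \<noteq> 0)"
      then have "sum c E = 0" by simp
      then show False using c(1) by simp
    qed
    then obtain e where e: "e \<in> E" "c e > 0" by auto
    define c' where "c' f = c f - ?e e f" for f
    have cc: "c = (\<lambda>f. c' f + ?e e f)" using e(2) by (auto simp: c'_def)
    have inc: "G.inc c x = G.inc c' x + (if x \<in> e then 1 else 0)" for x
      by (subst cc) (simp add: G.inc_add G.inc_single[OF e(1)])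
    have "sum c E = sum c' E + 1"
      by (subst cc) (use e(1) G.finite_E in \<open>simp add: sum.distrib\<close>)
    then have c't: "t \<le> sum c' E" using c(1) by simp
    let ?h = "\<lambda>x. if x \<in> e then 1 else 0 :: nat"
    have "?h x \<le> lookup a x" if "x \<in> V" for x
      using bspec[OF c(2) that] inc[of x] by simp
    then obtain b where b: "b \<in> monomials V" "a = monomial_of V ?h + b"
      using monomials_diff[OF G.finite_V aV, of ?h] by blast
    have "G.inc c' x \<le> lookup b x" if "x \<in> V" for x
      using bspec[OF c(2) that] inc[of x] that
      by (simp add: b(2) lookup_add lookup_monomial_of[OF G.finite_V])
    then have "G.dominates t (lookup b)"
      unfolding G.dominates_def using c't by blast
    then have "b \<in> L.mpow (L.above E) t" using Suc b by simp
    moreover have "monomial_of V ?h \<in> L.above E"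
      using e(1) G.edge_subset[OF e(1)] G.finite_V
      by (auto simp: L.above_def monomial_of_mem in_keys_iff lookup_monomial_of intro!: bexI[of _ e])
    ultimately show "a \<in> L.mpow (L.above E) (Suc t)"
      using b(2) by (auto simp: L.msum_def add.commute)
  qed
qed

lemma length_gr:
  "module_length L.R (local_cohomology_0 L.R (max_ideal L.R)
    (quotient_module (ideal_module L.R (ideal_power L.R (L.ext (L.above E)) t)) (ideal_power L.R (L.ext (L.above E)) (t + 1))))
   = enat (card (G.torsion t))"
proof -
  let ?U = "\<lambda>t. L.mpow (L.above E) t"
  have "?U (Suc t) \<subseteq> ?U t"
    unfolding mpow_above G.dominates_def by (auto intro: Suc_leD)
  then interpret Q: monomial_quotient V k "?U t" "?U (Suc t)"
    using L.up_closed_mpow[OF L.up_closed_above]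
    by (intro monomial_quotient.intro L.local_polynomials_axioms monomial_quotient_axioms.intro)
  have shift: "lookup (a + monom x N) = (lookup a)(x := lookup a x + N)" for a :: "'v \<Rightarrow>\<^sub>0 nat" and x N
    by (auto simp: fun_eq_iff lookup_add lookup_single when_def)
  have shiftV: "a + monom x N \<in> monomials V" if "a \<in> monomials V" "x \<in> V" for a x N
    using that by (simp add: monomials_def keys_add_nat)
  have outside: "lookup a x = 0" if "a \<in> monomials V" "x \<notin> V" for a x
    using that in_keys_iff[of x a] by (auto simp: monomials_def)
  have sat: "a \<in> Q.saturated \<longleftrightarrow> a \<in> monomials V \<and> lookup a \<in> G.torsion t" for a
    unfolding Q.saturated_def unfolding mpow_above G.torsion_def using shiftV[of a] outside[of a] by (auto simp: shift)
  have "bij_betw lookup Q.saturated (G.torsion t)"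
  proof (rule bij_betw_byWitness[of _ "monomial_of V"])
    have sV: "a \<in> monomials V" if "a \<in> Q.saturated" for a
      using that sat by blast
    show "\<forall>a\<in>Q.saturated. monomial_of V (lookup a) = a"
      using sV G.finite_V by (auto intro!: monomials_eqI[of _ V] simp: monomial_of_mem lookup_monomial_of)
    have lm: "lookup (monomial_of V h) = h" if "h \<in> G.torsion t" for h
      using that G.finite_V by (auto simp: fun_eq_iff lookup_monomial_of G.torsion_def)
    then show "\<forall>h\<in>G.torsion t. lookup (monomial_of V h) = h" by blast
    show "lookup ` Q.saturated \<subseteq> G.torsion t"
      using sat by blast
    show "monomial_of V ` G.torsion t \<subseteq> Q.saturated"
      using sat lm monomial_of_mem[OF G.finite_V] by auto
  qed
  then have "card Q.saturated = card (G.torsion t)" "finite Q.saturated"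
    using bij_betw_same_card bij_betw_finite G.finite_torsion by blast+
  then show ?thesis
    using Q.module_length_H L.ideal_power_ext[OF L.up_closed_above] by simp
qed

lemma j_multiplicity_limit:
  assumes "(\<lambda>t. real (card (G.torsion t)) / real t ^ (card V - 1)) \<longlonglongrightarrow> l"
  shows "j_multiplicity L.R (L.ext (L.above E)) = ereal (fact (card V - 1) * l)"
proof -
  let ?d = "card V - 1"
  have "(\<lambda>t. ereal (real (card (G.torsion t)) / real t ^ ?d)) \<longlonglongrightarrow> ereal l"
    using assms by (rule tendsto_ereal)
  \<comment> \<open>Division by 0 gives 0 for reals but not in general for extended reals, so the
    index \<open>t = 0\<close> is left out.\<close>
  moreover have "\<forall>\<^sub>F t in sequentially. ereal (real (card (G.torsion t)) / real t ^ ?d)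
    = ereal_of_enat (enat (card (G.torsion t))) / ereal (real t ^ ?d)"
    using eventually_gt_at_top[of 0] by eventually_elim simp
  ultimately have "(\<lambda>t. ereal_of_enat (enat (card (G.torsion t))) / ereal (real t ^ ?d)) \<longlonglongrightarrow> ereal l"
    by (rule Lim_transform_eventually)
  then have "lim (\<lambda>t. ereal_of_enat (enat (card (G.torsion t))) / ereal (real t ^ ?d)) = ereal l"
    by (rule limI)
  then show ?thesis
    unfolding j_multiplicity_def Let_def L.krull_dim_R length_gr by simp
qed

lemma j_multiplicity_edge_ideal:
  "j_multiplicity L.R (L.ext (L.above E)) = (if G.nonsingular then ereal (real m ^ card Us) else 0)"
  using j_multiplicity_limit[OF G.nonsingular_torsion_asymp] j_multiplicity_limit[OF G.singular_torsion_asymp]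
  by (simp flip: zero_ereal_def)

end

section \<open>From the hypergraph to the counting setting\<close>

lemma successively_rtrancl:
  assumes "successively P es" "es \<noteq> []" "set es \<subseteq> X"
  shows "(hd es, last es) \<in> {(e, f). e \<in> X \<and> f \<in> X \<and> P e f}\<^sup>*"
  using assms
proof (induction es)
  case (Cons e es)
  show ?case
  proof (cases "es = []")
    case False
    then have path: "(hd es, last es) \<in> {(e, f). e \<in> X \<and> f \<in> X \<and> P e f}\<^sup>*"
      using Cons by (simp add: successively_Cons)
    have "(e, hd es) \<in> {(e, f). e \<in> X \<and> f \<in> X \<and> P e f}"
      using Cons.prems False hd_in_set[OF False] by (auto simp: successively_Cons)
    from converse_rtrancl_into_rtrancl[OF this path] show ?thesis
      using False by simp
  qed simp
qed simp

definition connection :: "'v hypergraph \<Rightarrow> ('v \<times> 'v) set" where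
  "connection G = {(x, y). x \<in> nodes G \<and> y \<in> nodes G \<and> (x = y \<or> joined G x y)}"

lemma components_connection: "components G = induced G ` (nodes G // connection G)"
  by (simp add: components_def connection_def)

lemma joined_edge: "e \<in> edges G \<Longrightarrow> x \<in> e \<Longrightarrow> y \<in> e \<Longrightarrow> joined G x y"
  unfolding joined_def by (intro exI[of _ "[e]"]) simp

lemma equiv_connection: "equiv (nodes G) (connection G)"
proof (rule equivI)
  show "connection G \<subseteq> nodes G \<times> nodes G" by (auto simp: connection_def)
  show "refl_on (nodes G) (connection G)" by (auto simp: refl_on_def connection_def)
  have "joined G y x" if xy: "joined G x y" for x y
  proof -
    obtain es where es: "es \<noteq> []" "set es \<subseteq> edges G" "x \<in> hd es" "y \<in> last es"
      "successively (\<lambda>e f. e \<inter> f \<noteq> {}) es"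
      using xy unfolding joined_def by blast
    then show ?thesis
      unfolding joined_def by (intro exI[of _ "rev es"]) (auto simp: hd_rev last_rev Int_commute)
  qed
  then show "sym (connection G)" by (auto simp: sym_def connection_def)
  have "joined G x z" if xy: "joined G x y" and yz: "joined G y z" for x y z
  proof -
    obtain es where es: "es \<noteq> []" "set es \<subseteq> edges G" "x \<in> hd es" "y \<in> last es"
      "successively (\<lambda>e f. e \<inter> f \<noteq> {}) es"
      using xy unfolding joined_def by blast
    obtain fs where fs: "fs \<noteq> []" "set fs \<subseteq> edges G" "y \<in> hd fs" "z \<in> last fs"
      "successively (\<lambda>e f. e \<inter> f \<noteq> {}) fs"
      using yz unfolding joined_def by blast
    show ?thesis
      unfolding joined_def using es fs
      by (intro exI[of _ "es @ fs"]) (auto simp: successively_append_iff)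
  qed
  then show "trans (connection G)" by (auto simp: trans_def connection_def)
qed

text \<open>An induced hypergraph remembers its node set, so components correspond one to one to
  equivalence classes.\<close>

lemma card_components: "card (components G) = card (nodes G // connection G)"
proof -
  have "inj (induced G)"
    by (rule injI) (metis hypergraph.select_convs(1) induced_def)
  then show ?thesis
    unfolding components_connection by (intro card_image) (auto intro: inj_on_subset)
qed

lemma uniform_componentsI:
  assumes G: "hypergraph G" "no_isolated_nodes G" and m: "m \<ge> 1" "uniform m G"
    and pc: "\<forall>H\<in>components G. properly_connected m H"
    and card: "card (edges G) = card (nodes G)"
  shows "uniform_components (nodes G) (edges G) m (nodes G // connection G)"
proof
  show "finite (nodes G)" "nodes G \<noteq> {}" using G by (auto simp: hypergraph_def)
  show "partition_on (nodes G) (nodes G // connection G)"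
    by (rule partition_on_quotient[OF equiv_connection])
  show "card e = m" if "e \<in> edges G" for e
    using that m by (auto simp: uniform_def)
  show "\<exists>e\<in>edges G. x \<in> e" if "x \<in> nodes G" for x
    using that G by (auto simp: no_isolated_nodes_def)
  show "\<exists>U\<in>nodes G // connection G. e \<subseteq> U" if e: "e \<in> edges G" for e
  proof -
    have eV: "e \<subseteq> nodes G" using e G by (auto simp: hypergraph_def)
    have "card e = m" using e m by (auto simp: uniform_def)
    \<comment> \<open>Edges are nonempty because \<open>m \<ge> 1\<close>; the class of any node of
      an edge contains the whole edge.\<close>
    then obtain x where x: "x \<in> e" using m(1) by fastforce
    have "e \<subseteq> connection G `` {x}"
      using joined_edge[OF e x] x eV by (auto simp: connection_def)
    then show ?thesis using x eV by (intro bexI[of _ "connection G `` {x}"]) (auto intro: quotientI)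
  qed
  show "(e, f) \<in> {(e, f). e \<in> edges G \<and> f \<in> edges G \<and> e \<subseteq> U \<and> f \<subseteq> U \<and> card (e \<inter> f) = m - 1}\<^sup>*"
    if U: "U \<in> nodes G // connection G" and ef: "e \<in> edges G" "f \<in> edges G" "e \<subseteq> U" "f \<subseteq> U" for U e f
  proof -
    let ?H = "induced G U"
    have H: "edges ?H = {e \<in> edges G. e \<subseteq> U}" by (simp add: induced_def)
    have "properly_connected m ?H" using pc U by (auto simp: components_connection)
    then have "\<forall>u\<in>edges ?H. \<forall>v\<in>edges ?H. \<exists>es. es \<noteq> [] \<and> set es \<subseteq> edges ?H \<and> hd es = u \<and> last es = v \<and>
        successively (\<lambda>e f. card (e \<inter> f) = m - 1) es"
      by (simp add: properly_connected_def)
    moreover have "e \<in> edges ?H" "f \<in> edges ?H" using ef by (simp_all add: H)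
    ultimately have "\<exists>es. es \<noteq> [] \<and> set es \<subseteq> edges ?H \<and> hd es = e \<and> last es = f \<and>
        successively (\<lambda>e f. card (e \<inter> f) = m - 1) es"
      by blast
    then obtain es where es: "es \<noteq> []" "set es \<subseteq> edges ?H" "hd es = e" "last es = f"
      "successively (\<lambda>e f. card (e \<inter> f) = m - 1) es"
      by (elim exE conjE)
    have "(e, f) \<in> {(e, f). e \<in> edges ?H \<and> f \<in> edges ?H \<and> card (e \<inter> f) = m - 1}\<^sup>*"
      using successively_rtrancl[OF es(5,1,2)] es(3,4) by simp
    then show ?thesis
      by (rule rev_subsetD[OF _ rtrancl_mono]) (auto simp: H)
  qed
  show "card (edges G) = card (nodes G)" by (rule card)
  show "m \<ge> 1" by (rule m(1))
qed

theorem proposition8p2: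
  fixes G :: "'v hypergraph" and m c :: nat
  assumes "hypergraph G" and "no_isolated_nodes G"
    and "m \<ge> 1" and "uniform m G"
    and "\<forall>H\<in>components G. properly_connected m H"
    and "card (edges G) = card (nodes G)"
    and "card (components G) = c"
    and "j_multiplicity (node_ring TYPE('k::field) G) (edge_ideal TYPE('k) G) \<noteq> 0"
  shows "j_multiplicity (node_ring TYPE('k) G) (edge_ideal TYPE('k) G) = ereal (real m ^ c)"
proof -
  interpret G: uniform_components "nodes G" "edges G" m "nodes G // connection G"
    by (rule uniform_componentsI) (use assms in auto)
  interpret L: local_polynomials "nodes G" "TYPE('k)"
    by unfold_locales (rule G.finite_V)
  interpret J: edge_polynomials "nodes G" "edges G" m "nodes G // connection G" "TYPE('k)" ..
  have I: "edge_ideal TYPE('k) G = L.ext (L.above (edges G))"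
    unfolding edge_ideal_def node_ring_def by (rule L.genideal_edges[OF G.edge_subset])
  have "j_multiplicity (node_ring TYPE('k) G) (edge_ideal TYPE('k) G)
    = (if G.nonsingular then ereal (real m ^ c) else 0)"
    unfolding I unfolding node_ring_def J.j_multiplicity_edge_ideal
    using assms(7) card_components[of G] by simp
  \<comment> \<open>The assumption that the multiplicity is nonzero excludes the case of dependent
    edges.\<close>
  then show ?thesis using assms(8) by (simp split: if_splits)
qed

end
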